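(* Let $K$ be a one-dimensional analytic $k$-field and let $t\in K$ be a tame parameter. Then: (i) $\widehat\Omega_{K/k}$ is a one-dimensional $K$-vector space with basis $dt$, and $|dt|_\Omega=r_t$. (ii) The natural map $\widehat\Omega_{K^\circ/k^\circ}\to\widehat\Omega_{K/k}$ is injective, and its image is the $K^\circ$-submodule of $\widehat\Omega_{K/k}$ generated by the elements $\frac{dt}{c}$, where $c$ runs over the elements of $k^\times$ for which there exists $a\in k$ with $|t-a|\le|c|$.
   Context: $k$ is an algebraically closed field, complete with respect to a nontrivial non-archimedean absolute value $|\cdot|$ with values in $\mathbb R_{\ge0}$; $k^\circ$ is its ring of integers. An analytic $k$-field is a complete real-valued field extension of $k$; it is one-dimensional if it is finite over the completion $\widehat{k(t)}$ of a subfield $k(t)$ with $t\notin k$. For $K$ one-dimensional and $t\in K\setminus k$, $K/\widehat{k(t)}$ is finite; $t$ is a parameter if this extension is separable and a tame parameter if it is tamely ramified (as an extension of valued fields). The radius of $t$ is $r_t=\inf_{c\in k}|t-c|$. For an extension of real-valued fields $l/k$, the Kähler seminorm $|\cdot|_\Omega$ on $\Omega_{l/k}$ is the maximal $l$-seminorm such that $d:l\to\Omega_{l/k}$ is contracting (i.e. $|df|_\Omega\le|f|$); $\widehat\Omega_{l/k}$ denotes the completion with respect to it (with induced norm, also denoted $|\cdot|_\Omega$). For a valued field $K$, $K^\circ$ is its ring of integers and $\widehat\Omega_{K^\circ/k^\circ}$ is the $\pi$-adic completion of $\Omega_{K^\circ/k^\circ}$ for any $0\ne\pi$ with $|\pi|<1$.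 *)

theory Defs
  imports Complex_Main "HOL-Computational_Algebra.Polynomial" "HOL-Computational_Algebra.Primes"
begin

text \<open>Conventions. The one-dimensional analytic field K is the whole type 'a (a field),
 carrying a real-valued non-archimedean absolute value v.  The base field k is a subset of 'a.\<close>

definition nonarch_abs :: "('a::field \<Rightarrow> real) \<Rightarrow> bool" where
  "nonarch_abs v \<longleftrightarrow> (\<forall>x. 0 \<le> v x) \<and> (\<forall>x. v x = 0 \<longleftrightarrow> x = 0)
     \<and> (\<forall>x y. v (x * y) = v x * v y) \<and> (\<forall>x y. v (x + y) \<le> max (v x) (v y))"

definition v_cauchy :: "('a::field \<Rightarrow> real) \<Rightarrow> (nat \<Rightarrow> 'a) \<Rightarrow> bool" where
  "v_cauchy v X \<longleftrightarrow> (\<forall>e>0. \<exists>N. \<forall>m\<ge>N. \<forall>n\<ge>N. v (X m - X n) < e)"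

definition v_complete_on :: "('a::field \<Rightarrow> real) \<Rightarrow> 'a set \<Rightarrow> bool" where
  "v_complete_on v S \<longleftrightarrow> (\<forall>X. (\<forall>n. X n \<in> S) \<and> v_cauchy v X \<longrightarrow>
       (\<exists>L\<in>S. (\<lambda>n. v (X n - L)) \<longlonglongrightarrow> 0))"

definition is_subfield :: "('a::field) set \<Rightarrow> bool" where
  "is_subfield S \<longleftrightarrow> 0 \<in> S \<and> 1 \<in> S \<and> (\<forall>x\<in>S. \<forall>y\<in>S. x + y \<in> S \<and> x * y \<in> S)
     \<and> (\<forall>x\<in>S. - x \<in> S \<and> inverse x \<in> S)"

definition poly_over :: "('a::comm_ring_1) set \<Rightarrow> 'a poly \<Rightarrow> bool" where
  "poly_over S p \<longleftrightarrow> (\<forall>i. coeff p i \<in> S)"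

definition alg_closed_in :: "('a::field) set \<Rightarrow> bool" where
  "alg_closed_in k \<longleftrightarrow> (\<forall>p. poly_over k p \<and> degree p > 0 \<longrightarrow> (\<exists>x\<in>k. poly p x = 0))"

definition analytic_k_field :: "('a::field \<Rightarrow> real) \<Rightarrow> 'a set \<Rightarrow> bool" where
  "analytic_k_field v k \<longleftrightarrow> nonarch_abs v \<and> v_complete_on v UNIV \<and> is_subfield k
     \<and> alg_closed_in k \<and> v_complete_on v k \<and> (\<exists>x\<in>k. v x \<noteq> 0 \<and> v x \<noteq> 1)"

definition rat_fun_field :: "('a::field) set \<Rightarrow> 'a \<Rightarrow> 'a set" where
  "rat_fun_field k t = {poly p t / poly q t | p q. poly_over k p \<and> poly_over k q \<and> poly q t \<noteq> 0}"

text \<open>Completion of k(t), realised as its closure inside the complete field K.\<close>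
definition v_closure :: "('a::field \<Rightarrow> real) \<Rightarrow> 'a set \<Rightarrow> 'a set" where
  "v_closure v S = {x. \<forall>e>0. \<exists>y\<in>S. v (x - y) < e}"

definition compl_kt :: "('a::field \<Rightarrow> real) \<Rightarrow> 'a set \<Rightarrow> 'a \<Rightarrow> 'a set" where
  "compl_kt v k t = v_closure v (rat_fun_field k t)"

definition is_basis_over :: "('a::field) set \<Rightarrow> nat \<Rightarrow> (nat \<Rightarrow> 'a) \<Rightarrow> bool" where
  "is_basis_over F n b \<longleftrightarrow>
     (\<forall>a. (\<forall>i<n. a i \<in> F) \<and> (\<Sum>i<n. a i * b i) = 0 \<longrightarrow> (\<forall>i<n. a i = 0))
   \<and> (\<forall>x. \<exists>a. (\<forall>i<n. a i \<in> F) \<and> x = (\<Sum>i<n. a i * b i))"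

definition finite_over :: "('a::field) set \<Rightarrow> bool" where
  "finite_over F \<longleftrightarrow> (\<exists>n b. is_basis_over F n b)"

definition separable_elem :: "('a::field) set \<Rightarrow> 'a \<Rightarrow> bool" where
  "separable_elem F x \<longleftrightarrow> (\<exists>p. poly_over F p \<and> p \<noteq> 0 \<and> poly p x = 0 \<and>
      (\<exists>a b. poly_over F a \<and> poly_over F b \<and> a * p + b * pderiv p = 1))"

definition separable_over :: "('a::field) set \<Rightarrow> bool" where
  "separable_over F \<longleftrightarrow> (\<forall>x. separable_elem F x)"

definition ring_int :: "('a::field \<Rightarrow> real) \<Rightarrow> 'a set \<Rightarrow> 'a set" where
  "ring_int v S = {x \<in> S. v x \<le> 1}"

text \<open>Elements b 0..b (n-1) of K\<degree> whose residues form a basis of the residue field of K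
  over the residue field of F.\<close>
definition res_basis :: "('a::field \<Rightarrow> real) \<Rightarrow> 'a set \<Rightarrow> nat \<Rightarrow> (nat \<Rightarrow> 'a) \<Rightarrow> bool" where
  "res_basis v F n b \<longleftrightarrow> (\<forall>i<n. v (b i) \<le> 1)
   \<and> (\<forall>a. (\<forall>i<n. a i \<in> ring_int v F) \<and> v (\<Sum>i<n. a i * b i) < 1 \<longrightarrow> (\<forall>i<n. v (a i) < 1))
   \<and> (\<forall>y. v y \<le> 1 \<longrightarrow> (\<exists>a. (\<forall>i<n. a i \<in> ring_int v F) \<and> v (y - (\<Sum>i<n. a i * b i)) < 1))"

text \<open>Separability of the residue field extension: every residue class of K is a root of the
  reduction of a monic polynomial over F\<degree> whose reduction is separable.\<close>
definition res_separable :: "('a::field \<Rightarrow> real) \<Rightarrow> 'a set \<Rightarrow> bool" where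
  "res_separable v F \<longleftrightarrow> (\<forall>y. v y \<le> 1 \<longrightarrow> (\<exists>P A B.
      poly_over (ring_int v F) P \<and> poly_over (ring_int v F) A \<and> poly_over (ring_int v F) B
      \<and> lead_coeff P = 1 \<and> v (poly P y) < 1
      \<and> (\<forall>i. v (coeff (A * P + B * pderiv P - 1) i) < 1)))"

definition val_group :: "('a::field \<Rightarrow> real) \<Rightarrow> 'a set \<Rightarrow> real set" where
  "val_group v S = {v x | x. x \<in> S \<and> x \<noteq> 0}"

text \<open>The cosets of |F^\<times>| in |K^\<times>|; their number is the ramification index.\<close>
definition ram_cosets :: "('a::field \<Rightarrow> real) \<Rightarrow> 'a set \<Rightarrow> real set set" where
  "ram_cosets v F = (\<lambda>g. (\<lambda>h. g * h) ` val_group v F) ` val_group v UNIV"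

text \<open>K/F tamely ramified: residue extension separable, ramification index prime to the
  residue characteristic, and no defect ([K:F] = e f).\<close>
definition tamely_ramified :: "('a::field \<Rightarrow> real) \<Rightarrow> 'a set \<Rightarrow> bool" where
  "tamely_ramified v F \<longleftrightarrow> res_separable v F \<and> finite (ram_cosets v F)
   \<and> (\<forall>p::nat. prime p \<and> v (of_nat p) < 1 \<longrightarrow> \<not> p dvd card (ram_cosets v F))
   \<and> (\<exists>n b f c. is_basis_over F n b \<and> res_basis v F f c \<and> n = card (ram_cosets v F) * f)"

definition one_dimensional :: "('a::field \<Rightarrow> real) \<Rightarrow> 'a set \<Rightarrow> bool" where
  "one_dimensional v k \<longleftrightarrow> (\<exists>t. t \<notin> k \<and> finite_over (compl_kt v k t))"

definition tame_parameter :: "('a::field \<Rightarrow> real) \<Rightarrow> 'a set \<Rightarrow> 'a \<Rightarrow> bool" where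
  "tame_parameter v k t \<longleftrightarrow> t \<notin> k \<and> finite_over (compl_kt v k t)
     \<and> separable_over (compl_kt v k t) \<and> tamely_ramified v (compl_kt v k t)"

definition radius :: "('a::field \<Rightarrow> real) \<Rightarrow> 'a set \<Rightarrow> 'a \<Rightarrow> real" where
  "radius v k t = (INF c\<in>k. v (t - c))"

text \<open>A formal sum \<Sum> w(f) [f] is a finitely supported function 'a \<Rightarrow> 'a (coefficient of symbol [f]).
  fs_ok A B w: support in A, coefficients in B.\<close>
definition fs_ok :: "('a::field) set \<Rightarrow> 'a set \<Rightarrow> ('a \<Rightarrow> 'a) \<Rightarrow> bool" where
  "fs_ok A B w \<longleftrightarrow> finite {f. w f \<noteq> 0} \<and> (\<forall>f. w f \<noteq> 0 \<longrightarrow> f \<in> A) \<and> (\<forall>f. w f \<in> B)"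

definition dsym :: "'a::field \<Rightarrow> ('a \<Rightarrow> 'a)" where
  "dsym f = (\<lambda>g. if g = f then 1 else 0)"

definition fadd :: "('a::field \<Rightarrow> 'a) \<Rightarrow> ('a \<Rightarrow> 'a) \<Rightarrow> ('a \<Rightarrow> 'a)" where
  "fadd w u = (\<lambda>g. w g + u g)"

definition fsub :: "('a::field \<Rightarrow> 'a) \<Rightarrow> ('a \<Rightarrow> 'a) \<Rightarrow> ('a \<Rightarrow> 'a)" where
  "fsub w u = (\<lambda>g. w g - u g)"

definition fscale :: "'a::field \<Rightarrow> ('a \<Rightarrow> 'a) \<Rightarrow> ('a \<Rightarrow> 'a)" where
  "fscale a w = (\<lambda>g. a * w g)"

definition kahler_rels :: "('a::field) set \<Rightarrow> 'a set \<Rightarrow> ('a \<Rightarrow> 'a) set" where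
  "kahler_rels A c0 =
     {fsub (fsub (dsym (f + g)) (dsym f)) (dsym g) | f g. f \<in> A \<and> g \<in> A}
   \<union> {fsub (fsub (dsym (f * g)) (fscale f (dsym g))) (fscale g (dsym f)) | f g. f \<in> A \<and> g \<in> A}
   \<union> {dsym c | c. c \<in> c0}"

definition span_over :: "('a::field) set \<Rightarrow> ('a \<Rightarrow> 'a) set \<Rightarrow> ('a \<Rightarrow> 'a) set" where
  "span_over B S = {w. \<exists>(n::nat) b r. (\<forall>i<n. b i \<in> B \<and> r i \<in> S) \<and> w = (\<lambda>g. \<Sum>i<n. b i * r i g)}"

text \<open>Admissible seminorms on \<Omega>_{K/k} (as functions on representatives, constant on classes):
  non-archimedean K-seminorms for which d is contracting.\<close>
definition kahler_adm :: "('a::field \<Rightarrow> real) \<Rightarrow> 'a set \<Rightarrow> (('a \<Rightarrow> 'a) \<Rightarrow> real) \<Rightarrow> bool" where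
  "kahler_adm v k p \<longleftrightarrow>
     (\<forall>w. 0 \<le> p w)
   \<and> (\<forall>w u. fs_ok UNIV UNIV w \<and> fs_ok UNIV UNIV u \<longrightarrow> p (fadd w u) \<le> max (p w) (p u))
   \<and> (\<forall>a w. fs_ok UNIV UNIV w \<longrightarrow> p (fscale a w) = v a * p w)
   \<and> (\<forall>w u. fs_ok UNIV UNIV w \<and> fs_ok UNIV UNIV u \<and> fsub w u \<in> span_over UNIV (kahler_rels UNIV k)
            \<longrightarrow> p w = p u)
   \<and> (\<forall>f. p (dsym f) \<le> v f)"

definition kahler_sn :: "('a::field \<Rightarrow> real) \<Rightarrow> 'a set \<Rightarrow> ('a \<Rightarrow> 'a) \<Rightarrow> real" where
  "kahler_sn v k w = (SUP p\<in>{p. kahler_adm v k p}. p w)"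

text \<open>Cauchy sequences in \<Omega>_{K/k}; the completion is given by them modulo null sequences.\<close>
definition om_cauchy :: "('a::field \<Rightarrow> real) \<Rightarrow> 'a set \<Rightarrow> (nat \<Rightarrow> ('a \<Rightarrow> 'a)) \<Rightarrow> bool" where
  "om_cauchy v k X \<longleftrightarrow> (\<forall>n. fs_ok UNIV UNIV (X n)) \<and>
     (\<forall>e>0. \<exists>N. \<forall>m\<ge>N. \<forall>n\<ge>N. kahler_sn v k (fsub (X m) (X n)) < e)"

text \<open>\<Omega>_{K\<degree>/k\<degree>}: formal sums with symbols and coefficients in K\<degree>, modulo the K\<degree>-span
  of the relations; pi_pow_sub N = image of \<pi>^N \<Omega>_{K\<degree>/k\<degree>} (as set of representatives).\<close>
definition pi_pow_sub :: "('a::field \<Rightarrow> real) \<Rightarrow> 'a set \<Rightarrow> 'a \<Rightarrow> nat \<Rightarrow> ('a \<Rightarrow> 'a) set" where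
  "pi_pow_sub v k \<pi> N = {w. fs_ok (ring_int v UNIV) (ring_int v UNIV) w \<and>
      (\<exists>u. fs_ok (ring_int v UNIV) (ring_int v UNIV) u \<and>
         fsub w (fscale (\<pi> ^ N) u) \<in> span_over (ring_int v UNIV) (kahler_rels (ring_int v UNIV) (ring_int v k)))}"

text \<open>\<pi>-adic Cauchy sequences in \<Omega>_{K\<degree>/k\<degree>} (the \<pi>-adic completion consists of them
  modulo \<pi>-adic null sequences).\<close>
definition pi_cauchy :: "('a::field \<Rightarrow> real) \<Rightarrow> 'a set \<Rightarrow> 'a \<Rightarrow> (nat \<Rightarrow> ('a \<Rightarrow> 'a)) \<Rightarrow> bool" where
  "pi_cauchy v k \<pi> Y \<longleftrightarrow> (\<forall>n. fs_ok (ring_int v UNIV) (ring_int v UNIV) (Y n)) \<and>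
     (\<forall>N. \<exists>M. \<forall>m\<ge>M. \<forall>n\<ge>M. fsub (Y m) (Y n) \<in> pi_pow_sub v k \<pi> N)"

end

theory Submission
  imports Defs "HOL-Library.Function_Algebras"
begin

text \<open>The derivation \<open>d/dt\<close> of \<open>k(t)\<close> satisfies \<open>v (D f) \<le> v f / r\<close> because k is algebraically
  closed, so that \<open>D f / f\<close> is a sum of terms \<open>\<plusminus>1 / (t - a)\<close>. It extends to the completion F by
  continuity and to K by separability; tameness provides an orthogonal basis of K over F consisting
  of products of units and radicals, on which a contraction argument shows that the bound persists.
  Hence \<open>r * v (\<Sum> w(f) D f)\<close> is an admissible seminorm of \<open>\<Sum> w(f) [f]\<close>. It is the largest one:
  \<open>df - (D f) dt\<close> has seminorm zero, first for f in \<open>k(t)\<close>, then in F and in K.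

  For the integral part, let p run through the elements \<open>(t - a) / c\<close> of the valuation ring. For y in
  the valuation ring of K and every nonzero \<open>\<eta>\<close> in that of k, if \<open>1 / c\<close> is large enough then
  \<open>dy - (Dy / Dp) dp\<close> lies in \<open>\<eta> \<Omega>\<close>. On \<open>k(t)\<close> this holds exactly, by factoring into linear
  terms; on F it follows by approximation, and on K by the same contraction argument as before.
  Therefore the seminorm controls divisibility by powers of \<open>\<pi>\<close>.\<close>

section \<open>Extension of derivations\<close>

text \<open>Two obstacles shape the argument. The radius \<open>r\<close> need not be attained and
  need not be a value of k, so the module in (ii) may have no generator and no single
  \<open>dp\<close> serves as a basis. Statements are therefore made for all sufficiently fine p,
  through the filter \<open>fine\<close>, and strict inequalities such as \<open>v y < 1\<close>
  create the room that is missing at the boundary. Constants filling that room exist because roots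
  make the value group of k divisible, hence dense.

  The other obstacle is division. Over K a separable equation \<open>P(y) = 0\<close> can be solved
  for \<open>dy\<close>. Over the valuation ring \<open>P'(y)\<close> may be a non-unit;
  separability of the residue extension supplies a P with unit \<open>P'(y)\<close>, but then
  \<open>P(y)\<close> is only small. The contraction makes this error harmless: a small element is a
  small constant times an integral one, so its differential gains that constant as a factor. The
  gain is uniform because only finitely many units have to be checked. Working modulo \<eta>
  \<Omega> lets this process stop after finitely many rounds.\<close>

definition derivation_on :: "'a::field set \<Rightarrow> ('a \<Rightarrow> 'a) \<Rightarrow> bool" where
  "derivation_on L D \<longleftrightarrow>
     (\<forall>x\<in>L. \<forall>y\<in>L. D (x + y) = D x + D y \<and> D (x * y) = x * D y + y * D x)"

lemma derivation_on_add: "derivation_on L D \<Longrightarrow> x \<in> L \<Longrightarrow> y \<in> L \<Longrightarrow> D (x + y) = D x + D y"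
  and derivation_on_mult: "derivation_on L D \<Longrightarrow> x \<in> L \<Longrightarrow> y \<in> L \<Longrightarrow> D (x * y) = x * D y + y * D x"
  by (auto simp: derivation_on_def)

lemma subfieldD:
  assumes "is_subfield S"
  shows subfield_zero: "0 \<in> S" and subfield_one: "1 \<in> S"
    and subfield_add: "x \<in> S \<Longrightarrow> y \<in> S \<Longrightarrow> x + y \<in> S"
    and subfield_mult: "x \<in> S \<Longrightarrow> y \<in> S \<Longrightarrow> x * y \<in> S"
    and subfield_minus: "x \<in> S \<Longrightarrow> - x \<in> S"
    and subfield_inverse: "x \<in> S \<Longrightarrow> inverse x \<in> S"
  using assms by (auto simp: is_subfield_def)

lemma subfield_diff: "is_subfield S \<Longrightarrow> x \<in> S \<Longrightarrow> y \<in> S \<Longrightarrow> x - y \<in> S"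
  using subfield_add[of S x "- y"] subfield_minus by force

lemma subfield_divide: "is_subfield S \<Longrightarrow> x \<in> S \<Longrightarrow> y \<in> S \<Longrightarrow> x / y \<in> S"
  by (simp add: divide_inverse subfield_mult subfield_inverse)

lemma subfield_power: "is_subfield S \<Longrightarrow> x \<in> S \<Longrightarrow> x ^ n \<in> S"
  by (induction n) (auto simp: subfield_one subfield_mult)

lemma subfield_sum: "is_subfield S \<Longrightarrow> (\<And>i. i \<in> I \<Longrightarrow> f i \<in> S) \<Longrightarrow> sum f I \<in> S"
  by (induction I rule: infinite_finite_induct) (auto simp: subfield_zero subfield_add)

lemma poly_over_0: "is_subfield S \<Longrightarrow> poly_over S 0"
  by (simp add: poly_over_def subfield_zero)

lemma poly_over_pCons_iff: "poly_over S (pCons a p) \<longleftrightarrow> a \<in> S \<and> poly_over S p"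
  by (auto simp: poly_over_def coeff_pCons split: nat.splits)

lemma poly_over_add: "is_subfield S \<Longrightarrow> poly_over S p \<Longrightarrow> poly_over S q \<Longrightarrow> poly_over S (p + q)"
  by (simp add: poly_over_def subfield_add)

lemma poly_over_minus: "is_subfield S \<Longrightarrow> poly_over S p \<Longrightarrow> poly_over S (- p)"
  by (simp add: poly_over_def subfield_minus)

lemma poly_over_diff: "is_subfield S \<Longrightarrow> poly_over S p \<Longrightarrow> poly_over S q \<Longrightarrow> poly_over S (p - q)"
  by (simp add: poly_over_def subfield_diff)

lemma poly_over_mult: "is_subfield S \<Longrightarrow> poly_over S p \<Longrightarrow> poly_over S q \<Longrightarrow> poly_over S (p * q)"
  by (auto simp: poly_over_def coeff_mult intro!: subfield_sum subfield_mult)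

lemma poly_over_monom: "is_subfield S \<Longrightarrow> a \<in> S \<Longrightarrow> poly_over S (monom a n)"
  by (auto simp: poly_over_def subfield_zero)

lemma poly_over_mono: "S \<subseteq> T \<Longrightarrow> poly_over S p \<Longrightarrow> poly_over T p"
  by (auto simp: poly_over_def)

lemma derivation_on_0:
  assumes "is_subfield L" "derivation_on L D"
  shows "D 0 = 0"
  using derivation_on_add[OF assms(2) subfield_zero subfield_zero] assms(1) by (metis add_cancel_right_left add_0)

lemma derivation_on_1:
  assumes "is_subfield L" "derivation_on L D"
  shows "D 1 = 0"
  using derivation_on_mult[OF assms(2) subfield_one subfield_one] assms(1) by (metis add_cancel_right_left mult_1)

lemma derivation_on_minus:
  assumes "is_subfield L" "derivation_on L D" "x \<in> L"
  shows "D (- x) = - D x"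
  using derivation_on_add[OF assms(2,3) subfield_minus[OF assms(1,3)]] derivation_on_0[OF assms(1,2)]
  by (simp add: minus_unique)

lemma derivation_on_diff:
  assumes "is_subfield L" "derivation_on L D" "x \<in> L" "y \<in> L"
  shows "D (x - y) = D x - D y"
  using derivation_on_add[OF assms(2,3) subfield_minus[OF assms(1,4)]] derivation_on_minus[OF assms(1,2,4)]
  by simp

lemma map_poly_deriv_add:
  assumes "is_subfield L" "derivation_on L D" "poly_over L p" "poly_over L q"
  shows "map_poly D (p + q) = map_poly D p + map_poly D q"
  using assms derivation_on_0[OF assms(1,2)]
  by (intro poly_eqI) (simp add: coeff_map_poly poly_over_def derivation_on_add)

text \<open>One half of the chain rule: together with the formal derivative it yields the derivation
  \<Delta> on polynomials by which a simple extension is treated.\<close>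

lemma poly_map_poly_deriv_mult:
  assumes "is_subfield L" "derivation_on L D" "poly_over L p" "poly_over L q"
  shows "poly (map_poly D (p * q)) y =
    poly p y * poly (map_poly D q) y + poly q y * poly (map_poly D p) y"
  using assms(3)
proof (induction p)
  case 0
  then show ?case by simp
next
  case (pCons a p)
  note D0 = derivation_on_0[OF assms(1,2)]
  have a: "a \<in> L" and p: "poly_over L p"
    using pCons.prems by (auto simp: poly_over_pCons_iff)
  have smult: "map_poly D (smult a q) = smult a (map_poly D q) + smult (D a) q"
    using assms a D0
    by (intro poly_eqI) (simp add: coeff_map_poly poly_over_def derivation_on_mult)
  have L: "poly_over L (smult a q)" "poly_over L (p * q)"
    using a p assms by (auto simp: poly_over_def[of _ "smult a q"] poly_over_def[of _ q] subfield_mult poly_over_mult)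
  have "poly_over L (pCons 0 (p * q))"
    using L assms by (simp add: poly_over_pCons_iff subfield_zero)
  then have "map_poly D (pCons a p * q) = map_poly D (smult a q) + map_poly D (pCons 0 (p * q))"
    using L assms by (simp add: map_poly_deriv_add)
  also have "poly \<dots> y = poly (pCons a p) y * poly (map_poly D q) y
      + poly q y * poly (map_poly D (pCons a p)) y"
    using pCons.IH[OF p] D0 by (simp add: smult map_poly_pCons algebra_simps)
  finally show ?case .
qed

text \<open>Euclidean division by the minimal polynomial P of y, carried out inside the derivation.\<close>
lemma derivation_vanishes_on_relations:
  fixes \<Delta> :: "'a::field poly \<Rightarrow> 'a"
  assumes L: "is_subfield L" and P: "poly_over L P" "P \<noteq> 0" "poly P y = 0"
    and min: "\<And>g. poly_over L g \<Longrightarrow> g \<noteq> 0 \<Longrightarrow> poly g y = 0 \<Longrightarrow> degree P \<le> degree g"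
    and add: "\<And>g h. poly_over L g \<Longrightarrow> poly_over L h \<Longrightarrow> \<Delta> (g + h) = \<Delta> g + \<Delta> h"
    and mult: "\<And>g h. poly_over L g \<Longrightarrow> poly_over L h \<Longrightarrow> \<Delta> (g * h) = poly g y * \<Delta> h + poly h y * \<Delta> g"
    and \<Delta>P: "\<Delta> P = 0"
    and "poly_over L g" "poly g y = 0"
  shows "\<Delta> g = 0"
  using assms(9,10)
proof (induction "degree g" arbitrary: g rule: less_induct)
  case less
  have \<Delta>0: "\<Delta> 0 = 0"
    using add[of 0 0] L by (metis add_cancel_right_left add_0 poly_over_0)
  show ?case
  proof (cases "g = 0")
    case False
    define m where "m = monom (lead_coeff g / lead_coeff P) (degree g - degree P)"
    define h where "h = g - m * P"
    have deg: "degree P \<le> degree g"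
      using min less False by auto
    have m: "poly_over L m"
      unfolding m_def using less.prems(1) P(1)
      by (intro poly_over_monom subfield_divide L) (simp_all add: poly_over_def)
    then have h: "poly_over L h" "poly h y = 0"
      unfolding h_def using L less.prems P by (auto intro!: poly_over_diff poly_over_mult)
    have lc: "lead_coeff P \<noteq> 0" "lead_coeff g \<noteq> 0" using P(2) False by auto
    have "m \<noteq> 0" using lc by (simp add: m_def monom_eq_0_iff)
    then have dm: "degree (m * P) = degree g"
      using P(2) lc deg degree_monom_eq[of "lead_coeff g / lead_coeff P" "degree g - degree P"]
      by (simp add: degree_mult_eq m_def)
    have "degree h \<le> degree g" unfolding h_def using dm by (metis degree_diff_le order_refl)
    moreover have "coeff h (degree g) = 0"
    proof -
      have "lead_coeff (m * P) = lead_coeff m * lead_coeff P" by (rule lead_coeff_mult)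
      moreover have "lead_coeff m = lead_coeff g / lead_coeff P"
        using lc by (simp add: m_def degree_monom_eq)
      ultimately show ?thesis unfolding h_def using dm lc by simp
    qed
    ultimately have "h = 0 \<or> degree h < degree g"
      by (rule eq_zero_or_degree_less)
    then have "\<Delta> h = 0"
      using less.hyps h \<Delta>0 by auto
    moreover have "\<Delta> (m * P) = 0"
      using mult[OF m P(1)] \<Delta>P P(3) by simp
    moreover have "\<Delta> g = \<Delta> h + \<Delta> (m * P)"
      using add[OF h(1) poly_over_mult[OF L m P(1)]] by (simp add: h_def)
    ultimately show ?thesis by simp
  qed (simp add: \<Delta>0)
qed

text \<open>Powers of \<open>z\<close> can be cancelled from the relation because \<open>z\<close>
  is nonzero, so the induction reaches a nonzero constant coefficient \<open>a\<close>. There the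
  relation reads \<open>a + z * poly p z = 0\<close> and exhibits the inverse.\<close>

lemma inverse_poly_of_algebraic:
  assumes "is_subfield L" "poly_over L p" "p \<noteq> 0" "poly p z = 0" "z \<noteq> 0"
  shows "\<exists>q. poly_over L q \<and> inverse z = poly q z"
  using assms(2,3,4)
proof (induction p)
  case (pCons a p)
  then have a: "a \<in> L" and p: "poly_over L p" by (auto simp: poly_over_pCons_iff)
  show ?case
  proof (cases "a = 0")
    case True
    then show ?thesis using pCons p assms(5) by auto
  next
    case False
    then have "inverse z = - poly p z / a"
      using pCons.prems(3) assms(5) by (simp add: field_simps eq_neg_iff_add_eq_0)
    then have "inverse z = poly (smult (- inverse a) p) z"
      by (simp add: divide_inverse)
    moreover have "poly_over L (smult (- inverse a) p)"
      using a p assms(1) by (auto simp: poly_over_def intro!: subfield_mult subfield_minus subfield_inverse)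
    ultimately show ?thesis by blast
  qed
qed auto

text \<open>The ring \<open>L[y]\<close> is a field because every element is algebraic: its inverse
  is a polynomial in the element and hence, by composition, a polynomial in
  \<open>y\<close>.\<close>

lemma subfield_adjoin:
  fixes y :: "'a::field"
  assumes L: "is_subfield L"
    and alg: "\<And>z::'a. \<exists>p. poly_over L p \<and> p \<noteq> 0 \<and> poly p z = 0"
  shows "is_subfield {poly g y | g. poly_over L g}"
proof -
  let ?L = "{poly g y | g. poly_over L g}"
  have comp: "\<exists>h. poly_over L h \<and> poly q (poly g y) = poly h y"
    if "poly_over L q" "poly_over L g" for q g
  proof (intro exI conjI)
    show "poly_over L (pcompose q g)"
      using that(1)
    proof (induction q)
      case (pCons a q)
      have "poly_over L [:a:]"
        using pCons.prems L by (simp add: poly_over_pCons_iff poly_over_0)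
      then show ?case
        using pCons that(2) L
        by (simp add: pcompose_pCons poly_over_pCons_iff poly_over_add poly_over_mult)
    qed (simp add: L poly_over_0)
  qed (simp add: poly_pcompose)
  have inv: "inverse z \<in> ?L" if z: "z \<in> ?L" for z
  proof (cases "z = 0")
    case True
    then show ?thesis using z by simp
  next
    case False
    obtain p where "poly_over L p" "p \<noteq> 0" "poly p z = 0" using alg by blast
    then obtain q where "poly_over L q" "inverse z = poly q z"
      using inverse_poly_of_algebraic[OF L] False by blast
    then show ?thesis using z comp by auto
  qed
  have 0: "0 \<in> ?L" using L poly_over_0 by force
  have 1: "1 \<in> ?L"
    using poly_over_monom[OF L subfield_one[OF L], of 0] by (force simp: poly_monom)
  have "x + z \<in> ?L" "x * z \<in> ?L" if xz: "x \<in> ?L" "z \<in> ?L" for x z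
  proof -
    obtain p q where pq: "poly_over L p" "poly_over L q" "x = poly p y" "z = poly q y"
      using xz by auto
    have "x + z = poly (p + q) y" "x * z = poly (p * q) y" using pq by auto
    then show "x + z \<in> ?L" "x * z \<in> ?L"
      using poly_over_add[OF L pq(1,2)] poly_over_mult[OF L pq(1,2)] by blast+
  qed
  moreover have "- x \<in> ?L" if "x \<in> ?L" for x
  proof -
    obtain p where "poly_over L p" "x = poly p y" using \<open>x \<in> ?L\<close> by auto
    then have "poly_over L (- p)" "- x = poly (- p) y" by (simp_all add: poly_over_minus[OF L])
    then show ?thesis by blast
  qed
  ultimately show ?thesis
    unfolding is_subfield_def using 0 1 inv by (intro conjI ballI) assumption+
qed

text \<open>Differentiating the minimal equation \<open>P(y) = 0\<close> forces the value at
  \<open>y\<close>, and this value works once \<open>P'(y)\<close> is nonzero. It may lie anywhere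
  in the ambient field, which is why \<open>derivation_on\<close> does not ask \<open>D\<close> to
  preserve its domain.\<close>

lemma derivation_extends_to_simple:
  fixes y :: "'a::field"
  assumes L: "is_subfield L" and D: "derivation_on L D" and sep: "separable_elem L y"
    and alg: "\<And>z::'a. \<exists>p. poly_over L p \<and> p \<noteq> 0 \<and> poly p z = 0"
  shows "\<exists>L' D'. is_subfield L' \<and> L \<subseteq> L' \<and> y \<in> L' \<and> derivation_on L' D' \<and> (\<forall>x\<in>L. D' x = D x)"
proof -
  have "\<exists>p. poly_over L p \<and> p \<noteq> 0 \<and> poly p y = 0" by (rule alg)
  then obtain P where P: "poly_over L P" "P \<noteq> 0" "poly P y = 0"
    and min: "\<And>g. poly_over L g \<Longrightarrow> g \<noteq> 0 \<Longrightarrow> poly g y = 0 \<Longrightarrow> degree P \<le> degree g"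
    using ex_has_least_nat[of "\<lambda>p. poly_over L p \<and> p \<noteq> 0 \<and> poly p y = 0" _ degree] by metis
  note vanish = derivation_vanishes_on_relations[OF L P min]
  \<comment> \<open>If \<open>P'(y) = 0\<close>, then \<open>g \<mapsto> g'(y)\<close> is a
    derivation killing \<open>P\<close>, so it kills every relation of \<open>y\<close>, in
    particular the separable one, whose Bezout identity would read 0 = 1 at
    \<open>y\<close>.\<close>
  have P': "poly (pderiv P) y \<noteq> 0"
  proof
    assume P'0: "poly (pderiv P) y = 0"
    obtain p a b where p: "poly_over L p" "poly p y = 0" and ab: "a * p + b * pderiv p = 1"
      using sep unfolding separable_elem_def by blast
    have "poly (pderiv p) y = 0"
    proof (rule vanish[of "\<lambda>g. poly (pderiv g) y"])
    qed (use P'0 p in \<open>auto simp: pderiv_add pderiv_mult algebra_simps\<close>)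
    then show False
      using arg_cong[OF ab, of "\<lambda>g. poly g y"] p by simp
  qed
  \<comment> \<open>Chosen so that \<open>\<Delta> P = 0\<close>, where \<open>\<Delta> g\<close> is
    the derivative that the chain rule predicts for \<open>g(y)\<close>.\<close>
  define z where "z = - poly (map_poly D P) y / poly (pderiv P) y"
  define \<Delta> where "\<Delta> g = poly (map_poly D g) y + poly (pderiv g) y * z" for g
  have add: "\<Delta> (g + h) = \<Delta> g + \<Delta> h" if "poly_over L g" "poly_over L h" for g h
    using that by (simp add: \<Delta>_def map_poly_deriv_add[OF L D] pderiv_add algebra_simps)
  have mult: "\<Delta> (g * h) = poly g y * \<Delta> h + poly h y * \<Delta> g"
    if "poly_over L g" "poly_over L h" for g h
    using that by (simp add: \<Delta>_def poly_map_poly_deriv_mult[OF L D] pderiv_mult algebra_simps)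
  have "\<Delta> P = 0" using P' by (simp add: \<Delta>_def z_def)
  then have van: "\<Delta> g = 0" if "poly_over L g" "poly g y = 0" for g
    using vanish[of \<Delta> g] add mult that by blast
  have wd: "\<Delta> g = \<Delta> h" if "poly_over L g" "poly_over L h" "poly g y = poly h y" for g h
  proof -
    have "\<Delta> (g - h) = 0" using that L by (intro van) (auto intro: poly_over_diff)
    then show ?thesis using add[of "g - h" h] that L by (simp add: poly_over_diff)
  qed
  define D' where "D' x = \<Delta> (SOME g. poly_over L g \<and> x = poly g y)" for x
  have D': "D' (poly g y) = \<Delta> g" if "poly_over L g" for g
  proof -
    have "\<exists>h. poly_over L h \<and> poly g y = poly h y" using that by blast
    from someI_ex[OF this] show ?thesis unfolding D'_def using that wd by metis
  qed
  let ?L = "{poly g y | g. poly_over L g}"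
  have const: "poly_over L [:x:]" if "x \<in> L" for x
    using that L by (simp add: poly_over_pCons_iff poly_over_0)
  have "L \<subseteq> ?L"
  proof
    fix x assume "x \<in> L"
    then have "poly_over L [:x:]" "x = poly [:x:] y" by (auto simp: const)
    then show "x \<in> ?L" by blast
  qed
  moreover have "y \<in> ?L"
  proof -
    have "poly_over L [:0, 1:]" "y = poly [:0, 1:] y"
      using L by (auto simp: poly_over_pCons_iff poly_over_0 subfield_zero subfield_one)
    then show ?thesis by blast
  qed
  moreover have "D' x = D x" if "x \<in> L" for x
    using D'[OF const[OF that]] derivation_on_0[OF L D] by (simp add: \<Delta>_def map_poly_pCons)
  moreover have "derivation_on ?L D'"
    unfolding derivation_on_def
  proof (intro ballI)
    fix u w assume "u \<in> ?L" "w \<in> ?L"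
    then obtain g h where gh: "poly_over L g" "poly_over L h" "u = poly g y" "w = poly h y"
      by blast
    then have "D' (poly (g + h) y) = \<Delta> (g + h)" "D' (poly (g * h) y) = \<Delta> (g * h)"
      using L by (simp_all only: D' poly_over_add poly_over_mult)
    then show "D' (u + w) = D' u + D' w \<and> D' (u * w) = u * D' w + w * D' u"
      using gh add[OF gh(1,2)] mult[OF gh(1,2)] D' by simp
  qed
  ultimately show ?thesis using subfield_adjoin[OF L alg, of y] by blast
qed

text \<open>A basis is adjoined element by element. Separability over \<open>F\<close> passes to
  every larger \<open>L\<close>, because the polynomial and its Bezout identity remain valid
  there.\<close>

lemma derivation_extends_to_separable:
  fixes F :: "'a::field set"
  assumes F: "is_subfield F" and D: "derivation_on F D" and sep: "separable_over F"
    and fin: "finite_over F"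
  shows "\<exists>D'. derivation_on UNIV D' \<and> (\<forall>x\<in>F. D' x = D x)"
proof -
  obtain n b where b: "is_basis_over F n b" using fin finite_over_def by blast
  have sep_up: "separable_elem L z" if "F \<subseteq> L" for L z
    using sep that unfolding separable_over_def separable_elem_def by (meson poly_over_mono)
  have "\<exists>L E. is_subfield L \<and> F \<subseteq> L \<and> (\<forall>j<i. b j \<in> L) \<and> derivation_on L E \<and> (\<forall>x\<in>F. E x = D x)" for i
  proof (induction i)
    case 0
    then show ?case using F D by blast
  next
    case (Suc i)
    then obtain L E where L: "is_subfield L" "F \<subseteq> L" "\<forall>j<i. b j \<in> L" "derivation_on L E" "\<forall>x\<in>F. E x = D x"
      by blast
    have "\<exists>p. poly_over L p \<and> p \<noteq> 0 \<and> poly p z = 0" for z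
      using sep_up[OF L(2), of z] unfolding separable_elem_def by blast
    from derivation_extends_to_simple[OF L(1,4) sep_up[OF L(2)] this]
    obtain L' E' where "is_subfield L'" "L \<subseteq> L'" "b i \<in> L'" "derivation_on L' E'" "\<forall>x\<in>L. E' x = E x"
      by blast
    with L show ?case
      by (intro exI[of _ L'] exI[of _ E']) (auto simp: less_Suc_eq)
  qed
  from this[of n] obtain L E where L: "is_subfield L" "F \<subseteq> L" "\<forall>j<n. b j \<in> L" "derivation_on L E" "\<forall>x\<in>F. E x = D x"
    by blast
  have "x \<in> L" for x
  proof -
    obtain a where "\<forall>i<n. a i \<in> F" "x = (\<Sum>i<n. a i * b i)"
      using b unfolding is_basis_over_def by blast
    then show ?thesis using L(1,2,3) by (auto intro!: subfield_sum subfield_mult)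
  qed
  then have "L = UNIV" by blast
  then show ?thesis using L by blast
qed

text \<open>Gaussian elimination on the last column. If that column is zero, the last row gets
  coefficient 0; otherwise a pivot row \<open>m\<close> clears it, and a relation among the
  remaining rows determines the coefficient of the pivot.\<close>

lemma nontrivial_relation:
  fixes a :: "nat \<Rightarrow> nat \<Rightarrow> 'a::field"
  assumes F: "is_subfield F" and a: "\<And>i j. i \<le> n \<Longrightarrow> j < n \<Longrightarrow> a i j \<in> F"
  shows "\<exists>c. (\<forall>i\<le>n. c i \<in> F) \<and> (\<exists>i\<le>n. c i \<noteq> 0) \<and> (\<forall>j<n. (\<Sum>i\<le>n. c i * a i j) = 0)"
  using a
proof (induction n arbitrary: a)
  case 0
  have "(1::'a) \<in> F" using subfield_one[OF F] .
  then show ?case by (intro exI[of _ "\<lambda>_. 1::'a"]) simp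
next
  case (Suc n)
  show ?case
  proof (cases "\<exists>m\<le>Suc n. a m n \<noteq> 0")
    case False
    obtain c where c: "\<forall>i\<le>n. c i \<in> F" "\<exists>i\<le>n. c i \<noteq> 0" "\<forall>j<n. (\<Sum>i\<le>n. c i * a i j) = 0"
    proof -
      have "a i j \<in> F" if "i \<le> n" "j < n" for i j using that Suc.prems by simp
      from Suc.IH[of a, OF this] show ?thesis using that by blast
    qed
    let ?c = "\<lambda>i. if i \<le> n then c i else 0"
    have eq: "(\<Sum>i\<le>Suc n. ?c i * a i j) = (\<Sum>i\<le>n. c i * a i j)" for j
      by (simp add: sum.atMost_Suc del: sum.cl_ivl_Suc)
    have "(\<Sum>i\<le>n. c i * a i n) = 0" using False by (intro sum.neutral) auto
    then have "\<forall>j<Suc n. (\<Sum>i\<le>Suc n. ?c i * a i j) = 0"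
      unfolding eq using c(3) by (metis less_Suc_eq)
    moreover have "\<forall>i\<le>Suc n. ?c i \<in> F" using c(1) subfield_zero[OF F] by simp
    moreover have "\<exists>i\<le>Suc n. ?c i \<noteq> 0" using c(2) le_SucI by metis
    ultimately show ?thesis by (intro exI[of _ ?c] conjI)
  next
    case True
    then obtain m where m: "m \<le> Suc n" "a m n \<noteq> 0" by blast
    \<comment> \<open>Enumerates the rows other than the pivot.\<close>
    define \<sigma> where "\<sigma> i = (if i < m then i else Suc i)" for i
    have \<sigma>: "\<sigma> i \<le> Suc n" if "i \<le> n" for i using that by (auto simp: \<sigma>_def)
    have bij: "bij_betw \<sigma> {..n} ({..Suc n} - {m})"
    proof (rule bij_betw_byWitness[where f' = "\<lambda>i. if i < m then i else i - 1"])
    qed (use m in \<open>auto simp: \<sigma>_def\<close>)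
    define r where "r i = a (\<sigma> i) n / a m n" for i
    have r: "r i \<in> F" if "i \<le> n" for i
      unfolding r_def using that Suc.prems \<sigma> m by (intro subfield_divide F) auto
    obtain c where c: "\<forall>i\<le>n. c i \<in> F" "\<exists>i\<le>n. c i \<noteq> 0"
      "\<forall>j<n. (\<Sum>i\<le>n. c i * (a (\<sigma> i) j - r i * a m j)) = 0"
    proof -
      have "a (\<sigma> i) j - r i * a m j \<in> F" if "i \<le> n" "j < n" for i j
        using that Suc.prems \<sigma> m r by (intro subfield_diff subfield_mult F) auto
      from Suc.IH[of "\<lambda>i j. a (\<sigma> i) j - r i * a m j", OF this] show ?thesis
        using that by blast
    qed
    define c' where "c' i = (if i = m then - (\<Sum>l\<le>n. c l * r l) else c (if i < m then i else i - 1))" for i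
    have c\<sigma>: "c' (\<sigma> i) = c i" for i by (auto simp: c'_def \<sigma>_def)
    have split: "(\<Sum>i\<le>Suc n. c' i * a i j) = (\<Sum>i\<le>n. c i * (a (\<sigma> i) j - r i * a m j))" for j
    proof -
      have "(\<Sum>i\<le>Suc n. c' i * a i j) = c' m * a m j + (\<Sum>i\<in>{..Suc n} - {m}. c' i * a i j)"
        using m by (intro sum.remove) auto
      also have "(\<Sum>i\<in>{..Suc n} - {m}. c' i * a i j) = (\<Sum>i\<le>n. c i * a (\<sigma> i) j)"
        using sum.reindex_bij_betw[OF bij, of "\<lambda>i. c' i * a i j"] by (simp add: c\<sigma>)
      also have "c' m * a m j = - (\<Sum>i\<le>n. c i * r i * a m j)"
        by (simp add: c'_def sum_distrib_right)
      finally show ?thesis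
        by (simp add: sum_subtractf algebra_simps)
    qed
    have "a (\<sigma> i) n - r i * a m n = 0" for i using m by (simp add: r_def)
    then have "\<forall>j<Suc n. (\<Sum>i\<le>Suc n. c' i * a i j) = 0"
      unfolding split using c(3) by (simp add: less_Suc_eq)
    moreover have "\<forall>i\<le>Suc n. c' i \<in> F"
    proof (intro allI impI)
      fix i assume i: "i \<le> Suc n"
      have "(if i < m then i else i - 1) \<le> n" if "i \<noteq> m" using i m that by auto
      moreover have "(\<Sum>l\<le>n. c l * r l) \<in> F"
        using c(1) r by (intro subfield_sum subfield_mult F) auto
      ultimately show "c' i \<in> F"
        unfolding c'_def using c(1) subfield_minus[OF F] by metis
    qed
    moreover have "\<exists>i\<le>Suc n. c' i \<noteq> 0" using c(2) c\<sigma> \<sigma> by metis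
    ultimately show ?thesis by (intro exI[of _ c'] conjI)
  qed
qed

text \<open>The coordinates of the given elements and of \<open>y\<close> with respect to
  \<open>b\<close> form n + 1 rows of length n and satisfy a relation; independence forces
  \<open>y\<close> to occur in it.\<close>

lemma independent_spans:
  fixes w :: "'i \<Rightarrow> 'a::field"
  assumes F: "is_subfield F" and b: "is_basis_over F n b" and I: "finite I" "card I = n"
    and ind: "\<And>a. (\<And>i. i \<in> I \<Longrightarrow> a i \<in> F) \<Longrightarrow> (\<Sum>i\<in>I. a i * w i) = 0 \<Longrightarrow> (\<And>i. i \<in> I \<Longrightarrow> a i = 0)"
  shows "\<exists>a. (\<forall>i\<in>I. a i \<in> F) \<and> y = (\<Sum>i\<in>I. a i * w i)"
proof -
  obtain h where h: "bij_betw h {..<n} I"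
    using ex_bij_betw_nat_finite[OF I(1)] I(2) by (auto simp: atLeast0LessThan)
  define u where "u i = (if i < n then w (h i) else y)" for i
  have "\<exists>a. (\<forall>j<n. a j \<in> F) \<and> x = (\<Sum>j<n. a j * b j)" for x
    using b by (simp add: is_basis_over_def)
  then obtain A where A: "\<And>x j. j < n \<Longrightarrow> A x j \<in> F" "\<And>x. x = (\<Sum>j<n. A x j * b j)" by metis
  obtain c where c: "\<forall>i\<le>n. c i \<in> F" "\<exists>i\<le>n. c i \<noteq> 0" "\<forall>j<n. (\<Sum>i\<le>n. c i * A (u i) j) = 0"
    using nontrivial_relation[OF F, of n "\<lambda>i. A (u i)"] A(1) by blast
  have "(\<Sum>i\<le>n. c i * u i) = (\<Sum>i\<le>n. \<Sum>j<n. c i * A (u i) j * b j)"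
    by (subst A(2)) (simp add: sum_distrib_left mult.assoc)
  also have "\<dots> = (\<Sum>j<n. (\<Sum>i\<le>n. c i * A (u i) j) * b j)"
    by (subst sum.swap) (simp add: sum_distrib_right)
  also have "\<dots> = 0" using c(3) by simp
  finally have "(\<Sum>i<n. c i * w (h i)) + c n * y = 0"
    by (simp add: u_def lessThan_Suc_atMost[symmetric])
  moreover define e where "e i = c (inv_into {..<n} h i)" for i
  have eh: "e (h i) = c i" if "i < n" for i
    using h that by (simp add: e_def bij_betw_def inv_into_f_f)
  have "(\<Sum>i<n. c i * w (h i)) = (\<Sum>i\<in>I. e i * w i)"
    using sum.reindex_bij_betw[OF h, of "\<lambda>i. e i * w i"] eh by simp
  ultimately have rel: "(\<Sum>i\<in>I. e i * w i) + c n * y = 0" by simp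
  have eF: "e i \<in> F" if "i \<in> I" for i
    using that h eh c(1) unfolding bij_betw_def by force
  have "c n \<noteq> 0"
  proof
    assume cn: "c n = 0"
    then have "(\<Sum>i\<in>I. e i * w i) = 0" using rel by simp
    then have "e i = 0" if "i \<in> I" for i using ind eF that by blast
    then have "c i = 0" if "i < n" for i using eh[OF that] h that by (auto simp: bij_betw_def)
    then show False using c(2) cn by (metis le_neq_implies_less)
  qed
  then have "y = (\<Sum>i\<in>I. - (e i / c n) * w i)"
    using rel by (simp add: sum_divide_distrib[symmetric] sum_negf field_simps eq_neg_iff_add_eq_0)
  then show ?thesis
    using eF c(1) F by (intro exI[of _ "\<lambda>i. - (e i / c n)"]) (auto intro!: subfield_minus subfield_divide)
qed

section \<open>Non-archimedean absolute values\<close>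

locale nonarch_field =
  fixes v :: "'a::field \<Rightarrow> real"
  assumes nonarch: "nonarch_abs v"
begin

lemma v_nonneg [simp]: "0 \<le> v x"
  and v_eq_0 [simp]: "v x = 0 \<longleftrightarrow> x = 0"
  and v_mult: "v (x * y) = v x * v y"
  and v_add_le: "v (x + y) \<le> max (v x) (v y)"
  using nonarch by (auto simp: nonarch_abs_def)

lemma v_0 [simp]: "v 0 = 0" by simp

lemma v_pos: "x \<noteq> 0 \<Longrightarrow> 0 < v x"
  by (simp add: less_le)

lemma v_1 [simp]: "v 1 = 1"
  using v_mult[of 1 1] v_eq_0[of 1] by (metis mult_cancel_left2 mult_1 zero_neq_one)

lemma v_minus [simp]: "v (- x) = v x"
proof -
  have "v (- 1) * v (- 1) = 1" using v_mult[of "- 1" "- 1"] by simp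
  then have "v (- 1) = 1" using v_nonneg[of "- 1"] by (metis abs_of_nonneg abs_square_eq_1 power2_eq_square)
  then show ?thesis using v_mult[of "- 1" x] by simp
qed

lemma v_diff_le: "v (x - y) \<le> max (v x) (v y)"
  using v_add_le[of x "- y"] by simp

lemma v_diff_commute: "v (x - y) = v (y - x)"
  using v_minus[of "x - y"] by simp

lemma v_inverse: "v (inverse x) = inverse (v x)"
  by (cases "x = 0") (auto simp: v_mult[symmetric] intro!: inverse_unique[symmetric])

lemma v_divide: "v (x / y) = v x / v y"
  by (simp add: divide_inverse v_mult v_inverse)

lemma v_power: "v (x ^ n) = v x ^ n"
  by (induction n) (auto simp: v_mult)

lemma v_add_bound: "v x \<le> c \<Longrightarrow> v y \<le> c \<Longrightarrow> v (x + y) \<le> c"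
  using v_add_le[of x y] by linarith

lemma v_add_bound_less: "v x < c \<Longrightarrow> v y < c \<Longrightarrow> v (x + y) < c"
  using v_add_le[of x y] by linarith

lemma v_diff_bound: "v x \<le> c \<Longrightarrow> v y \<le> c \<Longrightarrow> v (x - y) \<le> c"
  using v_diff_le[of x y] by linarith

lemma v_diff_bound_less: "v x < c \<Longrightarrow> v y < c \<Longrightarrow> v (x - y) < c"
  using v_diff_le[of x y] by linarith

lemma v_sum_bound: "0 \<le> c \<Longrightarrow> (\<And>i. i \<in> I \<Longrightarrow> v (f i) \<le> c) \<Longrightarrow> v (sum f I) \<le> c"
  by (induction I rule: infinite_finite_induct) (auto simp: v_add_bound)

lemma v_sum_bound_less: "0 < c \<Longrightarrow> (\<And>i. i \<in> I \<Longrightarrow> v (f i) < c) \<Longrightarrow> v (sum f I) < c"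
  by (induction I rule: infinite_finite_induct) (auto simp: v_add_bound_less)

lemma v_add_eq: "v y < v x \<Longrightarrow> v (x + y) = v x"
  using v_add_le[of x y] v_diff_le[of "x + y" y] by simp

lemma v_eq_of_close: "v (x - y) < v x \<Longrightarrow> v y = v x"
  using v_add_eq[of "y - x" x] by (simp add: v_diff_commute)

lemma v_abs_diff_le: "\<bar>v x - v y\<bar> \<le> v (x - y)"
proof -
  have "v x \<le> max (v (x - y)) (v y)" "v y \<le> max (v (x - y)) (v x)"
    using v_add_le[of "x - y" y] v_add_le[of "y - x" x] v_diff_commute[of x y] by simp_all
  then show ?thesis using v_nonneg[of x] v_nonneg[of y] v_nonneg[of "x - y"] by linarith
qed

lemma v_of_nat: "v (of_nat n) \<le> 1"
  by (induction n) (auto simp: v_add_bound)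

lemma v_mult_le_1: "v x \<le> 1 \<Longrightarrow> v y \<le> 1 \<Longrightarrow> v (x * y) \<le> 1"
  using mult_mono[of "v x" 1 "v y" 1] by (simp add: v_mult)

lemma v_power_le_1: "v x \<le> 1 \<Longrightarrow> v (x ^ n) \<le> 1"
  by (simp add: v_power power_le_one)

text \<open>The largest summand strictly dominates the others and so determines the value of the
  sum. Zero summands are exempt from distinctness, since they may occur repeatedly.\<close>

lemma v_sum_distinct:
  assumes "finite I" "\<And>i j. i \<in> I \<Longrightarrow> j \<in> I \<Longrightarrow> f i \<noteq> 0 \<Longrightarrow> v (f i) = v (f j) \<Longrightarrow> i = j" "i \<in> I"
  shows "v (f i) \<le> v (sum f I)"
  using assms
proof (induction "card I" arbitrary: I i rule: less_induct)
  case less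
  obtain m where m: "m \<in> I" "\<And>j. j \<in> I \<Longrightarrow> v (f j) \<le> v (f m)"
    using less.prems(1,3) finite_imageI[of I "\<lambda>i. v (f i)"] Max_in[of "(\<lambda>i. v (f i)) ` I"] Max_ge[of "(\<lambda>i. v (f i)) ` I"]
    by (smt (verit) empty_iff imageE imageI)
  show ?case
  proof (cases "f m = 0")
    case True
    then show ?thesis using m(2)[of i] less.prems(3) v_nonneg[of "f i"] v_nonneg[of "sum f I"]
      unfolding True v_0 by linarith
  next
    case False
    have "v (f j) < v (f m)" if "j \<in> I - {m}" for j
      using m that less.prems(2)[OF m(1), of j] False by (auto simp: less_le)
    then have "v (sum f (I - {m})) < v (f m)"
      using False v_pos by (intro v_sum_bound_less) auto
    then have "v (sum f I) = v (f m)"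
      using sum.remove[OF less.prems(1) m(1), of f] v_add_eq by simp
    then show ?thesis using m(2) less.prems(3) by simp
  qed
qed

section \<open>Convergence, closure and extension by continuity\<close>

definition vlim :: "(nat \<Rightarrow> 'a) \<Rightarrow> 'a \<Rightarrow> bool" where
  "vlim X x \<longleftrightarrow> (\<lambda>n. v (X n - x)) \<longlonglongrightarrow> 0"

lemma tendsto_0_squeeze:
  fixes f g :: "nat \<Rightarrow> real"
  shows "g \<longlonglongrightarrow> 0 \<Longrightarrow> (\<And>n. 0 \<le> f n) \<Longrightarrow> (\<And>n. f n \<le> g n) \<Longrightarrow> f \<longlonglongrightarrow> 0"
  by (rule tendsto_sandwich[of "\<lambda>_. 0" f _ g]) auto

lemma vlim_const: "vlim (\<lambda>_. x) x"
  by (simp add: vlim_def)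

lemma vlim_norm: "vlim X x \<Longrightarrow> (\<lambda>n. v (X n)) \<longlonglongrightarrow> v x"
  unfolding vlim_def
  by (rule LIM_zero_cancel, rule tendsto_rabs_zero_cancel, erule tendsto_0_squeeze)
     (auto simp: v_abs_diff_le)

lemma vlim_add:
  assumes "vlim X x" "vlim Y y"
  shows "vlim (\<lambda>n. X n + Y n) (x + y)"
  unfolding vlim_def
proof (rule tendsto_0_squeeze)
  show "(\<lambda>n. v (X n - x) + v (Y n - y)) \<longlonglongrightarrow> 0"
    using tendsto_add[OF assms[unfolded vlim_def]] by simp
  show "v (X n + Y n - (x + y)) \<le> v (X n - x) + v (Y n - y)" for n
    using v_add_bound[of "X n - x" "v (X n - x) + v (Y n - y)" "Y n - y"]
    by (simp add: algebra_simps)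
qed auto

lemma vlim_mult:
  assumes "vlim X x" "vlim Y y"
  shows "vlim (\<lambda>n. X n * Y n) (x * y)"
  unfolding vlim_def
proof (rule tendsto_0_squeeze)
  show "(\<lambda>n. v (X n - x) * v (Y n) + v x * v (Y n - y)) \<longlonglongrightarrow> 0"
    using tendsto_add[OF tendsto_mult[OF assms(1)[unfolded vlim_def] vlim_norm[OF assms(2)]]
      tendsto_mult_left[OF assms(2)[unfolded vlim_def], of "v x"]] by simp
  have "v (X n * Y n - x * y) = v ((X n - x) * Y n + x * (Y n - y))" for n
    by (simp add: algebra_simps)
  also have "\<dots> n \<le> v (X n - x) * v (Y n) + v x * v (Y n - y)" for n
    by (intro v_add_bound) (simp_all add: v_mult)
  finally show "v (X n * Y n - x * y) \<le> v (X n - x) * v (Y n) + v x * v (Y n - y)" for n .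
qed auto

lemma vlim_minus: "vlim X x \<Longrightarrow> vlim (\<lambda>n. - X n) (- x)"
  using vlim_mult[OF vlim_const[of "- 1"], of X x] by simp

lemma vlim_diff: "vlim X x \<Longrightarrow> vlim Y y \<Longrightarrow> vlim (\<lambda>n. X n - Y n) (x - y)"
  using vlim_add[OF _ vlim_minus, of X x Y y] by simp

lemma vlim_inverse:
  assumes "vlim X x" "x \<noteq> 0"
  shows "vlim (\<lambda>n. inverse (X n)) (inverse x)"
proof -
  have ev: "eventually (\<lambda>n. X n \<noteq> 0) sequentially"
    using order_tendstoD(1)[OF vlim_norm[OF assms(1)], of 0] v_pos[OF assms(2)]
    by (auto elim!: eventually_mono)
  have "(\<lambda>n. v (X n - x) / (v (X n) * v x)) \<longlonglongrightarrow> 0 / (v x * v x)"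
    using assms by (intro tendsto_intros vlim_norm) (auto simp: vlim_def)
  then have "(\<lambda>n. v (X n - x) / (v (X n) * v x)) \<longlonglongrightarrow> 0" by simp
  moreover have "eventually (\<lambda>n. v (X n - x) / (v (X n) * v x) = v (inverse (X n) - inverse x)) sequentially"
    using ev
  proof eventually_elim
    case (elim n)
    have "inverse (X n) - inverse x = (x - X n) / (X n * x)"
      using elim assms(2) by (simp add: field_simps)
    then show ?case by (simp only: v_divide v_mult v_diff_commute[of x])
  qed
  ultimately show ?thesis
    unfolding vlim_def by (rule Lim_transform_eventually)
qed

lemma vlim_unique:
  assumes "vlim X x" "vlim X y"
  shows "x = y"
  using LIMSEQ_unique[OF vlim_norm[OF vlim_diff[OF assms]], of 0] by simp

lemma vlim_cauchy: "vlim X x \<Longrightarrow> v_cauchy v X"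
  unfolding v_cauchy_def
proof (intro allI impI)
  fix e :: real assume X: "vlim X x" and e: "0 < e"
  obtain N where "\<And>n. n \<ge> N \<Longrightarrow> v (X n - x) < e"
    using order_tendstoD(2)[OF X[unfolded vlim_def] e] by (auto simp: eventually_sequentially)
  then have "v (X m - X n) < e" if "m \<ge> N" "n \<ge> N" for m n
    using v_diff_bound_less[of "X m - x" e "X n - x"] that by simp
  then show "\<exists>N. \<forall>m\<ge>N. \<forall>n\<ge>N. v (X m - X n) < e" by blast
qed

lemma vlim_in_closure:
  "x \<in> v_closure v S \<longleftrightarrow> (\<exists>X. (\<forall>n. X n \<in> S) \<and> vlim X x)"
proof
  assume "x \<in> v_closure v S"
  then have "\<exists>y\<in>S. v (x - y) < inverse (real (Suc n))" for n
    unfolding v_closure_def by simp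
  then obtain X where X: "\<And>n. X n \<in> S" "\<And>n. v (x - X n) < inverse (real (Suc n))" by metis
  have "vlim X x"
    unfolding vlim_def
    by (rule tendsto_0_squeeze[OF LIMSEQ_inverse_real_of_nat])
       (use X(2) in \<open>auto simp: v_diff_commute[of _ x] intro: less_imp_le\<close>)
  then show "\<exists>X. (\<forall>n. X n \<in> S) \<and> vlim X x" using X(1) by blast
next
  assume "\<exists>X. (\<forall>n. X n \<in> S) \<and> vlim X x"
  then obtain X where X: "\<And>n. X n \<in> S" "(\<lambda>n. v (X n - x)) \<longlonglongrightarrow> 0" unfolding vlim_def by blast
  have "\<exists>y\<in>S. v (x - y) < e" if "e > 0" for e
    using order_tendstoD(2)[OF X(2) that] X(1) unfolding eventually_sequentially
    by (metis order_refl v_diff_commute)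
  then show "x \<in> v_closure v S" by (simp add: v_closure_def)
qed

lemma closure_superset: "S \<subseteq> v_closure v S"
proof
  fix x assume "x \<in> S"
  then show "x \<in> v_closure v S"
    unfolding vlim_in_closure using vlim_const by (intro exI[of _ "\<lambda>_. x"]) simp
qed

lemma closure_subfield:
  assumes S: "is_subfield S"
  shows "is_subfield (v_closure v S)"
  unfolding is_subfield_def
proof (intro conjI ballI)
  show "0 \<in> v_closure v S" "1 \<in> v_closure v S"
    using closure_superset[of S] subfield_zero[OF S] subfield_one[OF S] by auto
  fix x assume x: "x \<in> v_closure v S"
  then obtain X where X: "\<forall>n. X n \<in> S" "vlim X x" by (auto simp: vlim_in_closure)
  show "- x \<in> v_closure v S"
    unfolding vlim_in_closure using X vlim_minus subfield_minus[OF S]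
    by (intro exI[of _ "\<lambda>n. - X n"]) auto
  show "inverse x \<in> v_closure v S"
  proof (cases "x = 0")
    case True then show ?thesis using x by simp
  next
    case False
    then show ?thesis
      unfolding vlim_in_closure using X vlim_inverse subfield_inverse[OF S]
      by (intro exI[of _ "\<lambda>n. inverse (X n)"]) auto
  qed
  fix y assume "y \<in> v_closure v S"
  then obtain Y where Y: "\<forall>n. Y n \<in> S" "vlim Y y" by (auto simp: vlim_in_closure)
  show "x + y \<in> v_closure v S"
    unfolding vlim_in_closure using X Y vlim_add subfield_add[OF S]
    by (intro exI[of _ "\<lambda>n. X n + Y n"]) auto
  show "x * y \<in> v_closure v S"
    unfolding vlim_in_closure using X Y vlim_mult subfield_mult[OF S]
    by (intro exI[of _ "\<lambda>n. X n * Y n"]) auto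
qed

lemma completeD:
  assumes "v_complete_on v S" "\<And>n. X n \<in> S" "v_cauchy v X"
  obtains x where "x \<in> S" "vlim X x"
  using assms unfolding v_complete_on_def vlim_def by blast

text \<open>The bound makes \<open>D\<close> Lipschitz, so Cauchy sequences have Cauchy images;
  sums, products and the bound itself survive the passage to the limit.\<close>

lemma bounded_derivation_extends_to_closure:
  assumes S: "is_subfield S" and D: "derivation_on S D"
    and bnd: "\<And>x. x \<in> S \<Longrightarrow> v (D x) \<le> C * v x" and C: "C > 0"
    and complete: "v_complete_on v (UNIV :: 'a set)"
  shows "\<exists>D'. derivation_on (v_closure v S) D' \<and> (\<forall>x\<in>S. D' x = D x)
    \<and> (\<forall>x\<in>v_closure v S. v (D' x) \<le> C * v x)"
proof -
  \<comment> \<open>The graph of the extension. With a relation, any convenient approximating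
    sequence may be used for sums and products.\<close>
  define G where "G x l \<longleftrightarrow> (\<exists>X. (\<forall>n. X n \<in> S) \<and> vlim X x \<and> vlim (\<lambda>n. D (X n)) l)" for x l
  have bnd': "v (D x - D y) \<le> C * v (x - y)" if "x \<in> S" "y \<in> S" for x y
    using bnd[of "x - y"] derivation_on_diff[OF S D that] subfield_diff[OF S that] by simp
  have ex: "\<exists>l. G x l" if "x \<in> v_closure v S" for x
  proof -
    obtain X where X: "\<forall>n. X n \<in> S" "vlim X x" using \<open>x \<in> v_closure v S\<close> by (auto simp: vlim_in_closure)
    have "v_cauchy v (\<lambda>n. D (X n))"
      unfolding v_cauchy_def
    proof (intro allI impI)
      fix e :: real assume "e > 0"
      then have "e / C > 0" using C by simp
      then obtain N where N: "\<forall>m\<ge>N. \<forall>n\<ge>N. v (X m - X n) < e / C"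
        using vlim_cauchy[OF X(2)] unfolding v_cauchy_def by blast
      have "v (D (X m) - D (X n)) < e" if "m \<ge> N" "n \<ge> N" for m n
      proof -
        have "v (X m - X n) < e / C" using N that by blast
        then have "C * v (X m - X n) < e" using C by (simp add: field_simps)
        then show ?thesis using bnd'[of "X m" "X n"] X(1) by force
      qed
      then show "\<exists>N. \<forall>m\<ge>N. \<forall>n\<ge>N. v (D (X m) - D (X n)) < e" by blast
    qed
    then obtain l where "vlim (\<lambda>n. D (X n)) l" using completeD[OF complete, of "\<lambda>n. D (X n)"] by auto
    then show ?thesis unfolding G_def using X by blast
  qed
  have uniq: "l = m" if l: "G x l" and m: "G x m" for x l m
  proof -
    obtain X where X: "\<forall>n. X n \<in> S" "vlim X x" "vlim (\<lambda>n. D (X n)) l" using l G_def by blast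
    obtain Y where Y: "\<forall>n. Y n \<in> S" "vlim Y x" "vlim (\<lambda>n. D (Y n)) m" using m G_def by blast
    have "(\<lambda>n. C * v (X n - Y n)) \<longlonglongrightarrow> C * v (x - x)"
      using X Y by (intro tendsto_mult_left vlim_norm vlim_diff) auto
    then have "(\<lambda>n. C * v (X n - Y n)) \<longlonglongrightarrow> 0" by simp
    then have "(\<lambda>n. v (D (X n) - D (Y n))) \<longlonglongrightarrow> 0"
      by (rule tendsto_0_squeeze) (use X Y bnd' in auto)
    then have "v (l - m) = 0"
      using vlim_norm[OF vlim_diff[OF X(3) Y(3)]] LIMSEQ_unique by blast
    then show ?thesis by simp
  qed
  define D' where "D' x = (THE l. G x l)" for x
  have D'G: "D' x = l" if "G x l" for x l
    unfolding D'_def using that uniq by blast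
  have GD': "G x (D' x)" if "x \<in> v_closure v S" for x
    using ex[OF that] D'G by metis
  have "derivation_on (v_closure v S) D'"
    unfolding derivation_on_def
  proof (intro ballI)
    fix x y assume "x \<in> v_closure v S" "y \<in> v_closure v S"
    then have "G x (D' x)" "G y (D' y)" using GD' by auto
    then obtain X Y where X: "\<forall>n. X n \<in> S" "vlim X x" "vlim (\<lambda>n. D (X n)) (D' x)"
      and Y: "\<forall>n. Y n \<in> S" "vlim Y y" "vlim (\<lambda>n. D (Y n)) (D' y)"
      unfolding G_def by blast
    have "G (x + y) (D' x + D' y)"
      unfolding G_def using X Y vlim_add subfield_add[OF S] derivation_on_add[OF D]
      by (intro exI[of _ "\<lambda>n. X n + Y n"]) auto
    moreover have "G (x * y) (x * D' y + y * D' x)"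
      unfolding G_def using X Y vlim_add vlim_mult subfield_mult[OF S] derivation_on_mult[OF D]
      by (intro exI[of _ "\<lambda>n. X n * Y n"]) auto
    ultimately show "D' (x + y) = D' x + D' y \<and> D' (x * y) = x * D' y + y * D' x"
      using D'G by auto
  qed
  moreover have "D' x = D x" if "x \<in> S" for x
    by (rule D'G) (use that vlim_const in \<open>auto simp: G_def intro!: exI[of _ "\<lambda>_. x"]\<close>)
  moreover have "v (D' x) \<le> C * v x" if x: "x \<in> v_closure v S" for x
  proof -
    obtain X where X: "\<forall>n. X n \<in> S" "vlim X x" "vlim (\<lambda>n. D (X n)) (D' x)"
      using GD'[of x] x unfolding G_def by blast
    show ?thesis
      by (rule LIMSEQ_le[OF vlim_norm[OF X(3)] tendsto_mult_left[OF vlim_norm[OF X(2)]]])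
         (use bnd X(1) in auto)
  qed
  ultimately show ?thesis by blast
qed

section \<open>Values of integers and the ramification index\<close>

lemma v_of_nat_unit:
  assumes "n > 0" "\<And>p::nat. prime p \<Longrightarrow> v (of_nat p) < 1 \<Longrightarrow> \<not> p dvd n"
  shows "v (of_nat n) = 1"
  using assms
proof (induction n rule: less_induct)
  case (less n)
  show ?case
  proof (cases "n = 1")
    case False
    then obtain p where p: "prime p" "p dvd n" using prime_factor_nat by blast
    then obtain m where m: "n = p * m" by blast
    have "m < n" "m > 0"
      using m less.prems(1) prime_gt_1_nat[OF p(1)] by auto
    then have "v (of_nat m) = 1"
      using less.IH[of m] less.prems(2) m by (meson dvd_mult)
    moreover have "v (of_nat p) = 1"
      using v_of_nat[of p] less.prems(2)[OF p(1)] p(2) by fastforce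
    ultimately show ?thesis by (simp add: m v_mult)
  qed simp
qed

lemma val_group_mult: "is_subfield S \<Longrightarrow> a \<in> val_group v S \<Longrightarrow> b \<in> val_group v S \<Longrightarrow> a * b \<in> val_group v S"
  unfolding val_group_def by clarsimp (metis v_mult subfield_mult mult_eq_0_iff)

lemma val_group_inverse: "is_subfield S \<Longrightarrow> a \<in> val_group v S \<Longrightarrow> inverse a \<in> val_group v S"
  unfolding val_group_def by clarsimp (metis v_inverse subfield_inverse inverse_zero_imp_zero)

lemma val_group_pos: "a \<in> val_group v S \<Longrightarrow> a > 0"
  unfolding val_group_def using v_pos by auto

lemma val_group_coset_eq:
  assumes S: "is_subfield S" and g: "g > 0" "h > 0"
  shows "(*) g ` val_group v S = (*) h ` val_group v S \<longleftrightarrow> g / h \<in> val_group v S"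
proof
  assume eq: "(*) g ` val_group v S = (*) h ` val_group v S"
  have "1 \<in> val_group v S" unfolding val_group_def using subfield_one[OF S] by force
  then have "g \<in> (*) g ` val_group v S" by force
  then obtain a where "a \<in> val_group v S" "g = h * a" using eq by auto
  then show "g / h \<in> val_group v S" using g by simp
next
  assume a: "g / h \<in> val_group v S"
  have "(*) g ` val_group v S \<subseteq> (*) h ` val_group v S"
  proof
    fix x assume "x \<in> (*) g ` val_group v S"
    then obtain b where "b \<in> val_group v S" "x = g * b" by auto
    then have "(g / h) * b \<in> val_group v S" "x = h * ((g / h) * b)"
      using val_group_mult[OF S a] g by auto
    then show "x \<in> (*) h ` val_group v S" by blast
  qed
  moreover have "(*) h ` val_group v S \<subseteq> (*) g ` val_group v S"
  proof
    fix x assume "x \<in> (*) h ` val_group v S"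
    then obtain b where b: "b \<in> val_group v S" "x = h * b" by auto
    then have "inverse (g / h) * b \<in> val_group v S" "x = g * (inverse (g / h) * b)"
      using val_group_mult[OF S val_group_inverse[OF S a]] g by auto
    then show "x \<in> (*) g ` val_group v S" by blast
  qed
  ultimately show "(*) g ` val_group v S = (*) h ` val_group v S" by blast
qed

text \<open>Lagrange's theorem for the group of cosets: multiplication by \<open>v z\<close> permutes them, so
  comparing the product of all representatives with its translate gives the claim.\<close>
lemma power_ramification_index:
  assumes S: "is_subfield S" and fin: "finite (ram_cosets v S)" and z: "z \<noteq> 0"
  shows "v z ^ card (ram_cosets v S) \<in> val_group v S"
proof -
  let ?H = "val_group v S" and ?C = "ram_cosets v S"
  let ?g = "v z"
  have g: "?g > 0" using z v_pos by simp
  have "\<exists>h. h \<in> val_group v UNIV \<and> C = (*) h ` ?H" if "C \<in> ?C" for C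
    using that unfolding ram_cosets_def by auto
  then obtain \<rho> where \<rho>: "\<And>C. C \<in> ?C \<Longrightarrow> \<rho> C \<in> val_group v UNIV" "\<And>C. C \<in> ?C \<Longrightarrow> C = (*) (\<rho> C) ` ?H"
    by metis
  have \<rho>pos: "\<rho> C > 0" if "C \<in> ?C" for C using \<rho>(1)[OF that] val_group_pos by blast
  have sf: "is_subfield (UNIV :: 'a set)" by (simp add: is_subfield_def)
  define \<tau> where "\<tau> C = (*) ?g ` C" for C
  have \<tau>C: "\<tau> C \<in> ?C" if "C \<in> ?C" for C
  proof -
    have "\<tau> C = (*) (?g * \<rho> C) ` ?H"
      by (subst \<rho>(2)[OF that]) (simp add: \<tau>_def image_image mult.assoc)
    moreover have "?g * \<rho> C \<in> val_group v UNIV"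
      using z by (intro val_group_mult[OF sf] \<rho>(1)[OF that]) (auto simp: val_group_def)
    ultimately show ?thesis unfolding ram_cosets_def by blast
  qed
  have "inj ((*) ?g)" using g by (auto simp: inj_def)
  then have "inj_on \<tau> ?C"
    unfolding \<tau>_def by (intro inj_onI) (simp only: inj_image_eq_iff)
  then have bij: "bij_betw \<tau> ?C ?C"
    using \<tau>C fin by (metis bij_betw_def endo_inj_surj image_subsetI)
  have "(\<Prod>C\<in>?C. ?g * \<rho> C / \<rho> (\<tau> C)) \<in> ?H"
  proof -
    have in_H: "?g * \<rho> C / \<rho> (\<tau> C) \<in> ?H" if C: "C \<in> ?C" for C
    proof -
      have "(*) (?g * \<rho> C) ` ?H = \<tau> C"
        by (subst (2) \<rho>(2)[OF C]) (simp add: \<tau>_def image_image mult.assoc)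
      also have "\<dots> = (*) (\<rho> (\<tau> C)) ` ?H" by (rule \<rho>(2)[OF \<tau>C[OF C]])
      finally show ?thesis
        using val_group_coset_eq[OF S] g \<rho>pos[OF C] \<rho>pos[OF \<tau>C[OF C]] by simp
    qed
    have one: "1 \<in> ?H" unfolding val_group_def using subfield_one[OF S] by force
    have "prod f A \<in> ?H" if "\<And>C. C \<in> A \<Longrightarrow> f C \<in> ?H" for f :: "real set \<Rightarrow> real" and A
      using that by (induction A rule: infinite_finite_induct) (auto simp: one val_group_mult[OF S])
    then show ?thesis using in_H by simp
  qed
  also have "(\<Prod>C\<in>?C. ?g * \<rho> C / \<rho> (\<tau> C)) = ?g ^ card ?C * (\<Prod>C\<in>?C. \<rho> C) / (\<Prod>C\<in>?C. \<rho> (\<tau> C))"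
    by (simp add: prod_dividef prod.distrib)
  also have "(\<Prod>C\<in>?C. \<rho> (\<tau> C)) = (\<Prod>C\<in>?C. \<rho> C)"
    by (rule prod.reindex_bij_betw[OF bij])
  finally show ?thesis
    using \<rho>pos prod_pos[of ?C \<rho>] by simp
qed

end

section \<open>The field k(t)\<close>

locale nonrational_element = nonarch_field v
  for v :: "'a::field \<Rightarrow> real" +
  fixes k :: "'a set" and t :: 'a
  assumes analytic: "analytic_k_field v k" and t_notin: "t \<notin> k"
begin

lemma k_subfield: "is_subfield k"
  and k_alg_closed: "alg_closed_in k"
  and complete: "v_complete_on v (UNIV :: 'a set)"
  and k_complete: "v_complete_on v k"
  using analytic by (auto simp: analytic_k_field_def)

lemmas k_0 = subfield_zero[OF k_subfield] and k_1 = subfield_one[OF k_subfield]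
  and k_add = subfield_add[OF k_subfield] and k_mult = subfield_mult[OF k_subfield]
  and k_minus = subfield_minus[OF k_subfield] and k_diff = subfield_diff[OF k_subfield]
  and k_inverse = subfield_inverse[OF k_subfield] and k_divide = subfield_divide[OF k_subfield]
  and k_power = subfield_power[OF k_subfield]

lemma k_root:
  assumes "x \<in> k" "n > 0"
  obtains y where "y \<in> k" "y ^ n = x"
proof -
  let ?p = "monom 1 n + [:- x:]"
  have "poly_over k ?p"
    using assms k_0 k_1 k_minus k_subfield
    by (intro poly_over_add) (auto simp: poly_over_monom poly_over_pCons_iff poly_over_0)
  moreover have "degree ?p > 0"
    using assms(2) by (simp add: degree_add_eq_left degree_monom_eq)
  ultimately obtain y where "y \<in> k" "poly ?p y = 0" using k_alg_closed unfolding alg_closed_in_def by blast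
  then show ?thesis using that by (simp add: poly_monom)
qed

lemma val_group_k_divisible:
  assumes "a > 0" "n > 0" "a ^ n \<in> val_group v k"
  shows "a \<in> val_group v k"
proof -
  obtain x where x: "x \<in> k" "x \<noteq> 0" "v x = a ^ n" using assms(3) by (auto simp: val_group_def)
  obtain y where y: "y \<in> k" "y ^ n = x" using k_root[OF x(1) assms(2)] by blast
  then have "v y ^ n = a ^ n" using x(3) v_power by metis
  then have "v y = a" using assms by (simp add: power_eq_iff_eq_base)
  then show ?thesis using y x(2) assms unfolding val_group_def by force
qed

text \<open>Roots of an element of value greater than 1 exist in \<open>k\<close>, and their values
  tend to 1. The powers of such a root form a geometric progression with ratio below
  \<open>b / a'\<close>, so one of them falls into the interval.\<close>

lemma val_group_k_dense:
  assumes "0 \<le> a" "a < b"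
  obtains c where "c \<in> k" "c \<noteq> 0" "a < v c" "v c < b"
proof -
  obtain x0 where x0: "x0 \<in> k" "v x0 \<noteq> 0" "v x0 \<noteq> 1"
    using analytic unfolding analytic_k_field_def by blast
  define x where "x = (if v x0 > 1 then x0 else inverse x0)"
  have x: "x \<in> k" "v x > 1"
    using x0 k_inverse one_less_inverse[OF v_pos[of x0]] by (auto simp: x_def v_inverse not_less)
  \<comment> \<open>Positive even when \<open>a = 0\<close>, since its logarithm is taken.\<close>
  define a' where "a' = max a (b / 2)"
  have a': "0 < a'" "a' < b" "a \<le> a'" using assms by (auto simp: a'_def)
  obtain n where n: "n > 0" "root n (v x) < b / a'"
  proof -
    have "eventually (\<lambda>n. root n (v x) < b / a') sequentially"
      using a' x by (intro order_tendstoD(2)[OF LIMSEQ_root_const]) auto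
    then have "eventually (\<lambda>n. n > 0 \<and> root n (v x) < b / a') sequentially"
      using eventually_gt_at_top[of 0] by (rule eventually_conj[rotated])
    then show ?thesis using that by (auto simp: eventually_sequentially)
  qed
  obtain y where y: "y \<in> k" "y ^ n = x" using k_root[OF x(1) n(1)] by blast
  have "v y ^ n = v x" using y v_power by metis
  then have vy: "v y = root n (v x)" using n(1) by (metis real_root_pos2 v_nonneg)
  then have y1: "v y > 1" using x n by simp
  \<comment> \<open>The least exponent passing \<open>a'\<close>; it overshoots by at most the
    factor \<open>v y\<close>, which is below \<open>b / a'\<close>.\<close>
  define m where "m = \<lfloor>log (v y) a'\<rfloor> + 1"
  define c where "c = (if m \<ge> 0 then y ^ nat m else inverse y ^ nat (- m))"
  have vc: "v c = v y powr m"
  proof -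
    have "v c = v y powi m"
      by (simp add: c_def v_power v_inverse power_int_def)
    then show ?thesis using y1 by (subst powr_real_of_int') auto
  qed
  have "a' = v y powr log (v y) a'" using a' y1 by simp
  also have "\<dots> < v y powr m" using y1 by (intro powr_less_mono) (auto simp: m_def)
  finally have c1: "a' < v c" using vc by simp
  have "v y powr m \<le> v y powr (log (v y) a' + 1)"
    using y1 by (intro powr_mono) (auto simp: m_def)
  also have "\<dots> = a' * v y" using a' y1 by (simp add: powr_add)
  also have "\<dots> < b" using n vy a' by (simp add: field_simps)
  finally have "v c < b" using vc by simp
  moreover have "c \<in> k" using y by (auto simp: c_def intro!: k_power k_inverse)
  moreover have "c \<noteq> 0" using c1 a' by auto
  ultimately show ?thesis using that[of c] c1 a' by simp
qed

section \<open>The radius and polynomials in t\<close>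

definition r where "r = radius v k t"

lemma r_le: "a \<in> k \<Longrightarrow> r \<le> v (t - a)"
  unfolding r_def radius_def by (rule cINF_lower) (auto intro!: bdd_belowI2[where m = 0])

lemma r_less: "r < x \<Longrightarrow> \<exists>a\<in>k. v (t - a) < x"
  unfolding r_def radius_def using k_0 by (subst (asm) cINF_less_iff) (auto intro!: bdd_belowI2[where m = 0])

text \<open>A complete \<open>k\<close> is closed, so an element outside it keeps a positive
  distance from it.\<close>

lemma r_pos: "r > 0"
proof (rule ccontr)
  assume "\<not> r > 0"
  then have "r < inverse (real (Suc n))" for n
    by (smt (verit) inverse_positive_iff_positive of_nat_0_less_iff zero_less_Suc)
  then have "\<exists>a\<in>k. v (t - a) < inverse (real (Suc n))" for n by (rule r_less)
  then obtain X where X: "\<And>n. X n \<in> k" "\<And>n. v (t - X n) < inverse (real (Suc n))" by metis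
  have "vlim X t"
    unfolding vlim_def
    by (rule tendsto_0_squeeze[OF LIMSEQ_inverse_real_of_nat])
       (use X(2) in \<open>auto simp: v_diff_commute[of _ t] intro: less_imp_le\<close>)
  moreover obtain L where "L \<in> k" "vlim X L"
    using completeD[OF k_complete, of X, OF X(1) vlim_cauchy[OF calculation]] by blast
  ultimately show False using vlim_unique t_notin by blast
qed

text \<open>Over an algebraically closed \<open>k\<close>, polynomials are built from constants by
  linear factors; synthetic division keeps the quotient over \<open>k\<close>.\<close>

lemma k_poly_induct [consumes 1, case_names const mult]:
  assumes "poly_over k p"
    and "\<And>c. c \<in> k \<Longrightarrow> Q [:c:]"
    and "\<And>a q. a \<in> k \<Longrightarrow> poly_over k q \<Longrightarrow> q \<noteq> 0 \<Longrightarrow> Q q \<Longrightarrow> Q ([:- a, 1:] * q)"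
  shows "Q p"
  using assms(1)
proof (induction "degree p" arbitrary: p rule: less_induct)
  case less
  show ?case
  proof (cases "degree p = 0")
    case True
    then show ?thesis using assms(2) less.prems by (metis degree_eq_zeroE poly_over_pCons_iff)
  next
    case False
    then obtain a where a: "a \<in> k" "poly p a = 0"
      using k_alg_closed less.prems unfolding alg_closed_in_def by auto
    define q where "q = synthetic_div p a"
    have p: "p = [:- a, 1:] * q"
      using synthetic_div_correct'[of a p] a(2) by (simp add: q_def)
    have syn: "poly_over k (synthetic_div f a) \<and> poly f a \<in> k" if "poly_over k f" for f
      using that
    proof (induction f)
      case (pCons b f)
      then show ?case
        using a(1) by (auto simp: poly_over_pCons_iff k_add k_mult)
    qed (use k_0 in \<open>auto simp: poly_over_def\<close>)
    have "q \<noteq> 0" using False p by auto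
    moreover from this have "degree q < degree p" by (simp add: p degree_mult_eq del: mult_pCons_left)
    moreover have "poly_over k q" using syn[OF less.prems] by (simp add: q_def)
    ultimately show ?thesis using assms(3)[OF a(1)] less.hyps p by metis
  qed
qed

lemma t_diff_nonzero: "a \<in> k \<Longrightarrow> t - a \<noteq> 0"
  using t_notin by auto

lemma poly_t_nonzero: "poly_over k p \<Longrightarrow> p \<noteq> 0 \<Longrightarrow> poly p t \<noteq> 0"
proof (induction p rule: k_poly_induct)
  case (mult a q)
  then show ?case using t_diff_nonzero[of a] by simp
qed auto

lemma pderiv_t_bound: "poly_over k p \<Longrightarrow> v (poly (pderiv p) t) \<le> v (poly p t) / r"
proof (induction p rule: k_poly_induct)
  case (const c)
  then show ?case using r_pos by (simp add: pderiv_pCons)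
next
  case (mult a q)
  have 1: "r \<le> v (t - a)" using r_le mult by blast
  have "poly (pderiv ([:- a, 1:] * q)) t = poly q t + (t - a) * poly (pderiv q) t"
    unfolding pderiv_mult by (simp add: pderiv_pCons algebra_simps)
  also have "v \<dots> \<le> v (t - a) * v (poly q t) / r"
  proof (rule v_add_bound)
    show "v (poly q t) \<le> v (t - a) * v (poly q t) / r"
      using 1 r_pos mult_right_mono[OF 1 v_nonneg[of "poly q t"]] by (simp add: field_simps)
    show "v ((t - a) * poly (pderiv q) t) \<le> v (t - a) * v (poly q t) / r"
      using mult_left_mono[OF mult.IH v_nonneg[of "t - a"]] by (simp add: v_mult)
  qed
  finally show ?case by (simp add: v_mult[symmetric] algebra_simps)
qed

section \<open>Rational functions of t and their derivation\<close>

definition kt where "kt = rat_fun_field k t"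

lemma kt_I: "poly_over k p \<Longrightarrow> poly_over k q \<Longrightarrow> q \<noteq> 0 \<Longrightarrow> poly p t / poly q t \<in> kt"
  unfolding kt_def rat_fun_field_def using poly_t_nonzero by blast

lemma kt_E:
  assumes "x \<in> kt"
  obtains p q where "poly_over k p" "poly_over k q" "q \<noteq> 0" "poly q t \<noteq> 0" "x = poly p t / poly q t"
proof -
  obtain p q where "poly_over k p" "poly_over k q" "poly q t \<noteq> 0" "x = poly p t / poly q t"
    using assms unfolding kt_def rat_fun_field_def by blast
  moreover from this have "q \<noteq> 0" by auto
  ultimately show thesis using that by blast
qed

lemma poly_over_k_const: "a \<in> k \<Longrightarrow> poly_over k [:a:]"
  using k_subfield by (simp add: poly_over_pCons_iff poly_over_0)

lemma poly_over_k_1: "poly_over k 1"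
  using poly_over_k_const[OF k_1] by (simp add: one_pCons)

lemma poly_kt: "poly_over k p \<Longrightarrow> poly p t \<in> kt"
  using kt_I[of p 1] poly_over_k_1 by simp

lemma k_subset_kt: "k \<subseteq> kt"
proof
  fix a assume "a \<in> k"
  then show "a \<in> kt" using poly_kt[OF poly_over_k_const] by fastforce
qed

lemma t_in_kt: "t \<in> kt"
  using poly_kt[of "[:0, 1:]"] k_0 k_1 k_subfield by (simp add: poly_over_pCons_iff poly_over_0)

lemma kt_subfield: "is_subfield kt"
  unfolding is_subfield_def
proof (intro conjI ballI)
  show "0 \<in> kt" "1 \<in> kt" using k_subset_kt k_0 k_1 by auto
  fix x assume "x \<in> kt"
  then obtain p q where x: "poly_over k p" "poly_over k q" "q \<noteq> 0" "poly q t \<noteq> 0" "x = poly p t / poly q t"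
    by (rule kt_E)
  show "- x \<in> kt" using kt_I[OF poly_over_minus[OF k_subfield x(1)] x(2,3)] x(5) by simp
  show "inverse x \<in> kt"
  proof (cases "p = 0")
    case False
    then show ?thesis using kt_I[OF x(2,1)] x(5) by simp
  qed (use x k_subset_kt k_0 in auto)
  fix y assume "y \<in> kt"
  then obtain p' q' where y: "poly_over k p'" "poly_over k q'" "q' \<noteq> 0" "poly q' t \<noteq> 0" "y = poly p' t / poly q' t"
    by (rule kt_E)
  have "x + y = poly (p * q' + p' * q) t / poly (q * q') t"
    using x(4,5) y(4,5) by (simp add: add_frac_eq)
  then show "x + y \<in> kt"
    using x y k_subfield by (simp only:) (intro kt_I poly_over_add poly_over_mult; simp)
  have "x * y = poly (p * p') t / poly (q * q') t"
    using x(5) y(5) by simp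
  then show "x * y \<in> kt"
    using x y k_subfield by (simp only:) (intro kt_I poly_over_mult; simp)
qed

lemma derivation_kt:
  "\<exists>D. derivation_on kt D \<and> (\<forall>c\<in>k. D c = 0) \<and> D t = 1 \<and> (\<forall>x\<in>kt. v (D x) \<le> inverse r * v x)"
proof -
  define dq where "dq p q = (poly (pderiv p) t * poly q t - poly p t * poly (pderiv q) t) / (poly q t)\<^sup>2" for p q
  define D where "D x = (let (p, q) = SOME (p, q). poly_over k p \<and> poly_over k q \<and> q \<noteq> 0 \<and> x = poly p t / poly q t in dq p q)" for x
  have D: "D x = dq p q" if pq: "poly_over k p" "poly_over k q" "q \<noteq> 0" "x = poly p t / poly q t" for x p q
  proof -
    obtain p' q' where 1: "(SOME (p, q). poly_over k p \<and> poly_over k q \<and> q \<noteq> 0 \<and> x = poly p t / poly q t) = (p', q')"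
      by (cases "SOME (p, q). poly_over k p \<and> poly_over k q \<and> q \<noteq> 0 \<and> x = poly p t / poly q t")
    have "\<exists>z. case z of (p, q) \<Rightarrow> poly_over k p \<and> poly_over k q \<and> q \<noteq> 0 \<and> x = poly p t / poly q t"
      using pq by auto
    from someI_ex[OF this] have 2: "poly_over k p'" "poly_over k q'" "q' \<noteq> 0" "x = poly p' t / poly q' t"
      unfolding 1 by auto
    have nz: "poly q t \<noteq> 0" "poly q' t \<noteq> 0" using pq 2 poly_t_nonzero by auto
    have "poly (p * q' - p' * q) t = 0" using pq(4) 2(4) nz by (simp add: field_simps)
    moreover have "poly_over k (p * q' - p' * q)"
      using pq 2 k_subfield by (intro poly_over_diff poly_over_mult; simp)
    \<comment> \<open>Since \<open>t\<close> is transcendental over \<open>k\<close>, equality of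
      two fractions at \<open>t\<close> lifts to a polynomial identity, which may be differentiated.
      This makes \<open>D\<close> independent of the chosen fraction.\<close>
    ultimately have eq: "p * q' = p' * q" using poly_t_nonzero by fastforce
    from arg_cong[OF eq, of "\<lambda>f. poly f t"] have e1: "poly p t * poly q' t = poly p' t * poly q t" by simp
    from arg_cong[OF eq, of "\<lambda>f. poly (pderiv f) t"]
    have e2: "poly p t * poly (pderiv q') t + poly (pderiv p) t * poly q' t
       = poly p' t * poly (pderiv q) t + poly (pderiv p') t * poly q t"
      by (simp add: pderiv_mult algebra_simps)
    have "dq p q = dq p' q'"
      unfolding dq_def using nz
    proof (simp add: frac_eq_eq, goal_cases)
      case 1
      then show ?case using e1 e2 by algebra
    qed
    then show ?thesis by (simp add: D_def 1)
  qed
  have "derivation_on kt D"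
    unfolding derivation_on_def
  proof (intro ballI)
    fix x y assume "x \<in> kt" "y \<in> kt"
    then obtain p q p' q' where x: "poly_over k p" "poly_over k q" "q \<noteq> 0" "poly q t \<noteq> 0" "x = poly p t / poly q t"
      and y: "poly_over k p'" "poly_over k q'" "q' \<noteq> 0" "poly q' t \<noteq> 0" "y = poly p' t / poly q' t"
      by (meson kt_E)
    have Dx: "D x = dq p q" "D y = dq p' q'" using x y by (auto intro: D)
    have "D (x + y) = dq (p * q' + p' * q) (q * q')"
      using x y k_subfield by (intro D poly_over_add poly_over_mult) (simp_all add: add_frac_eq)
    moreover have "D (x * y) = dq (p * p') (q * q')"
      using x y k_subfield by (intro D poly_over_mult) auto
    moreover have "dq (p * q' + p' * q) (q * q') = dq p q + dq p' q'"
      using x(4) y(4) unfolding dq_def pderiv_add pderiv_mult poly_add poly_mult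
      by (simp add: divide_simps) algebra
    moreover have "dq (p * p') (q * q') = x * dq p' q' + y * dq p q"
      using x(4) y(4) unfolding dq_def pderiv_add pderiv_mult poly_add poly_mult x(5) y(5)
      by (simp add: divide_simps) algebra
    ultimately show "D (x + y) = D x + D y \<and> D (x * y) = x * D y + y * D x"
      unfolding Dx by simp
  qed
  moreover have "D c = 0" if "c \<in> k" for c
    using D[of "[:c:]" 1 c] that poly_over_k_const poly_over_k_1 by (simp add: dq_def pderiv_pCons)
  moreover have "D t = 1"
    using D[of "[:0, 1:]" 1 t] poly_over_k_1 k_0 k_1 k_subfield
    by (simp add: dq_def pderiv_pCons poly_over_pCons_iff poly_over_0)
  moreover have "v (D x) \<le> inverse r * v x" if x: "x \<in> kt" for x
  proof -
    obtain p q where x: "poly_over k p" "poly_over k q" "q \<noteq> 0" "poly q t \<noteq> 0" "x = poly p t / poly q t"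
      using kt_E[OF x] by blast
    have "v (poly (pderiv p) t * poly q t - poly p t * poly (pderiv q) t) \<le> v (poly p t) * v (poly q t) / r"
      using mult_right_mono[OF pderiv_t_bound[OF x(1)] v_nonneg[of "poly q t"]]
        mult_left_mono[OF pderiv_t_bound[OF x(2)] v_nonneg[of "poly p t"]]
      by (intro v_diff_bound) (simp_all add: v_mult)
    then have "v (dq p q) \<le> v (poly p t) * v (poly q t) / r / (v (poly q t))\<^sup>2"
      unfolding dq_def v_divide v_power by (intro divide_right_mono) auto
    also have "\<dots> = inverse r * v x"
      using x(4) by (simp add: x(5) v_divide field_simps power2_eq_square)
    finally show ?thesis using D[OF x(1,2,3,5)] by simp
  qed
  ultimately show ?thesis by blast
qed

end

section \<open>The derivation of a tamely ramified extension\<close>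

context nonarch_field
begin

section \<open>Separating polynomials and orthogonal bases\<close>

lemma v_poly_bound:
  assumes "v y \<le> 1" "0 \<le> C" "\<And>i. v (coeff p i) \<le> C"
  shows "v (poly p y) \<le> C"
  using assms(3)
proof (induction p)
  case (pCons a p)
  have "v a \<le> C" using pCons.prems[of 0] by simp
  moreover have "v (poly p y) \<le> C" using pCons.prems[of "Suc _"] by (intro pCons.IH) simp
  then have "v y * v (poly p y) \<le> 1 * C" using assms(1,2) by (intro mult_mono) auto
  ultimately show ?case by (simp add: v_add_bound v_mult)
qed (use assms in simp)

lemma v_poly_bound_less:
  assumes "v y \<le> 1" "0 < C" "\<And>i. v (coeff p i) < C"
  shows "v (poly p y) < C"
  using assms(3)
proof (induction p)
  case (pCons a p)
  have "v a < C" using pCons.prems[of 0] by simp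
  moreover have "v (poly p y) < C" using pCons.prems[of "Suc _"] by (intro pCons.IH) simp
  then have "v y * v (poly p y) < C"
    using assms(1) mult_right_mono[OF assms(1) v_nonneg[of "poly p y"]] by simp
  ultimately show ?case by (simp add: v_add_bound_less v_mult)
qed (use assms in simp)

text \<open>At \<open>y\<close> the Bezout identity says that \<open>B(y) P'(y)\<close> is congruent
  to 1, since \<open>P(y)\<close> is small; both factors are integral, hence units. Only the residue
  class of \<open>y\<close> is a root, so \<open>P(y)\<close> itself need not vanish.\<close>

lemma separating_poly:
  assumes "res_separable v S" "v y \<le> 1"
  obtains P where "poly_over (ring_int v S) P" "v (poly P y) < 1" "v (poly (pderiv P) y) = 1"
proof -
  obtain P A B where PAB: "poly_over (ring_int v S) P" "poly_over (ring_int v S) A" "poly_over (ring_int v S) B"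
      "v (poly P y) < 1" "\<forall>i. v (coeff (A * P + B * pderiv P - 1) i) < 1"
    using assms unfolding res_separable_def by blast
  have le1: "v (poly Q y) \<le> 1" if "poly_over (ring_int v S) Q" for Q
    using that assms(2) by (intro v_poly_bound) (auto simp: poly_over_def ring_int_def)
  have P': "v (poly (pderiv P) y) \<le> 1"
  proof (rule v_poly_bound[OF assms(2)])
    fix i show "v (coeff (pderiv P) i) \<le> 1"
      unfolding coeff_pderiv using PAB(1) v_of_nat
      by (intro v_mult_le_1) (auto simp: poly_over_def ring_int_def simp del: of_nat_Suc)
  qed simp
  have "v (poly (A * P + B * pderiv P - 1) y) < 1"
    using PAB(5) assms(2) by (intro v_poly_bound_less) auto
  moreover have "v (poly (A * P) y) < 1"
  proof -
    have "v (poly A y) * v (poly P y) \<le> 1 * v (poly P y)"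
      by (intro mult_right_mono le1 PAB) simp
    then show ?thesis using PAB(4) by (simp add: v_mult)
  qed
  ultimately have "v (poly (A * P + B * pderiv P - 1) y - poly (A * P) y) < 1"
    by (rule v_diff_bound_less)
  moreover have "poly (A * P + B * pderiv P - 1) y - poly (A * P) y = - (1 - poly (B * pderiv P) y)"
    by simp
  ultimately have "v (1 - poly (B * pderiv P) y) < v 1"
    by (simp only: v_minus v_1)
  then have "v (poly B y) * v (poly (pderiv P) y) = 1"
    using v_eq_of_close[of 1 "poly (B * pderiv P) y"] by (simp add: v_mult)
  moreover have "v (poly B y) * v (poly (pderiv P) y) \<le> 1 * v (poly (pderiv P) y)"
    by (intro mult_right_mono le1 PAB) simp
  ultimately have "v (poly (pderiv P) y) = 1" using P' by simp
  then show ?thesis using that PAB by blast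
qed

lemma res_basisD:
  assumes "res_basis v S f c" "\<And>i. i < f \<Longrightarrow> a i \<in> ring_int v S" "v (\<Sum>i<f. a i * c i) < 1" "j < f"
  shows "v (a j) < 1"
proof -
  have "(\<forall>i<f. a i \<in> ring_int v S) \<and> v (\<Sum>i<f. a i * c i) < 1 \<longrightarrow> (\<forall>i<f. v (a i) < 1)"
    using assms(1) unfolding res_basis_def by (elim conjE allE[where x = a])
  then show ?thesis using assms(2,3,4) by simp
qed

lemma res_basis_norm:
  assumes "res_basis v S f c" "is_subfield S" "j < f"
  shows "v (c j) = 1"
proof -
  let ?a = "\<lambda>i. if i = j then 1 else 0 :: 'a"
  have "?a i \<in> ring_int v S" for i
    using assms(2) by (auto simp: ring_int_def subfield_zero subfield_one)
  moreover have "?a i * c i = (if i = j then c i else 0)" for i by simp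
  then have "(\<Sum>i<f. ?a i * c i) = c j" using assms(3) by (simp only:) simp
  ultimately have "\<not> v (c j) < 1"
    using res_basisD[OF assms(1), of ?a j] assms(3) by fastforce
  moreover have "v (c j) \<le> 1" using assms(1,3) by (simp add: res_basis_def)
  ultimately show ?thesis by simp
qed

text \<open>Dividing by a coefficient of largest value gives an integral combination with a
  coefficient 1, whose residue cannot vanish. The disjunction \<open>nz\<close> offers two ways to
  know that some coefficient is nonzero: from the sum, or directly.\<close>

lemma res_basis_sum:
  assumes rb: "res_basis v S f c" and S: "is_subfield S" and a: "\<And>j. j < f \<Longrightarrow> a j \<in> S"
    and nz: "(\<Sum>j<f. a j * c j) \<noteq> 0 \<or> j < f \<and> a j \<noteq> 0"
  shows "\<exists>m<f. a m \<noteq> 0 \<and> v (\<Sum>j<f. a j * c j) = v (a m) \<and> (\<forall>j<f. v (a j) \<le> v (a m))"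
proof -
  have f: "f > 0" using nz by (cases f) auto
  define M where "M = Max ((\<lambda>j. v (a j)) ` {..<f})"
  have "M \<in> (\<lambda>j. v (a j)) ` {..<f}" unfolding M_def using f by (intro Max_in) auto
  then obtain m where m: "m < f" "M = v (a m)" by auto
  have max: "v (a j) \<le> v (a m)" if "j < f" for j
    unfolding m(2)[symmetric] M_def using that by (intro Max_ge) auto
  have am: "a m \<noteq> 0"
  proof
    assume "a m = 0"
    then have "a j = 0" if "j < f" for j using max[OF that] v_nonneg[of "a j"] v_eq_0[of "a j"] by simp
    then show False using nz by auto
  qed
  let ?s = "\<Sum>j<f. a j * c j"
  have "v ?s \<le> v (a m)"
    using max res_basis_norm[OF rb S] by (intro v_sum_bound) (auto simp: v_mult)
  moreover have "\<not> v ?s < v (a m)"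
  proof
    assume less: "v ?s < v (a m)"
    have eq: "(\<Sum>j<f. a j / a m * c j) = ?s / a m" by (simp add: sum_divide_distrib)
    have "v (\<Sum>j<f. a j / a m * c j) < 1"
      unfolding eq using less am v_pos[OF am] by (simp add: v_divide)
    moreover have "a j / a m \<in> ring_int v S" if "j < f" for j
      using a[OF that] a[OF m(1)] max[OF that] v_pos[OF am] S
      by (simp add: ring_int_def subfield_divide v_divide)
    ultimately have "v (a m / a m) < 1" using res_basisD[OF rb, of "\<lambda>j. a j / a m"] m by blast
    then show False using am by simp
  qed
  ultimately show ?thesis using m am max by (intro exI[of _ m]) auto
qed

text \<open>The values of the \<open>z g\<close> lie in different cosets and the residues of the
  \<open>c j\<close> are independent, so the products \<open>z g * c j\<close> are orthogonal. In
  the absence of defect their number is the degree, so they form a basis, and orthogonality bounds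
  each term of an expansion. The \<open>x g\<close> come from
  \<open>power_ramification_index\<close>; with them a power of \<open>z g\<close> becomes a unit
  times an element of \<open>S\<close>.\<close>

lemma tame_basis:
  assumes S: "is_subfield S" and tame: "tamely_ramified v S"
  obtains f :: nat and c :: "nat \<Rightarrow> 'a" and z x :: "real set \<Rightarrow> 'a" where
    "\<And>j. j < f \<Longrightarrow> v (c j) = 1"
    "\<And>g. g \<in> ram_cosets v S \<Longrightarrow> z g \<noteq> 0"
    "\<And>g. g \<in> ram_cosets v S \<Longrightarrow> x g \<in> S"
    "\<And>g. g \<in> ram_cosets v S \<Longrightarrow> v (x g) = v (z g) ^ card (ram_cosets v S)"
    "\<And>y. \<exists>a. (\<forall>j<f. \<forall>g\<in>ram_cosets v S. a j g \<in> S \<and> v (a j g * z g) \<le> v y)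
        \<and> y = (\<Sum>j<f. \<Sum>g\<in>ram_cosets v S. a j g * z g * c j)"
proof -
  let ?C = "ram_cosets v S"
  have fin: "finite ?C" using tame by (simp add: tamely_ramified_def)
  obtain n b f c where b: "is_basis_over S n b" and rb: "res_basis v S f c" and n: "n = card ?C * f"
    using tame unfolding tamely_ramified_def by blast
  have "\<exists>y. y \<noteq> 0 \<and> g = (*) (v y) ` val_group v S" if "g \<in> ?C" for g
    using that by (auto simp: ram_cosets_def val_group_def)
  then obtain z where z: "\<And>g. g \<in> ?C \<Longrightarrow> z g \<noteq> 0" "\<And>g. g \<in> ?C \<Longrightarrow> g = (*) (v (z g)) ` val_group v S"
    by metis
  have "\<exists>y\<in>S. v y = v (z g) ^ card ?C" if "g \<in> ?C" for g
    using power_ramification_index[OF S fin z(1)[OF that]] by (auto simp: val_group_def)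
  then obtain x where x: "\<And>g. g \<in> ?C \<Longrightarrow> x g \<in> S" "\<And>g. g \<in> ?C \<Longrightarrow> v (x g) = v (z g) ^ card ?C"
    by metis
  have orth: "v (a j g * z g) \<le> v (\<Sum>j<f. \<Sum>g\<in>?C. a j g * z g * c j)"
    if a: "\<And>j g. j < f \<Longrightarrow> g \<in> ?C \<Longrightarrow> a j g \<in> S" and jg: "j < f" "g \<in> ?C" for a j g
  proof -
    \<comment> \<open>For fixed \<open>g\<close> the sum over \<open>j\<close> has the value of one
      of its coefficients, a value of \<open>S\<close>. Hence nonzero terms \<open>z g * s g\<close>
      have values in distinct cosets and \<open>v_sum_distinct\<close> applies.\<close>
    define s where "s g = (\<Sum>j<f. a j g * c j)" for g
    have sum: "(\<Sum>j<f. \<Sum>g\<in>?C. a j g * z g * c j) = (\<Sum>g\<in>?C. z g * s g)"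
      by (subst sum.swap) (simp add: s_def sum_distrib_left mult.assoc mult.left_commute)
    have vs: "\<exists>m<f. a m g \<noteq> 0 \<and> v (s g) = v (a m g) \<and> (\<forall>j<f. v (a j g) \<le> v (a m g))"
      if "g \<in> ?C" "s g \<noteq> 0 \<or> j < f \<and> a j g \<noteq> 0" for g j
      using res_basis_sum[OF rb S, of "\<lambda>j. a j g" j] a that by (simp add: s_def)
    have "v (a j g * z g) \<le> v (z g * s g)"
    proof (cases "a j g = 0")
      case False
      then show ?thesis
        using vs[OF jg(2), of j] jg(1) by (auto simp: v_mult mult.commute[of "v (a j g)"] intro!: mult_left_mono)
    qed simp
    also have "\<dots> \<le> v (\<Sum>g\<in>?C. z g * s g)"
    proof (rule v_sum_distinct[OF fin _ jg(2)])
      fix g h assume gh: "g \<in> ?C" "h \<in> ?C" "z g * s g \<noteq> 0" "v (z g * s g) = v (z h * s h)"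
      have "z h * s h \<noteq> 0" using gh(3,4) v_eq_0 by metis
      then obtain i l where il: "i < f" "l < f" "a i g \<noteq> 0" "a l h \<noteq> 0" "v (s g) = v (a i g)" "v (s h) = v (a l h)"
        using vs[OF gh(1), of 0] vs[OF gh(2), of 0] gh(3) by auto
      have "v (z g) / v (z h) = v (a l h / a i g)"
        using gh(4) il z(1)[OF gh(2)] by (simp add: v_mult v_divide field_simps)
      moreover have "a l h / a i g \<in> S" "a l h / a i g \<noteq> 0"
        using il gh a S by (auto intro: subfield_divide)
      ultimately have "v (z g) / v (z h) \<in> val_group v S" unfolding val_group_def by blast
      then show "g = h"
        using val_group_coset_eq[OF S v_pos[OF z(1)[OF gh(1)]] v_pos[OF z(1)[OF gh(2)]]] z(2) gh by metis
    qed
    finally show ?thesis using sum by simp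
  qed
  define I where "I = {..<f} \<times> ?C"
  have expand: "\<exists>a. (\<forall>i\<in>I. a i \<in> S) \<and> y = (\<Sum>i\<in>I. a i * (z (snd i) * c (fst i)))" for y
  proof (rule independent_spans[OF S b])
    show "finite I" "card I = n" using fin n by (auto simp: I_def card_cartesian_product)
    fix a :: "nat \<times> real set \<Rightarrow> 'a" and i
    assume a: "\<And>i. i \<in> I \<Longrightarrow> a i \<in> S" and 0: "(\<Sum>i\<in>I. a i * (z (snd i) * c (fst i))) = 0" and i: "i \<in> I"
    have "(\<Sum>j<f. \<Sum>g\<in>?C. a (j, g) * z g * c j) = 0"
      using 0 by (simp add: I_def sum.cartesian_product' mult.assoc)
    then have "v (a (fst i, snd i) * z (snd i)) \<le> 0"
      using orth[of "\<lambda>j g. a (j, g)" "fst i" "snd i"] a i by (auto simp: I_def)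
    then have "a i * z (snd i) = 0" using v_nonneg[of "a i * z (snd i)"] v_eq_0 by (metis antisym prod.collapse)
    then show "a i = 0" using z(1)[of "snd i"] i by (auto simp: I_def)
  qed
  have "\<exists>a. (\<forall>j<f. \<forall>g\<in>?C. a j g \<in> S \<and> v (a j g * z g) \<le> v y)
        \<and> y = (\<Sum>j<f. \<Sum>g\<in>?C. a j g * z g * c j)" for y
  proof -
    obtain a where a: "\<forall>i\<in>I. a i \<in> S" "y = (\<Sum>i\<in>I. a i * (z (snd i) * c (fst i)))"
      using expand by blast
    have y: "y = (\<Sum>j<f. \<Sum>g\<in>?C. a (j, g) * z g * c j)"
      using a(2) by (simp add: I_def sum.cartesian_product' mult.assoc)
    have "v (a (j, g) * z g) \<le> v y" if "j < f" "g \<in> ?C" for j g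
      unfolding y using a(1) that by (intro orth[of "\<lambda>j g. a (j, g)"]) (auto simp: I_def)
    then show ?thesis using a(1) y by (intro exI[of _ "\<lambda>j g. a (j, g)"]) (auto simp: I_def)
  qed
  then show ?thesis by (intro that[OF res_basis_norm[OF rb S] z(1) x]) simp_all
qed

end

section \<open>The derivation of K and its bound\<close>

locale tame_element = nonrational_element v k t
  for v :: "'a::field \<Rightarrow> real" and k :: "'a set" and t :: 'a +
  assumes tame: "tame_parameter v k t"
begin

definition F where "F = compl_kt v k t"

lemma F_closure: "F = v_closure v kt"
  by (simp add: F_def compl_kt_def kt_def)

lemma F_subfield: "is_subfield F"
  unfolding F_closure by (rule closure_subfield[OF kt_subfield])

lemma kt_subset_F: "kt \<subseteq> F"
  unfolding F_closure by (rule closure_superset)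

lemma tame_F: "finite_over F" "separable_over F" "tamely_ramified v F" "res_separable v F"
  using tame by (auto simp: tame_parameter_def F_def tamely_ramified_def)

lemma derivation_exists:
  "\<exists>D. derivation_on UNIV D \<and> (\<forall>c\<in>k. D c = 0) \<and> D t = 1 \<and> (\<forall>x\<in>F. v (D x) \<le> v x / r)"
proof -
  obtain D0 where D0: "derivation_on kt D0" "\<forall>c\<in>k. D0 c = 0" "D0 t = 1" "\<forall>x\<in>kt. v (D0 x) \<le> inverse r * v x"
    using derivation_kt by blast
  have "inverse r > 0" using r_pos by simp
  then obtain D1 where D1: "derivation_on F D1" "\<forall>x\<in>kt. D1 x = D0 x" "\<forall>x\<in>F. v (D1 x) \<le> inverse r * v x"
    using bounded_derivation_extends_to_closure[OF kt_subfield D0(1) _ _ complete, of "inverse r"] D0(4)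
    unfolding F_closure by blast
  obtain D where D: "derivation_on UNIV D" "\<forall>x\<in>F. D x = D1 x"
    using derivation_extends_to_separable[OF F_subfield D1(1) tame_F(2,1)] by blast
  have "D c = 0" if "c \<in> k" for c
    using that k_subset_kt kt_subset_F D0 D1 D by (metis subsetD)
  moreover have "D t = 1" using t_in_kt kt_subset_F D0 D1 D by (metis subsetD)
  ultimately show ?thesis using D D1 by (auto simp: field_simps)
qed

definition D where "D = (SOME D. derivation_on UNIV D \<and> (\<forall>c\<in>k. D c = 0) \<and> D t = 1 \<and> (\<forall>x\<in>F. v (D x) \<le> v x / r))"

lemma D_derivation: "derivation_on UNIV D"
  and D_k: "c \<in> k \<Longrightarrow> D c = 0"
  and D_t: "D t = 1"
  and D_F_bound: "x \<in> F \<Longrightarrow> v (D x) \<le> v x / r"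
  using someI_ex[OF derivation_exists] unfolding D_def[symmetric] by auto

lemma D_add: "D (x + y) = D x + D y"
  and D_mult: "D (x * y) = x * D y + y * D x"
  using D_derivation by (auto simp: derivation_on_def)

lemma D_diff: "D (x - y) = D x - D y"
  and D_0: "D 0 = 0"
  and D_1: "D 1 = 0"
  using derivation_on_diff[OF _ D_derivation]
    derivation_on_0[OF _ D_derivation] derivation_on_1[OF _ D_derivation]
  by (auto simp: is_subfield_def)

lemma D_sum: "D (sum f I) = (\<Sum>i\<in>I. D (f i))"
  by (induction I rule: infinite_finite_induct) (auto simp: D_0 D_add)

lemma D_power: "D (x ^ n) = of_nat n * x ^ (n - 1) * D x"
proof (induction n)
  case (Suc n)
  have "x ^ n = x ^ (n - 1) * x" if "n > 0" using that by (simp add: power_eq_if)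
  then show ?case using Suc by (cases "n = 0") (auto simp: D_mult algebra_simps)
qed (simp add: D_1)

lemma D_k_mult: "c \<in> k \<Longrightarrow> D (c * x) = c * D x"
  by (simp add: D_mult D_k)

lemma D_poly: "D (poly P y) = poly (map_poly D P) y + poly (pderiv P) y * D y"
  by (induction P) (auto simp: D_0 D_add D_mult map_poly_pCons pderiv_pCons algebra_simps)

definition e where "e = card (ram_cosets v F)"

text \<open>The ramification index is prime to the residue characteristic, so it can be divided out
  after an \<open>e\<close>-th power has been differentiated.\<close>

lemma v_e: "v (of_nat e) = 1"
proof -
  have "finite (ram_cosets v F)" "ram_cosets v F \<noteq> {}"
    using tame_F(3) by (auto simp: tamely_ramified_def ram_cosets_def val_group_def intro: exI[of _ 1])
  then have "e > 0" by (simp add: e_def card_gt_0_iff)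
  then show ?thesis
    using v_of_nat_unit tame_F(3) by (auto simp: tamely_ramified_def e_def)
qed

lemma e_pos: "e > 0"
  using v_e by (cases "e = 0") auto

text \<open>Differentiate \<open>poly P y\<close> and solve for \<open>D y\<close>, whose
  coefficient \<open>P'(y)\<close> is a unit. The coefficients of \<open>P\<close> are integral
  elements of \<open>F\<close> and contribute at most \<open>1 / r\<close>.\<close>

lemma D_separating_poly_bound:
  assumes "poly_over (ring_int v F) P" "v y \<le> 1" "v (poly (pderiv P) y) = 1"
  shows "v (D y) \<le> max (inverse r) (v (D (poly P y)))"
proof -
  have "v (poly (map_poly D P) y) \<le> inverse r"
  proof (rule v_poly_bound[OF assms(2)])
    fix i
    have "coeff P i \<in> F" "v (coeff P i) \<le> 1" using assms(1) by (auto simp: poly_over_def ring_int_def)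
    then have "v (D (coeff P i)) \<le> 1 / r"
      using D_F_bound r_pos by (meson divide_right_mono less_imp_le order_trans)
    then show "v (coeff (map_poly D P) i) \<le> inverse r" by (simp add: coeff_map_poly D_0 field_simps)
  qed (use r_pos in simp)
  moreover have "poly (pderiv P) y * D y = D (poly P y) - poly (map_poly D P) y"
    by (simp add: D_poly)
  then have "v (D y) = v (D (poly P y) - poly (map_poly D P) y)"
    using assms(3) v_mult[of "poly (pderiv P) y" "D y"] by simp
  ultimately show ?thesis
    using v_diff_le[of "D (poly P y)" "poly (map_poly D P) y"] by linarith
qed

lemma D_bound: "v (D y) \<le> v y / r"
proof -
  let ?C = "ram_cosets v F"
  obtain f :: nat and c :: "nat \<Rightarrow> 'a" and z x :: "real set \<Rightarrow> 'a"
    where c: "\<And>j. j < f \<Longrightarrow> v (c j) = 1" and z: "\<And>g. g \<in> ?C \<Longrightarrow> z g \<noteq> 0"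
    and x: "\<And>g. g \<in> ?C \<Longrightarrow> x g \<in> F" "\<And>g. g \<in> ?C \<Longrightarrow> v (x g) = v (z g) ^ e"
    and expand: "\<And>y. \<exists>a. (\<forall>j<f. \<forall>g\<in>?C. a j g \<in> F \<and> v (a j g * z g) \<le> v y)
        \<and> y = (\<Sum>j<f. \<Sum>g\<in>?C. a j g * z g * c j)"
    by (rule tame_basis[OF F_subfield tame_F(3), folded e_def]) blast
  \<comment> \<open>Units measuring how far \<open>z g\<close> is from an \<open>e\<close>-th root
    of an element of \<open>F\<close>.\<close>
  define u where "u g = z g ^ e / x g" for g
  define U where "U = c ` {..<f} \<union> u ` ?C"
  have finU: "finite U" using tame_F(3) by (simp add: U_def tamely_ramified_def)
  have x0: "x g \<noteq> 0" if "g \<in> ?C" for g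
    using x(2)[OF that] z[OF that] v_eq_0[of "x g"] by auto
  have vu: "v w = 1" if "w \<in> U" for w
    using that c x(2) x0 z by (auto simp: U_def u_def v_divide v_power simp flip: v_eq_0)
  \<comment> \<open>A common bound \<open>M \<ge> 1 / r\<close> on the units in \<open>U\<close>
    becomes a relative bound on all of K: on \<open>F\<close> it is \<open>D_F_bound\<close>, for
    \<open>z g\<close> it follows from its \<open>e\<close>-th power, and orthogonality excludes
    cancellation in the expansion.\<close>
  have bound: "v (D y) \<le> M * v y" if M: "inverse r \<le> M" and U: "\<And>w. w \<in> U \<Longrightarrow> v (D w) \<le> M" for M y
  proof -
    have M0: "M > 0" using M r_pos by (meson inverse_positive_iff_positive less_le_trans)
    have F: "v (D a) \<le> M * v a" if "a \<in> F" for a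
      using D_F_bound[OF that] mult_right_mono[OF M v_nonneg[of a]] by (simp add: field_simps)
    have Dz: "v (D (z g)) \<le> M * v (z g)" if g: "g \<in> ?C" for g
    proof -
      have "z g ^ e = u g * x g" using x0[OF g] by (simp add: u_def)
      then have "of_nat e * z g ^ (e - 1) * D (z g) = u g * D (x g) + x g * D (u g)"
        using D_power[of "z g" e] by (simp add: D_mult)
      then have "v (z g) ^ (e - 1) * v (D (z g)) = v (u g * D (x g) + x g * D (u g))"
        using v_e by (simp add: v_mult v_power flip: mult.assoc)
          (metis v_mult v_power v_e mult_1)
      also have "\<dots> \<le> M * v (x g)"
        using F[OF x(1)[OF g]] vu[of "u g"] U[of "u g"] g mult_left_mono[of "v (D (u g))" M "v (x g)"]
        by (intro v_add_bound) (auto simp: v_mult U_def mult.commute)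
      also have "\<dots> = v (z g) ^ (e - 1) * (M * v (z g))"
        using x(2)[OF g] e_pos by (simp add: power_eq_if mult.commute)
      finally show ?thesis using v_pos[OF z[OF g]] by simp
    qed
    obtain a where a: "\<forall>j<f. \<forall>g\<in>?C. a j g \<in> F \<and> v (a j g * z g) \<le> v y"
      and y: "y = (\<Sum>j<f. \<Sum>g\<in>?C. a j g * z g * c j)"
      using expand by blast
    have summand: "v (D (a j g * z g * c j)) \<le> M * v y" if jg: "j < f" "g \<in> ?C" for j g
    proof -
      have "v (a j g * z g * D (c j)) \<le> v y * M"
        unfolding v_mult[of "a j g * z g"]
        using a jg U[of "c j"] by (intro mult_mono) (auto simp: U_def)
      moreover have "v (c j * (a j g * D (z g))) \<le> M * v y" "v (c j * (z g * D (a j g))) \<le> M * v y"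
      proof -
        have ag: "v (a j g) * v (z g) \<le> v y" using a jg by (simp add: v_mult)
        have "v (a j g) * v (D (z g)) \<le> v (a j g) * (M * v (z g))"
          by (intro mult_left_mono Dz jg) simp
        also have "\<dots> = M * (v (a j g) * v (z g))" by simp
        also have "\<dots> \<le> M * v y" using M0 ag by (intro mult_left_mono) auto
        finally show "v (c j * (a j g * D (z g))) \<le> M * v y" using c[OF jg(1)] by (simp add: v_mult)
        have "v (z g) * v (D (a j g)) \<le> v (z g) * (M * v (a j g))"
          using a jg by (intro mult_left_mono F) auto
        also have "\<dots> = M * (v (a j g) * v (z g))" by simp
        also have "\<dots> \<le> M * v y" using M0 ag by (intro mult_left_mono) auto
        finally show "v (c j * (z g * D (a j g))) \<le> M * v y" using c[OF jg(1)] by (simp add: v_mult)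
      qed
      ultimately show ?thesis
        by (simp add: D_mult distrib_left v_add_bound mult.commute)
    qed
    have "D y = (\<Sum>j<f. \<Sum>g\<in>?C. D (a j g * z g * c j))"
      unfolding y D_sum ..
    also have "v \<dots> \<le> M * v y"
      using summand M0 by (intro v_sum_bound) auto
    finally show ?thesis .
  qed
  define M where "M = Max (insert (inverse r) ((\<lambda>w. v (D w)) ` U))"
  have M: "inverse r \<le> M" "\<And>w. w \<in> U \<Longrightarrow> v (D w) \<le> M"
    unfolding M_def using finU by (auto intro!: Max_ge)
  \<comment> \<open>A maximum above \<open>1 / r\<close> would be attained at a unit
    \<open>w\<close>. It would be at most \<open>v (D (poly P w))\<close> by
    \<open>D_separating_poly_bound\<close>, hence at most \<open>M * v (poly P w)\<close> by
    \<open>bound\<close>, which is smaller than \<open>M\<close>.\<close>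
  have "M = inverse r"
  proof (rule ccontr)
    assume ne: "M \<noteq> inverse r"
    have "M \<in> insert (inverse r) ((\<lambda>w. v (D w)) ` U)"
      unfolding M_def using finU by (intro Max_in) auto
    then obtain w where w: "w \<in> U" "M = v (D w)" using ne by auto
    obtain P where P: "poly_over (ring_int v F) P" "v (poly P w) < 1" "v (poly (pderiv P) w) = 1"
      using separating_poly[OF tame_F(4), of w] vu[OF w(1)] by auto
    have "M \<le> max (inverse r) (v (D (poly P w)))"
      using D_separating_poly_bound[OF P(1) _ P(3)] vu[OF w(1)] w(2) by simp
    moreover have "v (D (poly P w)) \<le> M * v (poly P w)" by (rule bound[OF M])
    ultimately have "M \<le> M * v (poly P w)" using ne M(1) by linarith
    moreover have "M > 0" using M(1) r_pos by (meson inverse_positive_iff_positive less_le_trans)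
    ultimately show False using P(2) by simp
  qed
  then show ?thesis using bound[OF M, of y] by (simp add: field_simps)
qed

end

section \<open>The Kaehler seminorm\<close>

text \<open>Formal sums are handled as elements of the pointwise function group, so that
  simplification sees an abelian group; evaluation at a symbol is unfolded only on request.\<close>

lemmas fun_apply = plus_fun_apply zero_fun_apply minus_apply uminus_apply

declare fun_apply [simp del]

lemma fadd_eq: "fadd w u = w + u"
  by (simp add: fadd_def fun_eq_iff fun_apply)

lemma fsub_eq: "fsub w u = w - u"
  by (simp add: fsub_def fun_eq_iff fun_apply)

lemma fscale_simps:
  "fscale a (w + u) = fscale a w + fscale a u"
  "fscale a (w - u) = fscale a w - fscale a u"
  "fscale (a + b) w = fscale a w + fscale b w"
  "fscale (a - b) w = fscale a w - fscale b w"
  "fscale a (fscale b w) = fscale (a * b) w"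
  "fscale 1 w = w"
  "fscale 0 w = 0"
  "fscale a 0 = 0"
  "fscale (- a) w = - fscale a w"
  by (auto simp: fscale_def fun_eq_iff fun_apply algebra_simps)

lemma fscale_sum: "fscale a (sum w I) = (\<Sum>i\<in>I. fscale a (w i))"
  by (induction I rule: infinite_finite_induct) (auto simp: fscale_simps)

lemma sum_fun_apply: "sum w I x = (\<Sum>i\<in>I. w i x)"
  by (induction I rule: infinite_finite_induct) (auto simp: fun_apply)

lemma fs_expand:
  assumes "finite {f. w f \<noteq> 0}"
  shows "w = (\<Sum>f\<in>{f. w f \<noteq> 0}. fscale (w f) (dsym f))"
proof
  fix g
  have "w f * dsym f g = (if f = g then w f else 0)" for f by (simp add: dsym_def)
  then show "w g = (\<Sum>f\<in>{f. w f \<noteq> 0}. fscale (w f) (dsym f)) g"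
    using assms by (simp add: sum_fun_apply fscale_def sum.delta)
qed

text \<open>The linear functional on differentials that sends \<open>df\<close> to
  \<open>D f\<close>. For a derivation killing the constants it vanishes on all relations and so
  descends to \<Omega>.\<close>

definition pairing :: "('a::field \<Rightarrow> 'a) \<Rightarrow> ('a \<Rightarrow> 'a) \<Rightarrow> 'a" where
  "pairing D w = (\<Sum>f\<in>{f. w f \<noteq> 0}. w f * D f)"

lemma pairing_superset:
  "finite T \<Longrightarrow> {f. w f \<noteq> 0} \<subseteq> T \<Longrightarrow> pairing D w = (\<Sum>f\<in>T. w f * D f)"
  unfolding pairing_def by (rule sum.mono_neutral_left) auto

lemma finite_support_add:
  fixes w u :: "'a \<Rightarrow> 'b::group_add"
  assumes "finite {f. w f \<noteq> 0}" "finite {f. u f \<noteq> 0}"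
  shows "finite {f. (w + u) f \<noteq> 0}"
  by (rule finite_subset[OF _ finite_UnI[OF assms]]) (auto simp: fun_apply)

lemma finite_support_diff:
  fixes w u :: "'a \<Rightarrow> 'b::group_add"
  assumes "finite {f. w f \<noteq> 0}" "finite {f. u f \<noteq> 0}"
  shows "finite {f. (w - u) f \<noteq> 0}"
  by (rule finite_subset[OF _ finite_UnI[OF assms]]) (auto simp: fun_apply)

lemma finite_support_fscale:
  assumes "finite {f. w f \<noteq> 0}"
  shows "finite {f. fscale a w f \<noteq> 0}"
  by (rule finite_subset[OF _ assms]) (auto simp: fscale_def)

lemma finite_support_dsym: "finite {f. dsym g f \<noteq> 0}"
  by (rule finite_subset[of _ "{g}"]) (auto simp: dsym_def)

lemmas finite_support = finite_support_add finite_support_diff finite_support_fscale finite_support_dsym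

lemma fs_ok_UNIV: "fs_ok UNIV UNIV w \<longleftrightarrow> finite {f. w f \<noteq> 0}"
  by (simp add: fs_ok_def)

lemma pairing_add:
  assumes "finite {f. w f \<noteq> 0}" "finite {f. u f \<noteq> 0}"
  shows "pairing D (w + u) = pairing D w + pairing D u"
proof -
  let ?T = "{f. w f \<noteq> 0} \<union> {f. u f \<noteq> 0}"
  have "finite ?T" using assms by simp
  then have "pairing D (w + u) = (\<Sum>f\<in>?T. (w + u) f * D f)"
    "pairing D w = (\<Sum>f\<in>?T. w f * D f)" "pairing D u = (\<Sum>f\<in>?T. u f * D f)"
    by (intro pairing_superset; auto simp: fun_apply)+
  then show ?thesis by (simp add: sum.distrib distrib_right fun_apply)
qed

lemma pairing_fscale:
  assumes "finite {f. w f \<noteq> 0}"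
  shows "pairing D (fscale a w) = a * pairing D w"
proof -
  have "pairing D (fscale a w) = (\<Sum>f\<in>{f. w f \<noteq> 0}. fscale a w f * D f)"
    by (rule pairing_superset[OF assms]) (auto simp: fscale_def)
  then show ?thesis by (simp add: pairing_def fscale_def sum_distrib_left mult.assoc)
qed

lemma pairing_diff:
  assumes "finite {f. w f \<noteq> 0}" "finite {f. u f \<noteq> 0}"
  shows "pairing D (w - u) = pairing D w - pairing D u"
  using pairing_add[of "w - u" u D] finite_support_diff[OF assms] assms(2) by simp

lemma pairing_dsym: "pairing D (dsym f) = D f"
proof -
  have "{g. dsym f g \<noteq> 0} = {f}" by (auto simp: dsym_def)
  then show ?thesis by (simp add: pairing_def dsym_def)
qed

lemma sum_lessThan_add:
  fixes f :: "nat \<Rightarrow> 'b::comm_monoid_add"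
  shows "sum f {..<n + m} = sum f {..<n} + (\<Sum>i<m. f (n + i))"
  by (induction m) (auto simp: add.assoc)

lemma span_over_eq:
  "span_over B S = {w. \<exists>(n::nat) b r. (\<forall>i<n. b i \<in> B \<and> r i \<in> S) \<and> w = (\<Sum>i<n. fscale (b i) (r i))}"
proof -
  have "(\<lambda>g. \<Sum>i<n. b i * r i g) = (\<Sum>i<n. fscale (b i) (r i))" for n :: nat and b :: "nat \<Rightarrow> 'a" and r
    by (simp add: fun_eq_iff sum_fun_apply fscale_def)
  then show ?thesis unfolding span_over_def by simp
qed

lemma span_over_superset: "1 \<in> B \<Longrightarrow> S \<subseteq> span_over B S"
proof
  fix x assume "1 \<in> B" "x \<in> S"
  then show "x \<in> span_over B S" unfolding span_over_eq mem_Collect_eq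
    by (intro exI[of _ 1] exI[of _ "\<lambda>_. 1"] exI[of _ "\<lambda>_. x"]) (simp add: fscale_simps)
qed

lemma span_over_zero: "0 \<in> span_over B S"
  unfolding span_over_eq by (auto intro!: exI[of _ 0])

lemma span_over_add:
  assumes "w \<in> span_over B S" "u \<in> span_over B S"
  shows "w + u \<in> span_over B S"
proof -
  obtain n :: nat and b r where w: "\<forall>i<n. b i \<in> B \<and> r i \<in> S" "w = (\<Sum>i<n. fscale (b i) (r i))"
    using assms(1) unfolding span_over_eq by auto
  obtain m :: nat and b' r' where u: "\<forall>i<m. b' i \<in> B \<and> r' i \<in> S" "u = (\<Sum>i<m. fscale (b' i) (r' i))"
    using assms(2) unfolding span_over_eq by auto
  show ?thesis
    unfolding span_over_eq
  proof (intro CollectI exI conjI)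
    show "\<forall>i<n + m. (if i < n then b i else b' (i - n)) \<in> B \<and> (if i < n then r i else r' (i - n)) \<in> S"
      using w(1) u(1) by auto
    show "w + u = (\<Sum>i<n + m. fscale (if i < n then b i else b' (i - n)) (if i < n then r i else r' (i - n)))"
      unfolding sum_lessThan_add w(2) u(2) by simp
  qed
qed

lemma span_over_fscale:
  assumes "w \<in> span_over B S" "a \<in> B" "\<And>a b. a \<in> B \<Longrightarrow> b \<in> B \<Longrightarrow> a * b \<in> B"
  shows "fscale a w \<in> span_over B S"
proof -
  obtain n :: nat and b r where w: "\<forall>i<n. b i \<in> B \<and> r i \<in> S" "w = (\<Sum>i<n. fscale (b i) (r i))"
    using assms(1) unfolding span_over_eq by auto
  show ?thesis
    unfolding span_over_eq
  proof (intro CollectI exI conjI)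
    show "\<forall>i<n. a * b i \<in> B \<and> r i \<in> S" using w(1) assms by blast
    show "fscale a w = (\<Sum>i<n. fscale (a * b i) (r i))" by (simp add: w(2) fscale_sum fscale_simps)
  qed
qed

lemma span_over_least:
  assumes "S \<subseteq> M" "0 \<in> M" "\<And>w u. w \<in> M \<Longrightarrow> u \<in> M \<Longrightarrow> w + u \<in> M"
    "\<And>a w. a \<in> B \<Longrightarrow> w \<in> M \<Longrightarrow> fscale a w \<in> M"
  shows "span_over B S \<subseteq> M"
proof
  fix w assume "w \<in> span_over B S"
  then obtain n :: nat and b r where w: "\<forall>i<n. b i \<in> B \<and> r i \<in> S" "w = (\<Sum>i<n. fscale (b i) (r i))"
    unfolding span_over_eq by auto
  have "(\<Sum>i<m. fscale (b i) (r i)) \<in> M" if "m \<le> n" for m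
    using that
  proof (induction m)
    case (Suc m)
    then show ?case unfolding sum.lessThan_Suc using w(1) assms(1) by (intro assms(3,4)) auto
  qed (simp add: assms(2))
  then show "w \<in> M" using w(2) by simp
qed

section \<open>Calculus modulo a submodule of differentials\<close>

text \<open>A set B of formal sums standing for a submodule of Kaehler differentials, and a derivation D.
  The formal sum \<open>E x y\<close> represents the difference of \<open>dy\<close> and \<open>(Dy / Dx) dx\<close>; it behaves like a
  derivation in y modulo B.\<close>
locale kahler_submodule =
  fixes A c0 :: "'a::field set" and B :: "('a \<Rightarrow> 'a) set" and D :: "'a \<Rightarrow> 'a"
  assumes A_one: "1 \<in> A" and A_minus_one: "- 1 \<in> A"
    and A_add: "a \<in> A \<Longrightarrow> b \<in> A \<Longrightarrow> a + b \<in> A"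
    and A_mult: "a \<in> A \<Longrightarrow> b \<in> A \<Longrightarrow> a * b \<in> A"
    and c0_A: "c0 \<subseteq> A" and c0_zero: "0 \<in> c0" and c0_one: "1 \<in> c0"
    and Der: "derivation_on UNIV D" and Der_c0: "c \<in> c0 \<Longrightarrow> D c = 0"
    and B_zero: "0 \<in> B" and B_add: "w \<in> B \<Longrightarrow> u \<in> B \<Longrightarrow> w + u \<in> B"
    and B_scale: "a \<in> A \<Longrightarrow> w \<in> B \<Longrightarrow> fscale a w \<in> B"
    and B_rels: "kahler_rels A c0 \<subseteq> B"
begin

lemma A_zero: "0 \<in> A"
  using A_add[OF A_one A_minus_one] by simp

lemma B_minus: "w \<in> B \<Longrightarrow> - w \<in> B"
  using B_scale[OF A_minus_one, of w] by (simp add: fscale_simps)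

lemma B_diff: "w \<in> B \<Longrightarrow> u \<in> B \<Longrightarrow> w - u \<in> B"
  using B_add[of w "- u"] B_minus by simp

lemma B_diff_cancel: "w - u \<in> B \<Longrightarrow> w \<in> B \<Longrightarrow> u \<in> B"
  using B_diff[of w "w - u"] by simp

lemma B_sum: "(\<And>i. i \<in> I \<Longrightarrow> w i \<in> B) \<Longrightarrow> sum w I \<in> B"
  by (induction I rule: infinite_finite_induct) (auto simp: B_zero B_add)

lemma B_diff_trans: "w - u \<in> B \<Longrightarrow> u \<in> B \<Longrightarrow> w \<in> B"
  using B_add[of "w - u" u] by simp

definition E :: "'a \<Rightarrow> 'a \<Rightarrow> ('a \<Rightarrow> 'a)" where
  "E x y = dsym y - fscale (D y / D x) (dsym x)"

lemma Der_add: "D (x + y) = D x + D y"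
  and Der_mult: "D (x * y) = x * D y + y * D x"
  using Der by (auto simp: derivation_on_def)

lemma E_add:
  assumes "f \<in> A" "g \<in> A"
  shows "E x (f + g) - (E x f + E x g) \<in> B"
proof -
  have "E x (f + g) - (E x f + E x g) = fsub (fsub (dsym (f + g)) (dsym f)) (dsym g)"
    by (simp add: E_def Der_add fscale_simps add_divide_distrib fsub_eq)
  moreover have "fsub (fsub (dsym (f + g)) (dsym f)) (dsym g) \<in> kahler_rels A c0"
    unfolding kahler_rels_def using assms by blast
  ultimately show ?thesis using B_rels by auto
qed

lemma E_mult:
  assumes "f \<in> A" "g \<in> A"
  shows "E x (f * g) - (fscale f (E x g) + fscale g (E x f)) \<in> B"
proof -
  have "E x (f * g) - (fscale f (E x g) + fscale g (E x f))
      = fsub (fsub (dsym (f * g)) (fscale f (dsym g))) (fscale g (dsym f))"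
    by (simp add: E_def Der_mult fscale_simps add_divide_distrib fsub_eq)
  moreover have "fsub (fsub (dsym (f * g)) (fscale f (dsym g))) (fscale g (dsym f)) \<in> kahler_rels A c0"
    unfolding kahler_rels_def using assms by blast
  ultimately show ?thesis using B_rels by auto
qed

lemma E_const:
  assumes "c \<in> c0"
  shows "E x c \<in> B"
proof -
  have "dsym c \<in> kahler_rels A c0" unfolding kahler_rels_def using assms by blast
  then show ?thesis using B_rels Der_c0[OF assms] by (auto simp: E_def fscale_simps)
qed

lemma E_add_mem: "f \<in> A \<Longrightarrow> g \<in> A \<Longrightarrow> E x f \<in> B \<Longrightarrow> E x g \<in> B \<Longrightarrow> E x (f + g) \<in> B"
  by (rule B_diff_trans[OF E_add B_add])

lemma E_mult_mem: "f \<in> A \<Longrightarrow> g \<in> A \<Longrightarrow> E x f \<in> B \<Longrightarrow> E x g \<in> B \<Longrightarrow> E x (f * g) \<in> B"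
  by (rule B_diff_trans[OF E_mult B_add[OF B_scale B_scale]])

lemma E_const_mult:
  assumes "c \<in> c0" "f \<in> A"
  shows "E x (c * f) - fscale c (E x f) \<in> B"
proof -
  have "E x (c * f) - fscale c (E x f) = (E x (c * f) - (fscale c (E x f) + fscale f (E x c))) + fscale f (E x c)"
    by simp
  also have "\<dots> \<in> B"
    using assms c0_A by (intro B_add E_mult B_scale E_const) auto
  finally show ?thesis .
qed

lemma E_inverse_mem:
  assumes "f \<in> A" "inverse f \<in> A" "E x f \<in> B"
  shows "E x (inverse f) \<in> B"
proof (cases "f = 0")
  case True
  then show ?thesis using assms by simp
next
  case False
  have "E x (f * inverse f) - (fscale f (E x (inverse f)) + fscale (inverse f) (E x f)) \<in> B"
    by (rule E_mult[OF assms(1,2)])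
  moreover have "E x (f * inverse f) \<in> B"
    using False E_const[OF c0_one] by simp
  ultimately have "E x (f * inverse f) - (E x (f * inverse f) - (fscale f (E x (inverse f)) + fscale (inverse f) (E x f)))
      - fscale (inverse f) (E x f) \<in> B"
    using B_diff B_scale[OF assms(2,3)] by blast
  then have "fscale f (E x (inverse f)) \<in> B" by simp
  from B_scale[OF assms(2) this] show ?thesis using False by (simp add: fscale_simps)
qed

lemma poly_A: "poly_over A P \<Longrightarrow> y \<in> A \<Longrightarrow> poly P y \<in> A"
  by (induction P) (auto simp: poly_over_pCons_iff A_zero A_add A_mult)

text \<open>The chain rule modulo \<open>B\<close>; the coefficients drop out because their own
  \<open>E x\<close> lies in \<open>B\<close>.\<close>

lemma E_poly:
  assumes "poly_over A P" "y \<in> A" "\<And>i. E x (coeff P i) \<in> B"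
  shows "E x (poly P y) - fscale (poly (pderiv P) y) (E x y) \<in> B"
  using assms(1,3)
proof (induction P)
  case 0
  then show ?case using E_const[OF c0_zero] by (simp add: fscale_simps)
next
  case (pCons a P)
  have a: "a \<in> A" "E x a \<in> B" and P: "poly_over A P"
    using pCons.prems(1) pCons.prems(2)[of 0] by (auto simp: poly_over_pCons_iff)
  have IH: "E x (poly P y) - fscale (poly (pderiv P) y) (E x y) \<in> B"
    using pCons.prems(2)[of "Suc _"] by (intro pCons.IH P) simp
  have Py: "poly P y \<in> A" by (rule poly_A[OF P assms(2)])
  have "E x (a + y * poly P y) - fscale (poly P y + y * poly (pderiv P) y) (E x y)
    = (E x (a + y * poly P y) - (E x a + E x (y * poly P y))) + E x a
      + (E x (y * poly P y) - (fscale y (E x (poly P y)) + fscale (poly P y) (E x y)))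
      + fscale y (E x (poly P y) - fscale (poly (pderiv P) y) (E x y))"
    by (simp add: fscale_simps)
  also have "\<dots> \<in> B"
    using a Py assms(2) IH by (intro B_add E_add E_mult B_scale A_mult)
  finally show ?case by (simp add: pderiv_pCons)
qed

text \<open>Replacing each \<open>df\<close> in \<open>w\<close> by \<open>(D f / D x) dx\<close>
  collects the coefficients into \<open>pairing D w\<close>, so modulo \<open>B\<close> a form is
  known by a single number.\<close>

lemma E_pairing:
  assumes "fs_ok A A w" "\<And>f. w f \<noteq> 0 \<Longrightarrow> E x f \<in> B"
  shows "w - fscale (pairing D w / D x) (dsym x) \<in> B"
proof -
  let ?S = "{f. w f \<noteq> 0}"
  have fin: "finite ?S" using assms(1) by (simp add: fs_ok_def)
  have "(\<Sum>f\<in>?S. fscale (w f) (E x f)) = (\<Sum>f\<in>?S. fscale (w f) (dsym f)) - (\<Sum>f\<in>?S. fscale (w f * D f / D x) (dsym x))"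
    by (simp add: E_def fscale_simps sum_subtractf)
  also have "(\<Sum>f\<in>?S. fscale (w f) (dsym f)) = w" by (rule fs_expand[OF fin, symmetric])
  also have "(\<Sum>f\<in>?S. fscale (w f * D f / D x) (dsym x)) = fscale (pairing D w / D x) (dsym x)"
    unfolding pairing_def
    by (simp add: fun_eq_iff sum_fun_apply fscale_def sum_distrib_right sum_divide_distrib)
  finally have "w - fscale (pairing D w / D x) (dsym x) = (\<Sum>f\<in>?S. fscale (w f) (E x f))" by simp
  also have "\<dots> \<in> B"
    using assms by (intro B_sum B_scale) (auto simp: fs_ok_def)
  finally show ?thesis .
qed

end

lemma kahler_rels_pairing:
  assumes D: "derivation_on UNIV D" "\<And>c. c \<in> c0 \<Longrightarrow> D c = 0" and w: "w \<in> kahler_rels A c0"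
  shows "finite {f. w f \<noteq> 0} \<and> pairing D w = 0"
  using w unfolding kahler_rels_def fsub_eq
  by (elim UnE CollectE exE conjE)
     (simp_all only: finite_support pairing_diff pairing_fscale pairing_dsym,
      simp_all add: D(2) derivation_on_add[OF D(1)] derivation_on_mult[OF D(1)])

lemma span_rels_pairing:
  assumes "derivation_on UNIV D" "\<And>c. c \<in> c0 \<Longrightarrow> D c = 0" and "w \<in> span_over B (kahler_rels A c0)"
  shows "finite {f. w f \<noteq> 0} \<and> pairing D w = 0"
proof -
  have "span_over B (kahler_rels A c0) \<subseteq> {w. finite {f. w f \<noteq> 0} \<and> pairing D w = 0}"
  proof (rule span_over_least)
    show "kahler_rels A c0 \<subseteq> {w. finite {f. w f \<noteq> 0} \<and> pairing D w = 0}"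
      using kahler_rels_pairing[OF assms(1,2)] by blast
  qed (auto simp: pairing_add pairing_fscale finite_support_fscale pairing_def[of _ 0]
        zero_fun_apply intro!: finite_support_add)
  then show ?thesis using assms(3) by blast
qed

section \<open>Maximality of the seminorm given by D\<close>

context tame_element
begin

text \<open>Forms of seminorm zero play the part of \<open>B\<close>. Finite support is built into
  the set because subadditivity, scaling and invariance of \<open>p\<close> are required only
  there.\<close>

lemma adm_submodule:
  assumes p: "kahler_adm v k p"
  shows "kahler_submodule UNIV k {w. finite {f. w f \<noteq> 0} \<and> p w = 0} D"
proof -
  have p0: "0 \<le> p w" for w using p by (simp add: kahler_adm_def)
  have padd: "p (w + u) \<le> max (p w) (p u)" if "finite {f. w f \<noteq> 0}" "finite {f. u f \<noteq> 0}" for w u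
    using p that by (simp add: kahler_adm_def fs_ok_UNIV fadd_eq)
  have pscale: "p (fscale a w) = v a * p w" if "finite {f. w f \<noteq> 0}" for a w
    using p that by (simp add: kahler_adm_def fs_ok_UNIV)
  have pzero: "p 0 = 0" using pscale[of 0 0] by (simp add: fscale_simps fun_apply)
  have prel: "p w = 0" if "w \<in> kahler_rels UNIV k" for w
  proof -
    have "finite {f. w f \<noteq> 0}"
      using kahler_rels_pairing[OF D_derivation D_k that] by blast
    moreover have "fsub w 0 \<in> span_over UNIV (kahler_rels UNIV k)"
      using that span_over_superset[of UNIV "kahler_rels UNIV k"] by (auto simp: fsub_eq)
    moreover have "finite {f. (0 :: 'a \<Rightarrow> 'a) f \<noteq> 0}" by (simp add: zero_fun_apply)
    ultimately have "p w = p 0"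
      using p unfolding kahler_adm_def fs_ok_UNIV by blast
    then show ?thesis using pzero by simp
  qed
  show ?thesis
  proof (rule kahler_submodule.intro)
    let ?B = "{w. finite {f. w f \<noteq> 0} \<and> p w = 0}"
    show "w + u \<in> ?B" if "w \<in> ?B" "u \<in> ?B" for w u
      using that padd[of w u] p0[of "w + u"] finite_support_add[of w u] by auto
    show "fscale a w \<in> ?B" if "w \<in> ?B" for a w
      using that pscale finite_support_fscale by auto
    show "kahler_rels UNIV k \<subseteq> ?B"
      using prel kahler_rels_pairing[OF D_derivation D_k] by auto
  qed (auto simp: k_0 k_1 k_minus D_derivation D_k pzero zero_fun_apply)
qed

lemma adm_le:
  assumes p: "kahler_adm v k p" and w: "finite {f. w f \<noteq> 0}"
  shows "p w \<le> r * v (pairing D w)"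
proof -
  let ?B = "{w. finite {f. w f \<noteq> 0} \<and> p w = 0}"
  interpret kahler_submodule UNIV k ?B D by (rule adm_submodule[OF p])
  have p0: "0 \<le> p w" for w using p by (simp add: kahler_adm_def)
  have padd: "p (w + u) \<le> max (p w) (p u)" if "finite {f. w f \<noteq> 0}" "finite {f. u f \<noteq> 0}" for w u
    using p that by (simp add: kahler_adm_def fs_ok_UNIV fadd_eq)
  have pscale: "p (fscale a w) = v a * p w" if "finite {f. w f \<noteq> 0}" for a w
    using p that by (simp add: kahler_adm_def fs_ok_UNIV)
  have pd: "p (dsym f) \<le> v f" for f using p by (simp add: kahler_adm_def)
  have pB: "p w \<le> p u" if "w - u \<in> ?B" "finite {f. u f \<noteq> 0}" for w u
    using that padd[of "w - u" u] p0[of u] by simp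
  have finE: "finite {f. E x y f \<noteq> 0}" for x y
    unfolding E_def by (intro finite_support)
  \<comment> \<open>Subtracting a constant from \<open>t\<close> does not change \<open>dt\<close>,
    so \<open>p (dsym t)\<close> is at most every \<open>v (t - a)\<close> and hence at most the
    infimum.\<close>
  have pt: "p (dsym t) \<le> r"
  proof (rule ccontr)
    assume "\<not> p (dsym t) \<le> r"
    then obtain a where a: "a \<in> k" "v (t - a) < p (dsym t)" using r_less by force
    have "dsym t - dsym (t - a) = (dsym ((t - a) + a) - dsym (t - a) - dsym a) + dsym a" by simp
    also have "\<dots> \<in> ?B"
    proof (rule B_add)
      show "dsym a \<in> ?B" using E_const[OF a(1), of t] D_k[OF a(1)] by (simp only: E_def) (simp add: fscale_simps)
      have "dsym ((t - a) + a) - dsym (t - a) - dsym a = E t (t - a + a) - (E t (t - a) + E t a)"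
        by (simp add: E_def D_diff D_k[OF a(1)] fscale_simps)
      then show "dsym ((t - a) + a) - dsym (t - a) - dsym a \<in> ?B"
        using E_add[of "t - a" a t] by (simp only:) simp
    qed
    finally have "p (dsym t) \<le> p (dsym (t - a))" by (intro pB finite_support)
    then show False using a(2) pd[of "t - a"] by simp
  qed
  have Epoly: "E t (poly q t) \<in> ?B" if "poly_over k q" for q
    using that
  proof (induction q)
    case 0
    then show ?case using E_const[OF k_0] by simp
  next
    case (pCons a q)
    have "E t t = 0" by (simp add: E_def D_t fscale_simps)
    then have "E t t \<in> ?B" using B_zero by metis
    then have "E t (t * poly q t) \<in> ?B" using pCons by (intro E_mult_mem) (auto simp: poly_over_pCons_iff)
    then have "E t (a + t * poly q t) \<in> ?B"
      using pCons E_const by (intro E_add_mem) (auto simp: poly_over_pCons_iff)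
    then show ?case by simp
  qed
  have Ekt: "E t x \<in> ?B" if x: "x \<in> kt" for x
  proof -
    obtain q s where qs: "poly_over k q" "poly_over k s" "x = poly q t / poly s t" using kt_E[OF x] by metis
    have "E t (poly q t * inverse (poly s t)) \<in> ?B"
      by (intro E_mult_mem E_inverse_mem Epoly qs UNIV_I)
    then show ?thesis by (simp add: qs(3) divide_inverse)
  qed
  \<comment> \<open>For \<open>y\<close> in \<open>kt\<close> close to \<open>x\<close>, both parts
    of \<open>E t (x - y)\<close> are small: \<open>p\<close> contracts \<open>d\<close>, and the
    component along \<open>dt\<close> is at most \<open>v (x - y) / r * r\<close> by
    \<open>D_bound\<close>.\<close>
  have EF: "E t x \<in> ?B" if x: "x \<in> F" for x
  proof -
    have "p (E t x) \<le> \<epsilon>" if \<epsilon>: "\<epsilon> > 0" for \<epsilon>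
    proof -
      obtain y where y: "y \<in> kt" "v (x - y) < \<epsilon>" using x \<epsilon> unfolding F_closure v_closure_def by blast
      let ?z = "x - y"
      have "p (E t x) \<le> p (E t ?z + E t y)"
        using E_add[of ?z y t] by (intro pB finite_support_add finE) simp
      also have "\<dots> \<le> max (p (E t ?z)) (p (E t y))" by (intro padd finE)
      also have "\<dots> \<le> p (E t ?z)" using Ekt[OF y(1)] p0 by simp
      also have "\<dots> = p (dsym ?z + fscale (- D ?z) (dsym t))"
        by (simp add: E_def D_t fscale_simps)
      also have "\<dots> \<le> max (p (dsym ?z)) (p (fscale (- D ?z) (dsym t)))"
        by (intro padd finite_support)
      also have "p (fscale (- D ?z) (dsym t)) \<le> v ?z"
      proof -
        have "v (D ?z) * p (dsym t) \<le> v ?z / r * r"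
          by (intro mult_mono D_bound pt p0) (use r_pos in auto)
        then show ?thesis using r_pos pscale[OF finite_support_dsym, of "- D ?z" t] by simp
      qed
      finally show ?thesis using pd[of ?z] y(2) by linarith
    qed
    then have "p (E t x) \<le> 0" using field_le_epsilon[of "p (E t x)" 0] by simp
    then show ?thesis using finE p0[of "E t x"] by auto
  qed
  \<comment> \<open>Here \<open>P'(y)\<close> may be inverted whatever its value, as
    \<open>p\<close> is a seminorm over the field K; the integral analogue has to avoid this
    division.\<close>
  have E: "E t y \<in> ?B" for y
  proof -
    obtain P a b where P: "poly_over F P" "poly P y = 0" "a * P + b * pderiv P = 1"
      using tame_F(2) unfolding separable_over_def separable_elem_def by metis
    have nz: "poly (pderiv P) y \<noteq> 0"
      using arg_cong[OF P(3), of "\<lambda>f. poly f y"] P(2) by auto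
    have "E t (poly P y) - fscale (poly (pderiv P) y) (E t y) \<in> ?B"
      by (rule E_poly) (use P EF in \<open>auto simp: poly_over_def\<close>)
    then have "fscale (poly (pderiv P) y) (E t y) \<in> ?B"
      unfolding P(2) by (rule B_diff_cancel[OF _ E_const[OF k_0]])
    then have "fscale (inverse (poly (pderiv P) y)) (fscale (poly (pderiv P) y) (E t y)) \<in> ?B"
      by (rule B_scale[OF UNIV_I])
    then show ?thesis using nz by (simp add: fscale_simps)
  qed
  have "w - fscale (pairing D w / D t) (dsym t) \<in> ?B"
    by (rule E_pairing) (use w E in \<open>auto simp: fs_ok_UNIV\<close>)
  then have "p w \<le> p (fscale (pairing D w) (dsym t))"
    unfolding D_t by (intro pB finite_support) simp
  also have "\<dots> = v (pairing D w) * p (dsym t)" by (intro pscale finite_support)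
  also have "\<dots> \<le> v (pairing D w) * r" using pt by (intro mult_left_mono) auto
  finally show ?thesis by (simp add: mult.commute)
qed

lemma pairing_adm: "kahler_adm v k (\<lambda>w. r * v (pairing D w))"
  unfolding kahler_adm_def fs_ok_UNIV
proof (intro conjI allI impI)
  fix w u :: "'a \<Rightarrow> 'a" and a f
  show "0 \<le> r * v (pairing D w)" using r_pos by simp
  show "r * v (pairing D (dsym f)) \<le> v f"
    using D_bound[of f] r_pos by (simp add: pairing_dsym field_simps)
  {
    assume "finite {f. w f \<noteq> 0}"
    then show "r * v (pairing D (fscale a w)) = v a * (r * v (pairing D w))"
      by (simp add: pairing_fscale v_mult)
  }
  {
    assume "finite {f. w f \<noteq> 0} \<and> finite {f. u f \<noteq> 0}"
    then show "r * v (pairing D (fadd w u)) \<le> max (r * v (pairing D w)) (r * v (pairing D u))"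
      using r_pos mult_left_mono[OF v_add_le[of "pairing D w" "pairing D u"], of r]
      by (simp add: fadd_eq pairing_add max_mult_distrib_left)
  }
  {
    assume "finite {f. w f \<noteq> 0} \<and> finite {f. u f \<noteq> 0} \<and> fsub w u \<in> span_over UNIV (kahler_rels UNIV k)"
    then show "r * v (pairing D w) = r * v (pairing D u)"
      using span_rels_pairing[OF D_derivation D_k, where w = "w - u"] by (auto simp: fsub_eq pairing_diff)
  }
qed

lemma kahler_sn_eq:
  assumes "finite {f. w f \<noteq> 0}"
  shows "kahler_sn v k w = r * v (pairing D w)"
  unfolding kahler_sn_def
proof (rule cSup_eq_maximum)
  show "r * v (pairing D w) \<in> (\<lambda>p. p w) ` {p. kahler_adm v k p}"
    using pairing_adm by force
qed (use adm_le[OF _ assms] in auto)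

end

section \<open>Integral differentials\<close>

lemma fs_ok_ring_add:
  assumes "fs_ok A A w" "fs_ok A A u" "\<And>a b. a \<in> A \<Longrightarrow> b \<in> A \<Longrightarrow> a + b \<in> A"
  shows "fs_ok A A (w + u)"
proof -
  have "(w + u) f \<noteq> 0 \<Longrightarrow> w f \<noteq> 0 \<or> u f \<noteq> 0" for f by (auto simp: fun_apply)
  moreover have "(w + u) f \<in> A" for f using assms by (simp add: fs_ok_def fun_apply)
  ultimately show ?thesis
    using assms(1,2) finite_support_add[of w u] unfolding fs_ok_def by blast
qed

lemma fs_ok_fscale:
  assumes "fs_ok A A w" "a \<in> A" "\<And>a b. a \<in> A \<Longrightarrow> b \<in> A \<Longrightarrow> a * b \<in> A"
  shows "fs_ok A A (fscale a w)"
  using assms finite_support_fscale[of w a] unfolding fs_ok_def by (auto simp: fscale_def)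

lemma fs_ok_dsym: "f \<in> A \<Longrightarrow> 0 \<in> A \<Longrightarrow> 1 \<in> A \<Longrightarrow> fs_ok A A (dsym f)"
  using finite_support_dsym[of f] unfolding fs_ok_def by (auto simp: dsym_def split: if_splits)

context nonarch_field
begin

abbreviation K0 where "K0 \<equiv> ring_int v (UNIV :: 'a set)"

lemma K0_iff: "y \<in> K0 \<longleftrightarrow> v y \<le> 1"
  by (simp add: ring_int_def)

lemma int_add: "fs_ok K0 K0 w \<Longrightarrow> fs_ok K0 K0 u \<Longrightarrow> fs_ok K0 K0 (w + u)"
  by (rule fs_ok_ring_add) (auto simp: K0_iff v_add_bound)

lemma int_fscale: "fs_ok K0 K0 w \<Longrightarrow> v a \<le> 1 \<Longrightarrow> fs_ok K0 K0 (fscale a w)"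
  by (rule fs_ok_fscale) (auto simp: K0_iff v_mult_le_1)

lemma int_dsym: "v f \<le> 1 \<Longrightarrow> fs_ok K0 K0 (dsym f)"
  by (rule fs_ok_dsym) (auto simp: K0_iff)

lemma int_diff: "fs_ok K0 K0 w \<Longrightarrow> fs_ok K0 K0 u \<Longrightarrow> fs_ok K0 K0 (w - u)"
  using int_add[of w "fscale (- 1) u"] int_fscale[of u "- 1"] by (simp add: fscale_simps)

lemma int_zero: "fs_ok K0 K0 0"
  by (simp add: fs_ok_def zero_fun_apply K0_iff)

lemma int_finite: "fs_ok K0 K0 w \<Longrightarrow> finite {f. w f \<noteq> 0}"
  by (simp add: fs_ok_def)

end

section \<open>Integral parameters and the module M\<close>

context tame_element
begin

text \<open>Affine coordinates in the valuation ring. Their differentials are the generators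
  \<open>dt / c\<close> of the module in (ii), and \<open>v (D p) = 1 / v c\<close> measures their
  fineness.\<close>

definition param :: "'a \<Rightarrow> bool" where
  "param p \<longleftrightarrow> (\<exists>a\<in>k. \<exists>c\<in>k. c \<noteq> 0 \<and> p = (t - a) / c \<and> v p \<le> 1)"

lemma D_affine:
  assumes "c \<in> k"
  shows "a \<in> k \<Longrightarrow> D ((t - a) / c) = 1 / c"
  using D_k_mult[OF k_inverse[OF assms], of "t - a"] by (simp add: D_diff D_t D_k divide_inverse mult.commute)

lemma param_D:
  assumes "param p"
  shows "D p \<in> k" "D p \<noteq> 0" "v (D p) \<le> inverse r" "v p \<le> 1"
proof -
  obtain a c where ac: "a \<in> k" "c \<in> k" "c \<noteq> 0" "p = (t - a) / c" "v p \<le> 1"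
    using assms unfolding param_def by blast
  have Dp: "D p = 1 / c" using D_affine ac by simp
  show "D p \<in> k" "D p \<noteq> 0" unfolding Dp using ac k_1 k_divide by auto
  show "v (D p) \<le> inverse r"
    using D_bound[of p] ac(5) r_pos by (smt (verit) divide_right_mono inverse_eq_divide)
qed (use assms param_def in blast)

lemma param_exists_finer:
  assumes "v x < inverse r"
  obtains p where "param p" "v x \<le> v (D p)"
proof -
  \<comment> \<open>The value of \<open>c\<close> exceeds \<open>r\<close>, so that some
    \<open>t - a\<close> is smaller than \<open>c\<close>, and stays below \<open>1 / v x\<close>,
    so that \<open>1 / c\<close> dominates \<open>x\<close>.\<close>
  obtain c where c: "c \<in> k" "c \<noteq> 0" "r < v c" "x \<noteq> 0 \<Longrightarrow> v c < inverse (v x)"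
  proof (cases "x = 0")
    case True
    then show ?thesis using val_group_k_dense[of r "r + 1"] r_pos that by (metis less_add_one less_imp_le)
  next
    case False
    have "r < inverse (v x)"
      using assms False r_pos v_pos[OF False] by (simp add: field_simps)
    then show ?thesis using val_group_k_dense[of r "inverse (v x)"] r_pos that by (metis less_imp_le)
  qed
  obtain a where a: "a \<in> k" "v (t - a) < v c" using r_less[OF c(3)] by blast
  have vc: "v c > 0" using c v_pos by blast
  have "param ((t - a) / c)" unfolding param_def using a c vc by (auto simp: v_divide)
  moreover have "v x \<le> v (D ((t - a) / c))"
    using c(4) vc unfolding D_affine[OF c(1) a(1)]
    by (cases "x = 0") (auto simp: v_divide field_simps v_pos)
  ultimately show ?thesis using that by blast
qed

text \<open>The limit along parameters whose differentials approximate a generator.\<close>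
definition fine :: "'a filter" where
  "fine = (INF p\<in>Collect param. principal {q. param q \<and> v (D p) \<le> v (D q)})"

text \<open>Parameters are totally preordered by \<open>v (D p)\<close>, so the sets defining
  \<open>fine\<close> are directed and one parameter serves as threshold.\<close>

lemma eventually_fine: "eventually Q fine \<longleftrightarrow> (\<exists>p. param p \<and> (\<forall>q. param q \<and> v (D p) \<le> v (D q) \<longrightarrow> Q q))"
proof -
  have "v 0 < inverse r" using r_pos by simp
  then obtain p where "param p" using param_exists_finer by blast
  then have ne: "Collect param \<noteq> {}" by blast
  have "eventually Q fine \<longleftrightarrow> (\<exists>p\<in>Collect param. eventually Q (principal {q. param q \<and> v (D p) \<le> v (D q)}))"
    unfolding fine_def
  proof (rule eventually_INF_base[OF ne])
    fix a b assume "a \<in> Collect param" "b \<in> Collect param"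
    then show "\<exists>x\<in>Collect param. principal {q. param q \<and> v (D x) \<le> v (D q)}
        \<le> inf (principal {q. param q \<and> v (D a) \<le> v (D q)}) (principal {q. param q \<and> v (D b) \<le> v (D q)})"
      by (intro bexI[of _ "if v (D a) \<le> v (D b) then b else a"]) auto
  qed
  then show ?thesis by (auto simp: eventually_principal)
qed

lemma eventually_fine_param: "eventually param fine"
  and eventually_fine_ex: "eventually Q fine \<Longrightarrow> \<exists>p. param p \<and> Q p"
proof -
  have "v 0 < inverse r" using r_pos by simp
  then show "eventually param fine" unfolding eventually_fine using param_exists_finer by metis
qed (auto simp: eventually_fine)

text \<open>The coefficients x for which \<open>x dt\<close> lies in the module of (ii). It is the
  ball around 0 of radius \<open>1 / r\<close>, closed if some parameter attains
  \<open>v (D p) = 1 / r\<close> and open otherwise; the lemmas below treat both cases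
  alike.\<close>

definition M :: "'a set" where
  "M = {x. eventually (\<lambda>p. v x \<le> v (D p)) fine}"

lemma M_iff: "x \<in> M \<longleftrightarrow> (\<exists>p. param p \<and> v x \<le> v (D p))"
  unfolding M_def eventually_fine by (auto intro: order_trans)

lemma M_small: "v x < inverse r \<Longrightarrow> x \<in> M"
  using param_exists_finer M_iff by metis

lemma M_zero: "0 \<in> M"
  using r_pos by (intro M_small) simp

lemma M_mono: "x \<in> M \<Longrightarrow> v y \<le> v x \<Longrightarrow> y \<in> M"
  unfolding M_iff by (meson order_trans)

lemma M_add:
  assumes "x \<in> M" "y \<in> M"
  shows "x + y \<in> M"
proof -
  have "eventually (\<lambda>p. v (x + y) \<le> v (D p)) fine"
    using assms[unfolded M_def mem_Collect_eq] by eventually_elim (rule v_add_bound)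
  then show ?thesis by (simp add: M_def)
qed

lemma M_mult: "v a \<le> 1 \<Longrightarrow> x \<in> M \<Longrightarrow> a * x \<in> M"
  by (erule M_mono) (use mult_right_mono[of "v a" 1 "v x"] in \<open>simp add: v_mult\<close>)

lemma M_diff: "x \<in> M \<Longrightarrow> y \<in> M \<Longrightarrow> x - y \<in> M"
  using M_add[of x "- y"] M_mono[of y "- y"] by simp

lemma M_sum: "(\<And>i. i \<in> I \<Longrightarrow> f i \<in> M) \<Longrightarrow> sum f I \<in> M"
  by (induction I rule: infinite_finite_induct) (auto simp: M_zero M_add)

lemma M_poly:
  assumes "v y \<le> 1" "\<And>i. coeff P i \<in> M"
  shows "poly P y \<in> M"
  using assms(2)
proof (induction P)
  case (pCons a P)
  have "a \<in> M" using pCons.prems[of 0] by simp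
  moreover have "poly P y \<in> M" using pCons.prems[of "Suc _"] by (intro pCons.IH) simp
  ultimately show ?case using assms(1) by (simp add: M_add M_mult)
qed (simp add: M_zero)

text \<open>The strict inequality places \<open>D y\<close> in the open ball, which lies in
  \<open>M\<close> in either case.\<close>

lemma D_small_M: "v y < 1 \<Longrightarrow> D y \<in> M"
  using D_bound[of y] r_pos by (intro M_small) (smt (verit) divide_strict_right_mono inverse_eq_divide)

end

section \<open>Elements whose differential is controlled modulo a submodule\<close>

locale integral_submodule =
  tame_element v k t +
  kahler_submodule "ring_int v UNIV" "ring_int v k" B "tame_element.D v k t"
  for v :: "'a::field \<Rightarrow> real" and k t and B :: "('a \<Rightarrow> 'a) set"
begin

lemma scale_le: "v a \<le> 1 \<Longrightarrow> w \<in> B \<Longrightarrow> fscale a w \<in> B"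
  by (simp add: B_scale K0_iff)

text \<open>A substitute for division over the valuation ring, where a factor cannot be removed but
  may be exchanged for a smaller one.\<close>

lemma scale_cancel: "fscale b w \<in> B \<Longrightarrow> v a \<le> v b \<Longrightarrow> fscale a w \<in> B"
proof (cases "b = 0")
  case False
  assume w: "fscale b w \<in> B" and "v a \<le> v b"
  then have "v (a / b) \<le> 1" using v_pos[OF False] by (simp add: v_divide)
  from scale_le[OF this w] show ?thesis using False by (simp add: fscale_simps)
qed (use v_nonneg[of a] in simp)

lemma E_self: "D x \<noteq> 0 \<Longrightarrow> E x x = 0"
  by (simp add: E_def fscale_simps)

lemma E_param:
  assumes "param p" "param q" "v (D p) \<le> v (D q)"
  shows "E q p \<in> B"
proof -
  obtain a c where p: "a \<in> k" "c \<in> k" "c \<noteq> 0" "p = (t - a) / c"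
    using assms(1) unfolding param_def by blast
  obtain b d where q: "b \<in> k" "d \<in> k" "d \<noteq> 0" "q = (t - b) / d"
    using assms(2) unfolding param_def by blast
  \<comment> \<open>\<open>p\<close> is an affine function of \<open>q\<close> over
    \<open>k\<close>. Comparing \<open>D p\<close> with \<open>D q\<close> makes the slope
    \<open>l\<close> integral, and then the shift \<open>s\<close> is integral too.\<close>
  define l where "l = d / c"
  define s where "s = (b - a) / c"
  have "v (1 / c) \<le> v (1 / d)" using assms(3) D_affine p q by simp
  then have vl: "v l \<le> 1"
    using v_pos[OF p(3)] v_pos[OF q(3)] by (simp add: l_def v_divide field_simps)
  have eq: "p = l * q + s"
    using p(3) q(3) by (simp add: p(4) q(4) l_def s_def field_simps)
  have vq: "v q \<le> 1" and vp: "v p \<le> 1" using param_D assms by auto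
  have vlq: "v (l * q) \<le> 1" using vl vq by (rule v_mult_le_1)
  have vs: "v s \<le> 1" using eq v_diff_bound[OF vp vlq] by simp
  have l: "l \<in> ring_int v k" and s: "s \<in> ring_int v k"
    using vl vs p q by (auto simp: ring_int_def l_def s_def k_divide k_diff)
  have "E q (l * q) - fscale l (E q q) \<in> B" by (rule E_const_mult[OF l]) (simp add: K0_iff vq)
  then have "E q (l * q) \<in> B" using E_self[of q] param_D[OF assms(2)] by (simp add: fscale_simps)
  then show ?thesis unfolding eq using vlq vs by (intro E_add_mem E_const[OF s]) (simp_all add: K0_iff)
qed

text \<open>Passing from \<open>dp\<close> to \<open>(D p / D q) dq\<close> costs a multiple of
  \<open>E q p\<close> by the integral factor \<open>D y / D p\<close>, so the relation for
  \<open>y\<close> persists for finer parameters.\<close>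

lemma E_change:
  assumes "param p" "param q" "v (D p) \<le> v (D q)" "v (D y) \<le> v (D p)" "E p y \<in> B"
  shows "E q y \<in> B"
proof -
  have "E q y = E p y + fscale (D y / D p) (E q p)"
    using param_D[OF assms(1)] by (simp add: E_def fscale_simps)
  moreover have "v (D y / D p) \<le> 1"
    using assms(4) v_pos[of "D p"] param_D[OF assms(1)] by (simp add: v_divide)
  ultimately show ?thesis using assms by (simp add: B_add scale_le E_param)
qed

text \<open>The condition \<open>D y \<in> M\<close> makes \<open>D y / D p\<close> integral for
  fine \<open>p\<close>, so that \<open>E p y\<close> is a form over the valuation ring. For
  \<open>B\<close> equal to \<eta> \<Omega>, \<open>G\<close> will turn out to be the whole
  valuation ring.\<close>

definition G :: "'a set" where
  "G = {y. v y \<le> 1 \<and> D y \<in> M \<and> eventually (\<lambda>p. E p y \<in> B) fine}"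

lemma GI:
  assumes "v y \<le> 1" "param p" "v (D y) \<le> v (D p)" "E p y \<in> B"
  shows "y \<in> G"
  using assms E_change unfolding G_def M_iff eventually_fine by blast

lemma GD: "y \<in> G \<Longrightarrow> v y \<le> 1" "y \<in> G \<Longrightarrow> D y \<in> M" "y \<in> G \<Longrightarrow> eventually (\<lambda>p. E p y \<in> B) fine"
  by (simp_all add: G_def)

lemma G_add:
  assumes "x \<in> G" "y \<in> G"
  shows "x + y \<in> G"
proof -
  have "eventually (\<lambda>p. E p (x + y) \<in> B) fine"
    using GD(3)[OF assms(1)] GD(3)[OF assms(2)]
    by eventually_elim (rule E_add_mem, use GD(1) assms in \<open>simp_all add: K0_iff\<close>)
  then show ?thesis using assms by (simp add: G_def v_add_bound D_add M_add)
qed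

lemma G_mult:
  assumes "x \<in> G" "y \<in> G"
  shows "x * y \<in> G"
proof -
  have "eventually (\<lambda>p. E p (x * y) \<in> B) fine"
    using GD(3)[OF assms(1)] GD(3)[OF assms(2)]
    by eventually_elim (rule E_mult_mem, use GD(1) assms in \<open>simp_all add: K0_iff\<close>)
  then show ?thesis using assms by (simp add: G_def v_mult_le_1 D_mult M_add M_mult)
qed

lemma G_const: "c \<in> k \<Longrightarrow> v c \<le> 1 \<Longrightarrow> c \<in> G"
  unfolding G_def using E_const by (auto simp: D_k M_zero ring_int_def)

lemma G_sum: "(\<And>i. i \<in> I \<Longrightarrow> f i \<in> G) \<Longrightarrow> sum f I \<in> G"
  by (induction I rule: infinite_finite_induct) (auto simp: G_add G_const k_0)

lemma G_power: "x \<in> G \<Longrightarrow> x ^ n \<in> G"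
  by (induction n) (auto simp: G_mult G_const k_1)

lemma G_inverse:
  assumes "x \<in> G" "v x = 1"
  shows "inverse x \<in> G"
proof -
  have x0: "x \<noteq> 0" and vi: "v (inverse x) = 1" using assms(2) by (auto simp: v_inverse)
  have "D (x * inverse x) = 0" using x0 D_1 by simp
  then have "x * D (inverse x) = - (inverse x * D x)" by (simp add: D_mult add_eq_0_iff2)
  then have "v (D (inverse x)) = v (D x)"
    using arg_cong[of _ _ v] assms(2) vi by (metis v_mult v_minus mult_1)
  then have "D (inverse x) \<in> M" using GD(2)[OF assms(1)] M_mono by simp
  moreover have "eventually (\<lambda>p. E p (inverse x) \<in> B) fine"
    using GD(3)[OF assms(1)]
    by eventually_elim (rule E_inverse_mem, use assms vi in \<open>simp_all add: K0_iff\<close>)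
  ultimately show ?thesis using vi by (simp add: G_def)
qed

lemma G_param: "param p \<Longrightarrow> p \<in> G"
  using GI[of p p] param_D[of p] E_self[of p] B_zero by simp

lemma G_linear:
  assumes "b \<in> k" "l \<in> k" "v (l * (t - b)) \<le> 1"
  shows "l * (t - b) \<in> G"
proof (cases "l = 0")
  case False
  have "param (l * (t - b))"
    unfolding param_def using assms False
    by (intro bexI[of _ b] bexI[of _ "inverse l"]) (auto simp: k_inverse divide_inverse mult.commute)
  then show ?thesis by (rule G_param)
qed (simp add: G_const k_0)

text \<open>If \<open>x * y\<close> is constant then x is multiplied into the required relation for y; this is undone
  by writing the element as a small constant times y.\<close>
lemma G_inverse_linear:
  assumes "b \<in> k" "l \<in> k" "v (l / (t - b)) \<le> 1"
  shows "l / (t - b) \<in> G"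
proof (cases "l = 0")
  case l: False
  have tb: "t - b \<noteq> 0" "v (t - b) > 0" using t_diff_nonzero[OF assms(1)] v_pos by auto
  show ?thesis
  proof (cases "v (l / (t - b)) = 1")
    case True
    then have "v (inverse l * (t - b)) = 1"
      using l tb by (simp add: v_divide v_mult v_inverse field_simps)
    moreover from this have "inverse (inverse l * (t - b)) \<in> G"
      using assms by (intro G_inverse G_linear k_inverse) auto
    ultimately show ?thesis by (simp add: divide_inverse mult.commute)
  next
    case False
    then have "v (l / (t - b)) < 1" using assms(3) by simp
    \<comment> \<open>Dividing by \<open>n\<close> keeps \<open>y\<close> integral, while
      \<open>v n < 1\<close> opens an interval for the choice of \<open>c\<close>.\<close>
    then obtain n where n: "n \<in> k" "n \<noteq> 0" "v (l / (t - b)) < v n" "v n < 1"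
      using val_group_k_dense v_nonneg by metis
    have vn: "v n > 0" using n v_pos by blast
    define y where "y = l / n / (t - b)"
    have yl: "n * y = l / (t - b)" using n(2) by (simp add: y_def)
    then have "v n * v y < v n" using n(3) by (metis v_mult)
    then have y: "v y < 1" using vn by simp
    have "v (t - b) < v (t - b) / v n" using n(4) vn tb(2) by (simp add: field_simps)
    \<comment> \<open>This makes the parameter \<open>x = (t - b) / c\<close> integral and at least
      as large as \<open>n\<close>, so a relation multiplied by \<open>x\<close> yields one
      multiplied by \<open>n\<close>; and \<open>x * y\<close> is constant.\<close>
    then obtain c where c: "c \<in> k" "c \<noteq> 0" "v (t - b) < v c" "v c < v (t - b) / v n"
      using val_group_k_dense v_nonneg by metis
    have vc: "v c > 0" using c v_pos by blast
    define x where "x = (t - b) / c"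
    have x: "v x \<le> 1" "v n \<le> v x"
      using c(3,4) vc vn by (auto simp: x_def v_divide field_simps)
    have "param x" unfolding param_def using assms(1) c x x_def by blast
    then have Gx: "x \<in> G" by (rule G_param)
    have xy: "x * y = l / n / c" using tb by (simp add: x_def y_def)
    then have xyk: "x * y \<in> ring_int v k"
      using x(1) y assms n c v_mult_le_1[of x y] by (simp add: ring_int_def k_divide k_mult)
    have "eventually (\<lambda>p. E p (n * y) \<in> B) fine"
      using GD(3)[OF Gx]
    proof eventually_elim
      case (elim p)
      have "E p (x * y) - (fscale x (E p y) + fscale y (E p x)) \<in> B"
        using x y by (intro E_mult) (simp_all add: K0_iff)
      then have "fscale x (E p y) + fscale y (E p x) \<in> B"
        by (rule B_diff_cancel[OF _ E_const[OF xyk]])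
      then have "fscale x (E p y) + fscale y (E p x) - fscale y (E p x) \<in> B"
        using elim y by (intro B_diff scale_le) simp_all
      then have "fscale x (E p y) \<in> B" by simp
      then have 1: "fscale n (E p y) \<in> B" using x(2) by (rule scale_cancel)
      have "E p (n * y) - fscale n (E p y) \<in> B"
        using n y by (intro E_const_mult) (simp_all add: K0_iff ring_int_def)
      then show ?case using 1 by (rule B_diff_trans)
    qed
    moreover have "D (l / (t - b)) \<in> M" using False assms(3) by (intro D_small_M) simp
    ultimately show ?thesis using assms(3) yl by (simp add: G_def)
  qed
qed (simp add: G_const k_0)

text \<open>A constant \<mu> makes \<open>\<mu> * w\<close> integral while its \<open>j\<close>-th
  power stays at least as large as the monomial, which is then an integral constant times that
  power. The strict bound by 1 leaves room for \<mu>.\<close>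

lemma G_monomial:
  assumes w: "\<And>\<mu>. \<mu> \<in> k \<Longrightarrow> v (\<mu> * w) \<le> 1 \<Longrightarrow> \<mu> * w \<in> G"
    and w0: "w \<noteq> 0" and l: "l \<in> k" "v (l * w ^ j) < 1"
  shows "l * w ^ j \<in> G"
proof (cases "j = 0")
  case False
  then have j: "j > 0" by simp
  have vw: "v w > 0" using w0 v_pos by blast
  define \<rho> where "\<rho> = root j (v (l * w ^ j))"
  have \<rho>: "0 \<le> \<rho>" "\<rho> < 1" "\<rho> ^ j = v (l * w ^ j)"
    using j l(2) by (auto simp: \<rho>_def)
  obtain \<mu> where \<mu>: "\<mu> \<in> k" "\<mu> \<noteq> 0" "\<rho> / v w < v \<mu>" "v \<mu> < 1 / v w"
    using val_group_k_dense[of "\<rho> / v w" "1 / v w"] \<rho> vw by (auto simp: divide_strict_right_mono)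
  have 1: "\<rho> < v (\<mu> * w)" "v (\<mu> * w) < 1" using \<mu>(3,4) vw by (auto simp: v_mult field_simps)
  have "v (l * w ^ j) \<le> v ((\<mu> * w) ^ j)"
    using power_mono[of \<rho> "v (\<mu> * w)" j] \<rho> 1 by (simp add: v_power)
  then have "v l \<le> v (\<mu> ^ j)"
    using vw by (simp add: v_mult v_power power_mult_distrib)
  moreover have "v (\<mu> ^ j) > 0" using \<mu>(2) by (intro v_pos) simp
  ultimately have "v (l / \<mu> ^ j) \<le> 1" by (simp add: v_divide)
  then have "(l / \<mu> ^ j) * (\<mu> * w) ^ j \<in> G"
    using l \<mu> 1 by (intro G_mult G_power G_const w k_divide k_power) auto
  then show ?thesis using \<mu>(2) by (simp add: power_mult_distrib)
qed (use l G_const in simp)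

definition U where "U = {g \<in> G. v g = 1}"

lemma U_mult: "x \<in> U \<Longrightarrow> y \<in> U \<Longrightarrow> x * y \<in> U"
  by (simp add: U_def G_mult v_mult)

lemma U_inverse: "x \<in> U \<Longrightarrow> inverse x \<in> U"
  by (simp add: U_def G_inverse v_inverse)

lemma U_one: "1 \<in> U"
  by (simp add: U_def G_const k_1)

text \<open>Nonzero polynomials in \<open>t\<close> will have this form with one common
  \<open>s\<close>, so powers of \<open>s\<close> can be cancelled between numerator and
  denominator.\<close>

definition monomial_times_unit :: "'a \<Rightarrow> 'a \<Rightarrow> bool" where
  "monomial_times_unit s x \<longleftrightarrow> (\<exists>l i g. l \<in> k \<and> l \<noteq> 0 \<and> g \<in> U \<and> x = l * s ^ i * g)"

lemma monomial_times_unitI: "l \<in> k \<Longrightarrow> l \<noteq> 0 \<Longrightarrow> g \<in> U \<Longrightarrow> x = l * s ^ i * g \<Longrightarrow> monomial_times_unit s x"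
  unfolding monomial_times_unit_def by blast

lemma monomial_times_unitE:
  assumes "monomial_times_unit s x"
  obtains l i g where "l \<in> k" "l \<noteq> 0" "g \<in> U" "x = l * s ^ i * g"
  using assms unfolding monomial_times_unit_def by blast

lemma monomial_times_unit_mult:
  assumes "monomial_times_unit s x" "monomial_times_unit s y"
  shows "monomial_times_unit s (x * y)"
proof -
  obtain l i g where 1: "l \<in> k" "l \<noteq> 0" "g \<in> U" "x = l * s ^ i * g"
    using assms(1) by (rule monomial_times_unitE)
  obtain l' i' g' where 2: "l' \<in> k" "l' \<noteq> 0" "g' \<in> U" "y = l' * s ^ i' * g'"
    using assms(2) by (rule monomial_times_unitE)
  show ?thesis
  proof (rule monomial_times_unitI)
    show "l * l' \<in> k" "g * g' \<in> U" using 1 2 k_mult U_mult by auto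
    show "x * y = (l * l') * s ^ (i + i') * (g * g')" using 1 2 by (simp add: power_add mult_ac)
  qed (use 1 2 in simp)
qed

text \<open>Either every distance \<open>v (t - a)\<close> is a value of k, or all exceptions have equal distance to t
  and their ratios are units.\<close>
lemma linear_monomial_times_unit:
  obtains s where "s \<noteq> 0" "s = 1 \<or> (\<exists>b\<in>k. s = t - b \<and> v s \<notin> val_group v k)"
    "\<And>a. a \<in> k \<Longrightarrow> monomial_times_unit s (t - a)"
proof -
  have val: "monomial_times_unit s (t - a)" if a: "a \<in> k" "v (t - a) \<in> val_group v k" for a s
  proof -
    obtain l where l: "l \<in> k" "l \<noteq> 0" "v l = v (t - a)" using a(2) by (auto simp: val_group_def)
    have "v (inverse l * (t - a)) = 1" using l(2) by (simp add: v_mult v_inverse flip: l(3))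
    then have "inverse l * (t - a) \<in> U" using G_linear[of a "inverse l"] a l by (simp add: U_def k_inverse)
    then show ?thesis using l by (intro monomial_times_unitI[of l "inverse l * (t - a)" _ s 0]) auto
  qed
  show ?thesis
  proof (cases "\<forall>a\<in>k. v (t - a) \<in> val_group v k")
    case True
    then show ?thesis using val by (intro that[of 1]) auto
  next
    case False
    then obtain b where b: "b \<in> k" "v (t - b) \<notin> val_group v k" by blast
    have "monomial_times_unit (t - b) (t - a)" if a: "a \<in> k" for a
    proof (cases "v (t - a) \<in> val_group v k")
      case True
      then show ?thesis using val a by blast
    next
      case False
      have ab: "v (a - b) \<in> val_group v k" if "a \<noteq> b"
        unfolding val_group_def using a b k_diff that by auto
      \<comment> \<open>If the two distances differed, \<open>v (a - b)\<close> would equal the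
        larger one, which would then be a value of \<open>k\<close>.\<close>
      have eq: "v (t - a) = v (t - b)"
      proof (cases "a = b")
        case ne: False
        show ?thesis
        proof (rule ccontr)
          assume "v (t - a) \<noteq> v (t - b)"
          then consider "v (t - a) < v (t - b)" | "v (t - b) < v (t - a)" by linarith
          then show False
          proof cases
            case 1
            then have "v ((t - b) + - (t - a)) = v (t - b)" by (intro v_add_eq) (simp only: v_minus)
            then show ?thesis using ab[OF ne] b(2) by simp
          next
            case 2
            then have "v ((t - a) + - (t - b)) = v (t - a)" by (intro v_add_eq) (simp only: v_minus)
            then show ?thesis using ab[OF ne] False by (simp add: v_diff_commute[of b])
          qed
        qed
      qed simp
      have tb: "t - b \<noteq> 0" using t_diff_nonzero b by blast
      have "v (b - a) \<le> v (t - b)"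
        using v_diff_bound[of "t - a" "v (t - b)" "t - b"] eq by simp
      then have "v ((b - a) / (t - b)) \<le> 1" using v_pos[OF tb] by (simp add: v_divide)
      \<comment> \<open>This is the ratio of the two exceptional factors, rewritten so that
        \<open>G_inverse_linear\<close> applies.\<close>
      then have "1 + (b - a) / (t - b) \<in> G"
        using a b by (intro G_add G_inverse_linear G_const k_1 k_diff) auto
      moreover have q: "1 + (b - a) / (t - b) = (t - a) / (t - b)" using tb by (simp add: field_simps)
      ultimately have "(t - a) / (t - b) \<in> G" by simp
      then have "(t - a) / (t - b) \<in> U" using eq tb by (auto simp: U_def v_divide)
      then show ?thesis
        using k_1 tb by (intro monomial_times_unitI[of 1 "(t - a) / (t - b)" _ _ 1]) auto
    qed
    then show ?thesis using b t_diff_nonzero by (intro that[of "t - b"]) auto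
  qed
qed

text \<open>The linear factors of a fraction need not be integral, so they cannot be treated one at
  a time. Grouped as a constant times a power of \<open>s\<close> times a unit in \<open>G\<close>,
  the fraction has an integral monomial part because the unit has value 1.\<close>

lemma G_kt:
  assumes x: "x \<in> kt" "v x \<le> 1"
  shows "x \<in> G"
proof -
  obtain s where s: "s \<noteq> 0" "s = 1 \<or> (\<exists>b\<in>k. s = t - b \<and> v s \<notin> val_group v k)"
    and fact: "\<And>a. a \<in> k \<Longrightarrow> monomial_times_unit s (t - a)"
    using linear_monomial_times_unit by metis
  have poly: "monomial_times_unit s (poly p t)" if "poly_over k p" "p \<noteq> 0" for p
    using that
  proof (induction p rule: k_poly_induct)
    case (const c)
    then show ?case using U_one by (intro monomial_times_unitI[of c 1 _ s 0]) auto
  next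
    case (mult a q)
    have "monomial_times_unit s ((t - a) * poly q t)"
      by (intro monomial_times_unit_mult fact mult.hyps mult.IH)
    then show ?case by (simp add: algebra_simps)
  qed
  have mono_s: "l * w ^ j \<in> G" if l: "l \<in> k" "v (l * w ^ j) \<le> 1" and w: "w = s \<or> w = inverse s" for l w j
  proof (cases "s = 1 \<or> j = 0")
    case True
    then show ?thesis using l w G_const[of l] by auto
  next
    case False
    then obtain b where b: "b \<in> k" "s = t - b" "v s \<notin> val_group v k" using s by blast
    have w0: "w \<noteq> 0" using s(1) w by auto
    \<comment> \<open>Value 1 would put a positive power of \<open>v w\<close>, hence
      \<open>v s\<close>, into the divisible value group of \<open>k\<close>. This supplies the
      strict inequality that \<open>G_monomial\<close> asks for.\<close>
    have "v (l * w ^ j) \<noteq> 1"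
    proof
      assume 1: "v (l * w ^ j) = 1"
      then have l0: "l \<noteq> 0" by auto
      have "v w ^ j = v (inverse l)"
        using 1 inverse_unique[of "v l" "v w ^ j"] by (simp add: v_mult v_power v_inverse)
      then have "v w ^ j \<in> val_group v k"
        unfolding val_group_def using l0 l(1) k_inverse[of l] by auto
      then have "v w \<in> val_group v k"
        using val_group_k_divisible[OF v_pos[OF w0], of j] False by simp
      then have "v s \<in> val_group v k"
        using w val_group_inverse[OF k_subfield, of "v w"] by (auto simp: v_inverse)
      then show False using b(3) by simp
    qed
    then have less: "v (l * w ^ j) < 1" using l by simp
    have "m * w \<in> G" if "m \<in> k" "v (m * w) \<le> 1" for m
      using w that G_linear[OF b(1), of m] G_inverse_linear[OF b(1), of m] by (auto simp: b(2) divide_inverse)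
    then show ?thesis using w0 l(1) less by (rule G_monomial)
  qed
  obtain p q where pq: "poly_over k p" "poly_over k q" "q \<noteq> 0" "poly q t \<noteq> 0" "x = poly p t / poly q t"
    using kt_E[OF x(1)] by blast
  show ?thesis
  proof (cases "p = 0")
    case True
    then show ?thesis using pq(5) G_const k_0 by simp
  next
    case False
    obtain l i g where 1: "l \<in> k" "l \<noteq> 0" "g \<in> U" "poly p t = l * s ^ i * g"
      using poly[OF pq(1) False] by (rule monomial_times_unitE)
    obtain l' i' g' where 2: "l' \<in> k" "l' \<noteq> 0" "g' \<in> U" "poly q t = l' * s ^ i' * g'"
      using poly[OF pq(2,3)] by (rule monomial_times_unitE)
    define u where "u = g * inverse g'"
    have u: "u \<in> U" unfolding u_def using 1 2 by (intro U_mult U_inverse)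
    \<comment> \<open>A negative exponent of \<open>s\<close> is written as a positive power of its
      inverse.\<close>
    define w where "w = (if i' \<le> i then s else inverse s)"
    define j where "j = (if i' \<le> i then i - i' else i' - i)"
    have "s ^ i / s ^ i' = w ^ j"
    proof (cases "i' \<le> i")
      case True
      then show ?thesis using s(1) by (simp add: w_def j_def power_diff)
    next
      case False
      then show ?thesis using s(1) by (simp add: w_def j_def power_diff power_inverse)
    qed
    moreover have "x = (l / l') * (s ^ i / s ^ i') * u"
      by (simp add: pq(5) 1(4) 2(4) u_def divide_inverse mult_ac)
    ultimately have xe: "x = (l / l') * w ^ j * u" by simp
    have "v x = v ((l / l') * w ^ j) * v u"
      unfolding xe by (rule v_mult)
    then have "v ((l / l') * w ^ j) \<le> 1" using u x(2) by (simp add: U_def)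
    then have "(l / l') * w ^ j \<in> G"
      using 1 2 by (intro mono_s k_divide) (auto simp: w_def)
    then show ?thesis using u G_mult[of "(l / l') * w ^ j" u] unfolding xe U_def by simp
  qed
qed

end

text \<open>Work takes place in a quotient of \<Omega> in which \<eta> \<Omega> vanishes, so that
  errors divisible by \<eta> disappear.\<close>

locale absorbing_submodule = integral_submodule v k t B
  for v :: "'a::field \<Rightarrow> real" and k t and B :: "('a \<Rightarrow> 'a) set" +
  fixes \<eta> :: 'a
  assumes \<eta>_k: "\<eta> \<in> k" and \<eta>_nz: "\<eta> \<noteq> 0" and \<eta>_le: "v \<eta> \<le> 1"
    and absorb: "fs_ok (ring_int v UNIV) (ring_int v UNIV) w \<Longrightarrow> fscale \<eta> w \<in> B"
begin

lemma E_int: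
  assumes "v y \<le> 1" "param p" "v (D y) \<le> v (D p)"
  shows "fs_ok K0 K0 (E p y)"
  unfolding E_def using assms param_D[OF assms(2)] v_pos[of "D p"]
  by (intro int_diff int_dsym int_fscale) (auto simp: v_divide)

text \<open>Density of \<open>kt\<close> gives \<open>x = g + \<eta> * h\<close> with
  \<open>v h < 1\<close>. The first summand is covered by \<open>G_kt\<close>; for the second,
  \<open>E p h\<close> is an integral form for fine \<open>p\<close>, and its multiple by \<eta> is
  absorbed.\<close>

lemma G_F:
  assumes x: "x \<in> F" "v x \<le> 1"
  shows "x \<in> G"
proof -
  have v\<eta>: "v \<eta> > 0" using \<eta>_nz v_pos by blast
  obtain g where g: "g \<in> kt" "v (x - g) < v \<eta>"
    using x(1) v\<eta> unfolding F_closure v_closure_def by blast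
  define h where "h = (x - g) / \<eta>"
  have h: "v h < 1" using g(2) v\<eta> by (simp add: h_def v_divide)
  have eq: "x = g + \<eta> * h" using \<eta>_nz by (simp add: h_def)
  have \<eta>h: "v (\<eta> * h) \<le> 1" using h \<eta>_le by (intro v_mult_le_1) auto
  have "v g \<le> 1" using v_diff_bound[OF x(2) \<eta>h] eq by simp
  then have gG: "g \<in> G" by (rule G_kt[OF g(1)])
  have "eventually (\<lambda>p. E p (\<eta> * h) \<in> B) fine"
    using D_small_M[OF h, unfolded M_def mem_Collect_eq] eventually_fine_param
  proof eventually_elim
    case (elim p)
    then have "fscale \<eta> (E p h) \<in> B" using h by (intro absorb E_int) auto
    moreover have "E p (\<eta> * h) - fscale \<eta> (E p h) \<in> B"
      using \<eta>_k \<eta>_le h by (intro E_const_mult) (auto simp: ring_int_def)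
    ultimately show ?case by (rule B_diff_trans[rotated])
  qed
  moreover have "D (\<eta> * h) \<in> M"
    using M_mult[OF \<eta>_le D_small_M[OF h]] by (simp add: D_k_mult \<eta>_k)
  ultimately have "\<eta> * h \<in> G" using \<eta>h by (simp add: G_def)
  then show ?thesis unfolding eq using gG by (rule G_add[rotated])
qed

lemma poly_F_G: "poly_over (ring_int v F) P \<Longrightarrow> coeff P i \<in> G"
  by (rule G_F) (auto simp: poly_over_def ring_int_def)

text \<open>Solve the derivative of \<open>poly P y\<close> for \<open>D y\<close>: the small value
  \<open>poly P y\<close> is covered by \<open>D_small_M\<close> and the coefficients by
  \<open>G_F\<close>. Unlike \<open>D_bound\<close>, this also decides the boundary value
  \<open>1 / r\<close>.\<close>

lemma D_M:
  assumes "v y \<le> 1"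
  shows "D y \<in> M"
proof -
  obtain P where P: "poly_over (ring_int v F) P" "v (poly P y) < 1" "v (poly (pderiv P) y) = 1"
    using separating_poly[OF tame_F(4) assms] by blast
  have "poly (map_poly D P) y \<in> M"
    using assms by (rule M_poly) (simp add: coeff_map_poly D_0 GD(2) poly_F_G[OF P(1)])
  then have "D (poly P y) - poly (map_poly D P) y \<in> M"
    by (rule M_diff[OF D_small_M[OF P(2)]])
  moreover have "v (D y) = v (D (poly P y) - poly (map_poly D P) y)"
    using P(3) by (simp add: D_poly v_mult)
  ultimately show ?thesis using M_mono by simp
qed

text \<open>The chain rule is solved for \<open>E p y\<close> by cancelling the unit
  \<open>P'(y)\<close>. The finitely many coefficients of \<open>P\<close> satisfy their relations
  for a common threshold.\<close>

lemma G_separating_poly: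
  assumes y: "v y \<le> 1" and P: "poly_over (ring_int v F) P" "v (poly (pderiv P) y) = 1"
    and Py: "poly P y \<in> G"
  shows "y \<in> G"
proof -
  have "eventually (\<lambda>p. \<forall>i\<in>{..degree P}. E p (coeff P i) \<in> B) fine"
    by (intro eventually_ball_finite ballI GD(3) poly_F_G P) simp
  then have "eventually (\<lambda>p. E p y \<in> B) fine"
    using GD(3)[OF Py]
  proof eventually_elim
    case (elim p)
    have "E p (coeff P i) \<in> B" for i
      using elim E_const[OF c0_zero] by (cases "i \<le> degree P") (auto simp: coeff_eq_0)
    then have "E p (poly P y) - fscale (poly (pderiv P) y) (E p y) \<in> B"
      using P(1) y by (intro E_poly) (auto simp: K0_iff poly_over_def ring_int_def)
    then have "fscale (poly (pderiv P) y) (E p y) \<in> B"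
      using elim(2) by (rule B_diff_cancel)
    then have "fscale 1 (E p y) \<in> B"
      by (rule scale_cancel) (simp add: P(2))
    then show ?case by (simp add: fscale_simps)
  qed
  then show ?thesis using y D_M by (simp add: G_def)
qed

lemma E_power: "v y \<le> 1 \<Longrightarrow> E p (y ^ n) - fscale (of_nat n * y ^ (n - 1)) (E p y) \<in> B"
proof (induction n)
  case 0
  then show ?case using E_const[OF c0_one] by (simp add: fscale_simps)
next
  case (Suc n)
  have s: "of_nat (Suc n) * y ^ n = y * (of_nat n * y ^ (n - 1)) + y ^ n"
    by (cases n) (simp_all add: algebra_simps)
  have "E p (y * y ^ n) - fscale (of_nat (Suc n) * y ^ n) (E p y)
     = (E p (y * y ^ n) - (fscale y (E p (y ^ n)) + fscale (y ^ n) (E p y)))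
       + fscale y (E p (y ^ n) - fscale (of_nat n * y ^ (n - 1)) (E p y))"
    unfolding s by (simp add: fscale_simps)
  also have "\<dots> \<in> B"
    using Suc by (intro B_add E_mult scale_le) (auto simp: K0_iff v_power_le_1)
  finally show ?case by simp
qed

text \<open>Since z may be rescaled by constants to have absolute value close to 1, the factor
  \<open>z ^ (e - 1)\<close> produced by differentiating \<open>z ^ e\<close> is harmless.\<close>
lemma G_radical:
  assumes z: "z \<noteq> 0" "z ^ e = u * X" "X \<in> F" and u: "u \<in> G" "v u = 1"
    and x: "x \<in> F" "v (x * z) < 1"
  shows "x * z \<in> G"
proof (cases "x = 0")
  case False
  have vz: "v z > 0" using z v_pos by blast
  \<comment> \<open>Placing \<open>v y\<close> between \<rho> and 1 gives
    \<open>v w \<le> v y ^ (e - 1)\<close>, so the factor in front of \<open>E p y\<close> can be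
    lowered to \<open>w\<close>.\<close>
  define \<rho> where "\<rho> = root e (v (x * z))"
  have \<rho>: "0 \<le> \<rho>" "\<rho> < 1" "\<rho> ^ e = v (x * z)"
    using e_pos x(2) by (auto simp: \<rho>_def)
  obtain l where l: "l \<in> k" "l \<noteq> 0" "\<rho> / v z < v l" "v l < 1 / v z"
    using val_group_k_dense[of "\<rho> / v z" "1 / v z"] \<rho> vz by (auto simp: divide_strict_right_mono)
  define y where "y = l * z"
  have y: "\<rho> < v y" "v y < 1" using l(3,4) vz by (auto simp: y_def v_mult field_simps)
  have le: "v (x * z) \<le> v y ^ e"
    using power_mono[of \<rho> "v y" e] \<rho> y by simp
  define w where "w = x / l"
  have wy: "w * y = x * z" using l(2) by (simp add: w_def y_def)
  have "v w * v y \<le> v y ^ (e - 1) * v y"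
    using le e_pos wy by (simp add: v_mult[symmetric] power_eq_if mult.commute)
  then have vw: "v w \<le> v (y ^ (e - 1))"
    using y \<rho> by (simp add: v_power)
  have lF: "l \<in> F" using l k_subset_kt kt_subset_F by blast
  have wF: "w \<in> F" unfolding w_def using x lF by (intro subfield_divide F_subfield)
  have w1: "v w \<le> 1" using vw v_power_le_1[of y "e - 1"] y by simp
  have "y ^ e = u * (X * l ^ e)" by (simp add: y_def power_mult_distrib z(2))
  moreover from this have "v (X * l ^ e) \<le> 1"
  proof -
    assume yX: "y ^ e = u * (X * l ^ e)"
    have "v (X * l ^ e) = v (u * (X * l ^ e))" using u(2) by (simp add: v_mult)
    also have "\<dots> \<le> 1" using v_power_le_1[of y e] y unfolding yX[symmetric] by simp
    finally show ?thesis .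
  qed
  moreover have "X * l ^ e \<in> F" using z(3) lF by (intro subfield_mult subfield_power F_subfield)
  ultimately have ye: "y ^ e \<in> G" using G_mult[OF u(1) G_F] by simp
  have "eventually (\<lambda>p. E p (w * y) \<in> B) fine"
    using GD(3)[OF ye] GD(3)[OF G_F[OF wF w1]]
  proof eventually_elim
    case (elim p)
    have "E p (y ^ e) - fscale (of_nat e * y ^ (e - 1)) (E p y) \<in> B"
      using y by (intro E_power) simp
    then have "fscale (of_nat e * y ^ (e - 1)) (E p y) \<in> B"
      using elim(1) by (rule B_diff_cancel)
    then have "fscale w (E p y) \<in> B"
      by (rule scale_cancel) (use vw v_e in \<open>simp add: v_mult\<close>)
    moreover have "fscale y (E p w) \<in> B" using elim y by (intro scale_le) auto
    ultimately show ?case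
      using y w1 by (intro B_diff_trans[OF E_mult B_add]) (auto simp: K0_iff)
  qed
  then show ?thesis using D_small_M[OF x(2)] x(2) wy by (simp add: G_def)
qed (simp add: G_const k_0)

end

section \<open>Submodules of differentials divisible by a constant\<close>

context tame_element
begin

definition int_rels where
  "int_rels = span_over K0 (kahler_rels K0 (ring_int v k))"

text \<open>The submodule \<eta> \<Omega> at the level of formal sums; \<open>pi_pow_sub\<close> is
  its integral part for \<open>\<eta> = \<pi> ^ N\<close>.\<close>

definition int_scaled :: "'a \<Rightarrow> ('a \<Rightarrow> 'a) set" where
  "int_scaled \<eta> = {w. \<exists>u. fs_ok K0 K0 u \<and> w - fscale \<eta> u \<in> int_rels}"

lemma int_rels_zero: "0 \<in> int_rels"
  and int_rels_add: "w \<in> int_rels \<Longrightarrow> u \<in> int_rels \<Longrightarrow> w + u \<in> int_rels"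
  and int_rels_superset: "kahler_rels K0 (ring_int v k) \<subseteq> int_rels"
  by (simp_all add: int_rels_def span_over_zero span_over_add span_over_superset K0_iff)

lemma int_rels_scale: "v a \<le> 1 \<Longrightarrow> w \<in> int_rels \<Longrightarrow> fscale a w \<in> int_rels"
  unfolding int_rels_def by (rule span_over_fscale) (auto simp: K0_iff v_mult_le_1)

lemma int_rels_subset_scaled: "int_rels \<subseteq> int_scaled \<eta>"
  unfolding int_scaled_def using int_zero by (auto simp: fscale_simps intro!: exI[of _ 0])

lemma int_scaled_add:
  assumes "w \<in> int_scaled \<eta>" "u \<in> int_scaled \<eta>"
  shows "w + u \<in> int_scaled \<eta>"
proof -
  obtain w' u' where w: "fs_ok K0 K0 w'" "w - fscale \<eta> w' \<in> int_rels"
    and u: "fs_ok K0 K0 u'" "u - fscale \<eta> u' \<in> int_rels"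
    using assms unfolding int_scaled_def by blast
  have "w + u - fscale \<eta> (w' + u') = (w - fscale \<eta> w') + (u - fscale \<eta> u')"
    by (simp add: fscale_simps)
  then have "w + u - fscale \<eta> (w' + u') \<in> int_rels" using int_rels_add[OF w(2) u(2)] by (simp only:)
  then show ?thesis unfolding int_scaled_def using int_add[OF w(1) u(1)] by blast
qed

lemma int_scaled_mult:
  assumes "w \<in> int_scaled \<eta>" "v a \<le> 1"
  shows "fscale a w \<in> int_scaled (a * \<eta>)" "fscale a w \<in> int_scaled \<eta>"
proof -
  obtain w' where w: "fs_ok K0 K0 w'" "w - fscale \<eta> w' \<in> int_rels"
    using assms unfolding int_scaled_def by blast
  have "fscale a w - fscale (a * \<eta>) w' = fscale a (w - fscale \<eta> w')"
    "fscale a w - fscale \<eta> (fscale a w') = fscale a (w - fscale \<eta> w')"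
    by (simp_all add: fscale_simps mult.commute)
  then have "fscale a w - fscale (a * \<eta>) w' \<in> int_rels" "fscale a w - fscale \<eta> (fscale a w') \<in> int_rels"
    using int_rels_scale[OF assms(2) w(2)] by simp_all
  then show "fscale a w \<in> int_scaled (a * \<eta>)" "fscale a w \<in> int_scaled \<eta>"
    unfolding int_scaled_def using w(1) int_fscale[OF w(1) assms(2)] by blast+
qed

lemma int_scaled_mono:
  assumes "v \<eta> \<le> v \<theta>"
  shows "int_scaled \<eta> \<subseteq> int_scaled \<theta>"
proof (cases "\<theta> = 0")
  case True
  then show ?thesis using assms v_nonneg[of \<eta>] by simp
next
  case False
  show ?thesis
  proof
    fix w assume "w \<in> int_scaled \<eta>"
    then obtain u where u: "fs_ok K0 K0 u" "w - fscale \<eta> u \<in> int_rels" unfolding int_scaled_def by blast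
    have "v (\<eta> / \<theta>) \<le> 1" using assms v_pos[OF False] by (simp add: v_divide)
    moreover have "fscale \<eta> u = fscale \<theta> (fscale (\<eta> / \<theta>) u)" using False by (simp add: fscale_simps)
    ultimately show "w \<in> int_scaled \<theta>" unfolding int_scaled_def using u int_fscale by auto
  qed
qed

lemma absorbing_int_scaled:
  assumes "\<eta> \<in> k" "\<eta> \<noteq> 0" "v \<eta> \<le> 1"
  shows "absorbing_submodule v k t (int_scaled \<eta>) \<eta>"
proof -
  have "kahler_submodule K0 (ring_int v k) (int_scaled \<eta>) D"
  proof (rule kahler_submodule.intro)
    show "kahler_rels K0 (ring_int v k) \<subseteq> int_scaled \<eta>"
      using int_rels_superset int_rels_subset_scaled by blast
    show "0 \<in> int_scaled \<eta>" using int_rels_zero int_rels_subset_scaled by blast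
  qed (simp_all add: ring_int_def v_add_bound v_mult_le_1 k_0 k_1 k_minus D_derivation D_k
        int_scaled_add int_scaled_mult(2) subset_iff)
  moreover have "fscale \<eta> w \<in> int_scaled \<eta>" if "fs_ok K0 K0 w" for w
    unfolding int_scaled_def using that int_rels_zero by (auto intro!: exI[of _ w])
  ultimately show ?thesis
    using assms
    by (intro absorbing_submodule.intro integral_submodule.intro tame_element_axioms
        absorbing_submodule_axioms.intro)
qed

end

section \<open>Contraction over the valuation ring\<close>

context tame_element
begin

text \<open>The finite set is fixed before \<open>B\<close> and \<eta>, because the contraction runs
  through a sequence of submodules with the same generators. It consists of the residue basis and
  the units \<open>z g ^ e / x g\<close>; \<open>G_radical\<close> supplies the other factors of the
  expansion.\<close>

lemma unit_generators:
  obtains U where "finite U" "\<And>w. w \<in> U \<Longrightarrow> v w = 1"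
    "\<And>B \<eta> y. absorbing_submodule v k t B \<eta> \<Longrightarrow> U \<subseteq> integral_submodule.G v k t B \<Longrightarrow> v y < 1
       \<Longrightarrow> y \<in> integral_submodule.G v k t B"
proof -
  let ?C = "ram_cosets v F"
  obtain f :: nat and c :: "nat \<Rightarrow> 'a" and z x :: "real set \<Rightarrow> 'a"
    where c: "\<And>j. j < f \<Longrightarrow> v (c j) = 1" and z: "\<And>g. g \<in> ?C \<Longrightarrow> z g \<noteq> 0"
    and x: "\<And>g. g \<in> ?C \<Longrightarrow> x g \<in> F" "\<And>g. g \<in> ?C \<Longrightarrow> v (x g) = v (z g) ^ e"
    and expand: "\<And>y. \<exists>a. (\<forall>j<f. \<forall>g\<in>?C. a j g \<in> F \<and> v (a j g * z g) \<le> v y)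
        \<and> y = (\<Sum>j<f. \<Sum>g\<in>?C. a j g * z g * c j)"
    by (rule tame_basis[OF F_subfield tame_F(3), folded e_def]) blast
  define u where "u g = z g ^ e / x g" for g
  define T where "T = c ` {..<f} \<union> u ` ?C"
  have x0: "x g \<noteq> 0" if "g \<in> ?C" for g
    using x(2)[OF that] z[OF that] v_eq_0[of "x g"] by auto
  have vT: "v w = 1" if "w \<in> T" for w
    using that c x(2) x0 z by (auto simp: T_def u_def v_divide v_power simp flip: v_eq_0)
  have "y \<in> integral_submodule.G v k t B"
    if B: "absorbing_submodule v k t B \<eta>" and TG: "T \<subseteq> integral_submodule.G v k t B" and y: "v y < 1"
    for B \<eta> y
  proof -
    interpret absorbing_submodule v k t B \<eta> by (rule B)
    obtain a where a: "\<forall>j<f. \<forall>g\<in>?C. a j g \<in> F \<and> v (a j g * z g) \<le> v y"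
      and ye: "y = (\<Sum>j<f. \<Sum>g\<in>?C. a j g * z g * c j)"
      using expand by blast
    have "a j g * z g * c j \<in> G" if "j < f" "g \<in> ?C" for j g
    proof (rule G_mult)
      show "c j \<in> G" using that TG by (auto simp: T_def)
      have ug: "u g \<in> T" using that by (simp add: T_def)
      show "a j g * z g \<in> G"
      proof (rule G_radical)
        show "z g ^ e = u g * x g" using x0[OF that(2)] by (simp add: u_def)
        show "u g \<in> G" "v (u g) = 1" using ug TG vT by auto
        have "v (a j g * z g) \<le> v y" using a that by blast
        then show "v (a j g * z g) < 1" using y by simp
      qed (use that a z x in auto)
    qed
    then show ?thesis unfolding ye by (intro G_sum) auto
  qed
  moreover have "finite T" using tame_F(3) by (simp add: T_def tamely_ramified_def)
  ultimately show ?thesis using vT that by blast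
qed

text \<open>Contraction argument: if the finitely many unit generators satisfy the claim modulo
  \<open>\<kappa> ^ s\<close>, then elements of absolute value less than \<open>v \<kappa>\<close> satisfy it modulo \<open>\<kappa> ^ Suc s\<close>, hence
  so do the unit generators, each of which is a simple root of a polynomial over F up to such an
  element.\<close>
lemma integral_differential:
  assumes \<eta>: "\<eta> \<in> k" "\<eta> \<noteq> 0" "v \<eta> \<le> 1" and y: "v y \<le> 1"
  shows "y \<in> integral_submodule.G v k t (int_scaled \<eta>)"
proof -
  obtain U where U: "finite U" "\<And>w. w \<in> U \<Longrightarrow> v w = 1"
    and gen: "\<And>B \<eta> y. absorbing_submodule v k t B \<eta> \<Longrightarrow> U \<subseteq> integral_submodule.G v k t B \<Longrightarrow> v y < 1
       \<Longrightarrow> y \<in> integral_submodule.G v k t B"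
    by (rule unit_generators) blast
  have "\<exists>P. poly_over (ring_int v F) P \<and> v (poly P w) < 1 \<and> v (poly (pderiv P) w) = 1" if "v w \<le> 1" for w
    using separating_poly[OF tame_F(4) that] by blast
  then obtain P where P: "\<And>w. v w \<le> 1 \<Longrightarrow> poly_over (ring_int v F) (P w)"
      "\<And>w. v w \<le> 1 \<Longrightarrow> v (poly (P w) w) < 1" "\<And>w. v w \<le> 1 \<Longrightarrow> v (poly (pderiv (P w)) w) = 1"
    by metis
  \<comment> \<open>The worst error of the separating polynomials at the generators; finiteness
    keeps it below 1, with room for a constant \<kappa> above it.\<close>
  define q where "q = Max (insert 0 ((\<lambda>w. v (poly (P w) w)) ` U))"
  have q: "0 \<le> q" "\<And>w. w \<in> U \<Longrightarrow> v (poly (P w) w) \<le> q"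
    unfolding q_def using U(1) by (auto intro!: Max_ge)
  have "q \<in> insert 0 ((\<lambda>w. v (poly (P w) w)) ` U)" unfolding q_def using U(1) by (intro Max_in) auto
  then have "q < 1" using P(2) U(2) by auto
  then obtain \<kappa> where \<kappa>: "\<kappa> \<in> k" "\<kappa> \<noteq> 0" "q < v \<kappa>" "v \<kappa> < 1"
    using val_group_k_dense[OF q(1)] by blast
  have abs: "absorbing_submodule v k t (int_scaled (\<kappa> ^ s)) (\<kappa> ^ s)" for s
    using \<kappa> v_power_le_1[of \<kappa> s] by (intro absorbing_int_scaled k_power) auto
  have units: "U \<subseteq> integral_submodule.G v k t (int_scaled (\<kappa> ^ s))" for s
  proof (induction s)
    case 0
    interpret absorbing_submodule v k t "int_scaled (\<kappa> ^ 0)" "\<kappa> ^ 0" by (rule abs)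
    show ?case
    proof
      fix w assume "w \<in> U"
      then have w: "v w \<le> 1" using U(2) by simp
      \<comment> \<open>At exponent 0 every integral form is absorbed, so only
        \<open>D w \<in> M\<close> matters.\<close>
      have "eventually (\<lambda>p. E p w \<in> int_scaled (\<kappa> ^ 0)) fine"
        using D_M[OF w, unfolded M_def mem_Collect_eq] eventually_fine_param
      proof eventually_elim
        case (elim p)
        then have "fscale (\<kappa> ^ 0) (E p w) \<in> int_scaled (\<kappa> ^ 0)" using w by (intro absorb E_int) auto
        then show ?case by (simp add: fscale_simps)
      qed
      then show "w \<in> G" unfolding G_def mem_Collect_eq using w D_M by (intro conjI)
    qed
  next
    case (Suc s)
    interpret old: absorbing_submodule v k t "int_scaled (\<kappa> ^ s)" "\<kappa> ^ s" by (rule abs)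
    interpret new: absorbing_submodule v k t "int_scaled (\<kappa> ^ Suc s)" "\<kappa> ^ Suc s" by (rule abs)
    show ?case
    proof
      fix w assume w: "w \<in> U"
      then have w1: "v w \<le> 1" using U(2) by simp
      define \<epsilon> where "\<epsilon> = poly (P w) w"
      have v\<kappa>: "v \<kappa> > 0" using \<kappa> v_pos by blast
      have "v \<epsilon> < v \<kappa>" using q(2)[OF w] \<kappa>(3) by (simp add: \<epsilon>_def)
      then have small: "v (\<epsilon> / \<kappa>) < 1" using v\<kappa> by (simp add: v_divide)
      \<comment> \<open>Division by \<kappa> stays in the maximal ideal, where the relation holds
        modulo \<open>\<kappa> ^ s\<close>; multiplying back by the constant \<kappa> multiplies the
        submodule too and gains one power.\<close>
      then have "\<epsilon> / \<kappa> \<in> old.G" by (rule gen[OF abs Suc.IH])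
      from old.GD(3)[OF this] have "eventually (\<lambda>p. new.E p (\<kappa> * (\<epsilon> / \<kappa>)) \<in> int_scaled (\<kappa> ^ Suc s)) fine"
      proof eventually_elim
        case (elim p)
        have "new.E p (\<kappa> * (\<epsilon> / \<kappa>)) - fscale \<kappa> (new.E p (\<epsilon> / \<kappa>)) \<in> int_scaled (\<kappa> ^ Suc s)"
          using \<kappa> small by (intro new.E_const_mult) (auto simp: ring_int_def)
        moreover have "fscale \<kappa> (new.E p (\<epsilon> / \<kappa>)) \<in> int_scaled (\<kappa> ^ Suc s)"
          using int_scaled_mult(1)[OF elim, of \<kappa>] \<kappa> by simp
        ultimately show ?case by (rule new.B_diff_trans)
      qed
      then have "eventually (\<lambda>p. new.E p \<epsilon> \<in> int_scaled (\<kappa> ^ Suc s)) fine" using \<kappa> by simp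
      moreover have "v \<epsilon> < 1" using P(2)[OF w1] by (simp add: \<epsilon>_def)
      ultimately have "\<epsilon> \<in> new.G" using D_small_M by (simp add: new.G_def del: power_Suc)
      then show "w \<in> new.G" unfolding \<epsilon>_def
        by (rule new.G_separating_poly[OF w1 P(1)[OF w1] P(3)[OF w1]])
    qed
  qed
  have "(\<lambda>s. v \<kappa> ^ s) \<longlonglongrightarrow> 0" using \<kappa> by (intro LIMSEQ_realpow_zero) auto
  from order_tendstoD(2)[OF this v_pos[OF \<eta>(2)]] obtain s where s: "v (\<kappa> ^ s) < v \<eta>"
    by (auto simp: eventually_sequentially v_power)
  interpret absorbing_submodule v k t "int_scaled (\<kappa> ^ s)" "\<kappa> ^ s" by (rule abs)
  have "poly (P y) y \<in> G" using P(2)[OF y] by (intro gen[OF abs units])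
  then have yG: "y \<in> G" by (rule G_separating_poly[OF y P(1)[OF y] P(3)[OF y]])
  have "int_scaled (\<kappa> ^ s) \<subseteq> int_scaled \<eta>" using s by (intro int_scaled_mono) simp
  then have ev: "eventually (\<lambda>p. E p y \<in> int_scaled \<eta>) fine"
    using GD(3)[OF yG] by (auto elim: eventually_mono)
  interpret target: absorbing_submodule v k t "int_scaled \<eta>" \<eta> by (rule absorbing_int_scaled[OF \<eta>])
  show ?thesis
    using ev y GD(2)[OF yG] by (simp add: target.G_def)
qed

lemma D_M: 
  assumes "v y \<le> 1"
  shows "D y \<in> M"
proof -
  have "absorbing_submodule v k t (int_scaled 1) 1" by (intro absorbing_int_scaled k_1) auto
  then show ?thesis using absorbing_submodule.D_M assms by blast
qed

section \<open>Divisibility read off from the pairing\<close>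

lemma pairing_M:
  assumes "fs_ok K0 K0 w"
  shows "pairing D w \<in> M"
  unfolding pairing_def using assms by (intro M_sum M_mult D_M) (auto simp: fs_ok_def K0_iff)

lemma pairing_int_rels: "w \<in> int_rels \<Longrightarrow> finite {f. w f \<noteq> 0} \<and> pairing D w = 0"
  unfolding int_rels_def
  by (rule span_rels_pairing[OF D_derivation]) (auto simp: ring_int_def D_k)

lemma pairing_int_scaled:
  assumes "w \<in> int_scaled \<eta>"
  obtains x where "x \<in> M" "pairing D w = \<eta> * x"
proof -
  obtain u where u: "fs_ok K0 K0 u" "w - fscale \<eta> u \<in> int_rels" using assms int_scaled_def by auto
  have fin: "finite {f. fscale \<eta> u f \<noteq> 0}" by (intro finite_support_fscale int_finite u)
  have "w = (w - fscale \<eta> u) + fscale \<eta> u" by simp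
  then have "pairing D w = pairing D (w - fscale \<eta> u) + pairing D (fscale \<eta> u)"
    using pairing_add[OF conjunct1[OF pairing_int_rels[OF u(2)]] fin, of D] by (simp only:)
  also have "\<dots> = \<eta> * pairing D u"
    using pairing_int_rels[OF u(2)] by (simp add: pairing_fscale int_finite u)
  finally show ?thesis using that pairing_M[OF u(1)] by blast
qed

text \<open>Modulo \<eta> \<Omega> the form \<open>w\<close> equals
  \<open>(pairing D w / D p) dp = \<eta> (x / D p) dp\<close>, with \<open>x / D p\<close> integral
  for fine \<open>p\<close>. With \<open>pairing_int_scaled\<close> this turns divisibility by
  \<eta> into a condition on one number.\<close>

lemma int_scaled_of_pairing:
  assumes w: "fs_ok K0 K0 w" and \<eta>: "\<eta> \<in> k" "\<eta> \<noteq> 0" "v \<eta> \<le> 1" and x: "x \<in> M" "pairing D w = \<eta> * x"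
  shows "w \<in> int_scaled \<eta>"
proof -
  interpret absorbing_submodule v k t "int_scaled \<eta>" \<eta> by (rule absorbing_int_scaled[OF \<eta>])
  have "eventually (\<lambda>p. \<forall>f\<in>{f. w f \<noteq> 0}. E p f \<in> int_scaled \<eta>) fine"
    using w integral_differential[OF \<eta>]
    by (intro eventually_ball_finite ballI GD(3)) (auto simp: fs_ok_def K0_iff)
  with x(1)[unfolded M_def mem_Collect_eq] eventually_fine_param
  have "eventually (\<lambda>p. w \<in> int_scaled \<eta>) fine"
  proof eventually_elim
    case (elim p)
    have "w - fscale (pairing D w / D p) (dsym p) \<in> int_scaled \<eta>"
      using elim w by (intro E_pairing) auto
    moreover have "fscale (pairing D w / D p) (dsym p) = fscale \<eta> (fscale (x / D p) (dsym p))"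
      by (simp add: x(2) fscale_simps)
    moreover have "fscale \<eta> (fscale (x / D p) (dsym p)) \<in> int_scaled \<eta>"
      using elim param_D[of p] v_pos[of "D p"]
      by (intro absorb int_fscale int_dsym) (auto simp: v_divide)
    ultimately show ?case by (metis B_diff_trans)
  qed
  then show ?thesis using eventually_fine_ex by blast
qed

section \<open>Passage to the completions\<close>

lemma pi_pow_sub_eq: "pi_pow_sub v k \<pi> N = {w. fs_ok K0 K0 w \<and> w \<in> int_scaled (\<pi> ^ N)}"
  unfolding pi_pow_sub_def int_scaled_def int_rels_def fsub_eq by simp

lemma kahler_sn_diff:
  assumes "finite {f. w f \<noteq> 0}" "finite {f. u f \<noteq> 0}"
  shows "kahler_sn v k (fsub w u) = r * v (pairing D w - pairing D u)"
  unfolding fsub_eq using assms by (simp add: kahler_sn_eq finite_support_diff pairing_diff)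

lemma kahler_sn_tendsto:
  assumes "\<And>n. finite {f. X n f \<noteq> 0}" "\<And>n. finite {f. Y n f \<noteq> 0}"
  shows "(\<lambda>n. kahler_sn v k (fsub (X n) (Y n))) \<longlonglongrightarrow> 0 \<longleftrightarrow> vlim (\<lambda>n. pairing D (X n) - pairing D (Y n)) 0"
  unfolding vlim_def using assms r_pos tendsto_mult_left_iff[of r "\<lambda>n. v (pairing D (X n) - pairing D (Y n))" 0]
  by (simp add: kahler_sn_diff)

lemma vlim_diff_0_iff: "vlim (\<lambda>n. x n - c) 0 \<longleftrightarrow> vlim x c"
  by (simp add: vlim_def)

lemma kahler_sn_tendsto_dt:
  assumes "\<And>n. finite {f. X n f \<noteq> 0}"
  shows "(\<lambda>n. kahler_sn v k (fsub (X n) (fscale c (dsym t)))) \<longlonglongrightarrow> 0 \<longleftrightarrow> vlim (\<lambda>n. pairing D (X n)) c"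
  using kahler_sn_tendsto[of X "\<lambda>_. fscale c (dsym t)"] assms
  by (simp add: finite_support pairing_fscale pairing_dsym D_t vlim_diff_0_iff)

text \<open>Up to the factor \<open>r\<close> the pairing preserves the seminorm, so Cauchy
  sequences of forms become Cauchy sequences in K; the limit is the coordinate along
  \<open>dt\<close>.\<close>

lemma om_cauchy_limit:
  assumes "om_cauchy v k X"
  obtains c where "vlim (\<lambda>n. pairing D (X n)) c"
proof -
  have fin: "finite {f. X n f \<noteq> 0}" for n using assms by (simp add: om_cauchy_def fs_ok_UNIV)
  have "v_cauchy v (\<lambda>n. pairing D (X n))"
    unfolding v_cauchy_def
  proof (intro allI impI)
    fix \<epsilon> :: real assume "\<epsilon> > 0"
    then have "r * \<epsilon> > 0" using r_pos by simp
    then obtain N where "\<forall>m\<ge>N. \<forall>n\<ge>N. kahler_sn v k (fsub (X m) (X n)) < r * \<epsilon>"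
      using assms unfolding om_cauchy_def by blast
    then show "\<exists>N. \<forall>m\<ge>N. \<forall>n\<ge>N. v (pairing D (X m) - pairing D (X n)) < \<epsilon>"
      using r_pos by (auto simp: kahler_sn_diff fin)
  qed
  then show ?thesis using completeD[OF complete, of "\<lambda>n. pairing D (X n)"] that by auto
qed

lemma kahler_basis:
  assumes "om_cauchy v k X"
  shows "\<exists>!c. (\<lambda>n. kahler_sn v k (fsub (X n) (fscale c (dsym t)))) \<longlonglongrightarrow> 0"
proof -
  have fin: "finite {f. X n f \<noteq> 0}" for n using assms by (simp add: om_cauchy_def fs_ok_UNIV)
  obtain c where "vlim (\<lambda>n. pairing D (X n)) c" using om_cauchy_limit[OF assms] by blast
  then show ?thesis
    unfolding kahler_sn_tendsto_dt[OF fin] using vlim_unique by blast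
qed

lemma kahler_sn_dt: "kahler_sn v k (dsym t) = radius v k t"
  by (simp add: kahler_sn_eq finite_support_dsym pairing_dsym D_t r_def)

text \<open>Convergence in the seminorm only says that the pairings tend to 0. Since \<eta> times
  the module \<open>M\<close> contains a ball around 0, \<open>int_scaled_of_pairing\<close> turns
  this smallness into divisibility.\<close>

lemma completion_injective:
  assumes \<pi>: "\<pi> \<in> k" "0 < v \<pi>" "v \<pi> < 1"
    and Y: "pi_cauchy v k \<pi> Y" and Z: "pi_cauchy v k \<pi> Z"
    and lim: "(\<lambda>n. kahler_sn v k (fsub (Y n) (Z n))) \<longlonglongrightarrow> 0"
  shows "\<exists>M. \<forall>n\<ge>M. fsub (Y n) (Z n) \<in> pi_pow_sub v k \<pi> N"
proof -
  let ?\<eta> = "\<pi> ^ N"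
  have \<eta>: "?\<eta> \<in> k" "?\<eta> \<noteq> 0" "v ?\<eta> \<le> 1"
    using \<pi> k_power v_power_le_1[of \<pi> N] by auto
  interpret absorbing_submodule v k t "int_scaled ?\<eta>" ?\<eta> by (rule absorbing_int_scaled[OF \<eta>])
  have YZ: "fs_ok K0 K0 (Y n)" "fs_ok K0 K0 (Z n)" for n using Y Z by (auto simp: pi_cauchy_def)
  define W where "W n = Y n - Z n" for n
  have W: "fs_ok K0 K0 (W n)" for n unfolding W_def by (intro int_diff YZ)
  obtain M1 where M1: "\<forall>m\<ge>M1. \<forall>n\<ge>M1. fsub (Y m) (Y n) \<in> pi_pow_sub v k \<pi> N"
    using Y unfolding pi_cauchy_def by blast
  obtain M2 where M2: "\<forall>m\<ge>M2. \<forall>n\<ge>M2. fsub (Z m) (Z n) \<in> pi_pow_sub v k \<pi> N"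
    using Z unfolding pi_cauchy_def by blast
  define m where "m = max M1 M2"
  have close: "W n - W l \<in> int_scaled ?\<eta>" if "n \<ge> m" "l \<ge> m" for n l
  proof -
    have "Y n - Y l \<in> int_scaled ?\<eta>" "Z n - Z l \<in> int_scaled ?\<eta>"
      using M1 M2 that by (auto simp: m_def pi_pow_sub_eq fsub_eq)
    then have "(Y n - Y l) - (Z n - Z l) \<in> int_scaled ?\<eta>" by (rule B_diff)
    moreover have "W n - W l = (Y n - Y l) - (Z n - Z l)" by (simp add: W_def)
    ultimately show ?thesis by (simp only:)
  qed
  have "vlim (\<lambda>n. pairing D (Y n) - pairing D (Z n)) 0"
    using lim YZ by (simp add: kahler_sn_tendsto int_finite)
  then have "vlim (\<lambda>n. pairing D (W n)) 0"
    by (simp add: W_def pairing_diff int_finite YZ)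
  moreover have "v ?\<eta> * inverse r > 0" using v_pos[OF \<eta>(2)] r_pos by simp
  ultimately obtain n0 where n0: "\<And>n. n \<ge> n0 \<Longrightarrow> v (pairing D (W n)) < v ?\<eta> * inverse r"
    using order_tendstoD(2)[of _ 0 sequentially "v ?\<eta> * inverse r"]
    unfolding vlim_def eventually_sequentially by force
  have "W n \<in> int_scaled ?\<eta>" if n: "n \<ge> m" for n
  proof -
    \<comment> \<open>An index so far out that the pairing of \<open>W l\<close> is small. As
      \<open>W n\<close> differs from \<open>W l\<close> by a multiple of \<eta>, its pairing lies
      in \<eta> times the module \<open>M\<close> as well.\<close>
    define l where "l = max n0 m"
    obtain x where x: "x \<in> M" "pairing D (W n - W l) = ?\<eta> * x"
      using pairing_int_scaled[OF close[of n l]] n by (auto simp: l_def)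
    have "v (pairing D (W l) / ?\<eta>) < inverse r"
      using n0[of l] v_pos[OF \<eta>(2)] by (simp add: l_def v_divide field_simps)
    then have "pairing D (W l) / ?\<eta> \<in> M" by (rule M_small)
    then have xM: "x + pairing D (W l) / ?\<eta> \<in> M" by (rule M_add[OF x(1)])
    have "pairing D (W n) = ?\<eta> * x + pairing D (W l)"
      using x(2) by (simp add: pairing_diff int_finite W algebra_simps)
    then have "pairing D (W n) = ?\<eta> * (x + pairing D (W l) / ?\<eta>)"
      using \<eta>(2) by (simp add: distrib_left)
    then show ?thesis by (rule int_scaled_of_pairing[OF W \<eta> xM])
  qed
  then show ?thesis
    using W by (intro exI[of _ m]) (auto simp: pi_pow_sub_eq fsub_eq W_def)
qed

lemma integral_image:
  assumes \<pi>: "\<pi> \<in> k" "0 < v \<pi>" "v \<pi> < 1" and X: "om_cauchy v k X"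
  shows "(\<exists>Y. pi_cauchy v k \<pi> Y \<and> (\<lambda>n. kahler_sn v k (fsub (Y n) (X n))) \<longlonglongrightarrow> 0)
     \<longleftrightarrow> (\<exists>(m::nat) b c. (\<forall>i<m. b i \<in> K0 \<and> c i \<in> k \<and> c i \<noteq> 0 \<and> (\<exists>a\<in>k. v (t - a) \<le> v (c i)))
          \<and> (\<lambda>n. kahler_sn v k (fsub (X n) (fscale (\<Sum>i<m. b i / c i) (dsym t)))) \<longlonglongrightarrow> 0)"
    (is "?L \<longleftrightarrow> ?R")
proof -
  have fin: "finite {f. X n f \<noteq> 0}" for n using X by (simp add: om_cauchy_def fs_ok_UNIV)
  obtain x where x: "vlim (\<lambda>n. pairing D (X n)) x" using om_cauchy_limit[OF X] by blast
  show ?thesis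
  proof
    assume ?L
    then obtain Y where Y: "pi_cauchy v k \<pi> Y" "(\<lambda>n. kahler_sn v k (fsub (Y n) (X n))) \<longlonglongrightarrow> 0" by blast
    have YK: "fs_ok K0 K0 (Y n)" for n using Y(1) by (simp add: pi_cauchy_def)
    have "vlim (\<lambda>n. pairing D (Y n) - pairing D (X n)) 0"
      using Y(2) kahler_sn_tendsto[of Y X] fin YK by (simp add: int_finite)
    from vlim_add[OF this x] have "vlim (\<lambda>n. pairing D (Y n)) x" by simp
    moreover have "inverse r > 0" using r_pos by simp
    ultimately obtain n where "v (pairing D (Y n) - x) < inverse r"
      using order_tendstoD(2)[of _ 0 sequentially "inverse r"]
      unfolding vlim_def eventually_sequentially by blast
    \<comment> \<open>The module \<open>M\<close> contains a ball around 0, so it is closed and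
      keeps the limit \<open>x\<close> of pairings of integral forms.\<close>
    then have "pairing D (Y n) - (pairing D (Y n) - x) \<in> M"
      by (intro M_diff M_small pairing_M YK)
    then have "x \<in> M" by simp
    then obtain p where p: "param p" "v x \<le> v (D p)" unfolding M_iff by blast
    then obtain a c where ac: "a \<in> k" "c \<in> k" "c \<noteq> 0" "p = (t - a) / c" "v p \<le> 1"
      unfolding param_def by blast
    have vc: "v c > 0" using ac v_pos by blast
    \<comment> \<open>One summand is enough: the generators are totally ordered by divisibility, so
      \<open>x\<close> is an integral multiple of a single \<open>1 / c\<close>.\<close>
    have "v (x * c) \<le> 1"
      using p(2) D_affine[OF ac(2,1)] vc unfolding ac(4) by (simp add: v_mult v_divide field_simps)
    moreover have "v (t - a) \<le> v c" using ac(5) vc by (simp add: ac(4) v_divide)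
    moreover have "vlim (\<lambda>n. pairing D (X n)) (\<Sum>i<(1::nat). x * c / c)" using x ac(3) by simp
    ultimately show ?R
      unfolding kahler_sn_tendsto_dt[OF fin] using ac
      by (intro exI[of _ "1::nat"] exI[of _ "\<lambda>_. x * c"] exI[of _ "\<lambda>_. c"]) (auto simp: K0_iff)
  next
    assume ?R
    then obtain m :: nat and b c where bc: "\<forall>i<m. b i \<in> K0 \<and> c i \<in> k \<and> c i \<noteq> 0 \<and> (\<exists>a\<in>k. v (t - a) \<le> v (c i))"
      and lim: "vlim (\<lambda>n. pairing D (X n)) (\<Sum>i<m. b i / c i)"
      unfolding kahler_sn_tendsto_dt[OF fin] by blast
    \<comment> \<open>As \<open>dt / c\<close> is the differential of \<open>(t - a) / c\<close>,
      the limit is represented by an actual integral form, and the constant sequence serves as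
      \<open>Y\<close>.\<close>
    have "\<exists>w. fs_ok K0 K0 w \<and> pairing D w = (\<Sum>i<m. b i / c i)"
      using bc
    proof (induction m)
      case 0
      have "pairing D 0 = 0" by (simp add: pairing_def zero_fun_apply)
      then show ?case by (intro exI[of _ 0] conjI int_zero) simp
    next
      case (Suc m)
      then obtain w where w: "fs_ok K0 K0 w" "pairing D w = (\<Sum>i<m. b i / c i)" by auto
      obtain a where a: "a \<in> k" "v (t - a) \<le> v (c m)" and m: "b m \<in> K0" "c m \<in> k" "c m \<noteq> 0"
        using Suc.prems by blast
      let ?q = "(t - a) / c m"
      have "v ?q \<le> 1" using a(2) v_pos[OF m(3)] by (simp add: v_divide)
      then have q: "fs_ok K0 K0 (fscale (b m) (dsym ?q))"
        using m(1) by (intro int_fscale int_dsym) (simp_all add: K0_iff)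
      have "pairing D (w + fscale (b m) (dsym ?q)) = (\<Sum>i<Suc m. b i / c i)"
        using w q D_affine[OF m(2) a(1)]
        by (simp add: pairing_add int_finite pairing_fscale finite_support_dsym pairing_dsym)
      then show ?case using int_add[OF w(1) q] by blast
    qed
    then obtain w where w: "fs_ok K0 K0 w" "pairing D w = (\<Sum>i<m. b i / c i)" by blast
    have "pi_cauchy v k \<pi> (\<lambda>_. w)"
      unfolding pi_cauchy_def pi_pow_sub_eq fsub_eq
      using w(1) int_zero int_rels_zero int_rels_subset_scaled by auto
    moreover have "(\<lambda>n. kahler_sn v k (fsub w (X n))) \<longlonglongrightarrow> 0"
      using kahler_sn_tendsto[of "\<lambda>_. w" X] fin int_finite[OF w(1)] vlim_diff[OF vlim_const lim, of "pairing D w"]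
      by (simp add: w(2))
    ultimately show ?L by blast
  qed
qed

end

theorem theorem2p6:
  fixes v :: "'a::field \<Rightarrow> real" and k :: "'a set" and t :: 'a
  assumes "analytic_k_field v k" and "one_dimensional v k" and "tame_parameter v k t"
  shows "(\<forall>X. om_cauchy v k X \<longrightarrow>
            (\<exists>!c. (\<lambda>n. kahler_sn v k (fsub (X n) (fscale c (dsym t)))) \<longlonglongrightarrow> 0))
       \<and> kahler_sn v k (dsym t) = radius v k t
       \<and> (\<forall>\<pi>\<in>k. 0 < v \<pi> \<and> v \<pi> < 1 \<longrightarrow>
            (\<forall>Y Z. pi_cauchy v k \<pi> Y \<and> pi_cauchy v k \<pi> Z
                 \<and> (\<lambda>n. kahler_sn v k (fsub (Y n) (Z n))) \<longlonglongrightarrow> 0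
               \<longrightarrow> (\<forall>N. \<exists>M. \<forall>n\<ge>M. fsub (Y n) (Z n) \<in> pi_pow_sub v k \<pi> N))
          \<and> (\<forall>X. om_cauchy v k X \<longrightarrow>
               ((\<exists>Y. pi_cauchy v k \<pi> Y \<and> (\<lambda>n. kahler_sn v k (fsub (Y n) (X n))) \<longlonglongrightarrow> 0)
                \<longleftrightarrow> (\<exists>(m::nat) b c. (\<forall>i<m. b i \<in> ring_int v UNIV \<and> c i \<in> k \<and> c i \<noteq> 0
                                  \<and> (\<exists>a\<in>k. v (t - a) \<le> v (c i)))
                      \<and> (\<lambda>n. kahler_sn v k (fsub (X n) (fscale (\<Sum>i<m. b i / c i) (dsym t))))
                          \<longlonglongrightarrow> 0))))"
proof -
  interpret tame_element v k t
    using assms by unfold_locales (auto simp: analytic_k_field_def tame_parameter_def)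
  show ?thesis
    by (intro conjI allI ballI impI; (elim conjE)?)
       (assumption | rule kahler_basis kahler_sn_dt completion_injective integral_image)+
qed

end
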